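(* Let $\mathbb{K}$ be a field of characteristic zero, $d\ge 4$, $R=\mathbb{K}[x_1,\dots,x_d]$, and let $I=\langle x_ix_j,\ x_k^2-x_d^2 \mid i\neq j,\ k\neq d\rangle\subset R$. Let $I(X)\subset W$ be the defining ideal of the special fiber ring $\mathcal{F}(I)$, let $\mathcal{J}\subset S$ be the defining ideal of the Rees algebra $\mathcal{R}(I)$, let $\mathcal{L}\subset S$ be the defining ideal of the symmetric algebra $\mathrm{Sym}(I)$, and let $\Lambda=\Lambda_0+\Lambda_1+\Lambda_2\subset W$ be the ideal constructed in the context. Then $\Lambda=I(X)$, i.e. $\Lambda$ is the defining ideal of $\mathcal{F}(I)$. Further, $\mathcal{J}=\mathcal{L}+\Lambda S$.
   Context: Rings. Put $g_{ij}=x_ix_j$ for $i\ne j$ and $g_{ii}=x_i^2-x_d^2$ for $i\neq d$; these are the minimal generators of $I$. $W=\mathbb{K}[w_{ij}\mid 1\le i\le j\le d,\ (i,j)\ne(d,d)]$ is a polynomial ring with all variables of degree 1, and $S=R[w_{ij}]$ is the polynomial ring over $R$ in the same variables. Conventions: $w_{ji}=w_{ij}$ and $w_{dd}=0$. Blowup algebras. $\mathcal{R}(I)=R[It]$; $\mathcal{J}$ is the kernel of the $R$-algebra surjection $S\to R[It]$, $w_{ij}\mapsto g_{ij}t$. $\mathcal{F}(I)=\mathcal{R}(I)\otimes_R\mathbb{K}$ with $\mathbb{K}=R/(x_1,\dots,x_d)$; $I(X)$ is the kernel of the induced surjection $W\to\mathcal{F}(I)$ (equivalently, since $I$ is generated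 in one degree, the kernel of the $\mathbb{K}$-algebra map $W\to R$, $w_{ij}\mapsto g_{ij}$). $\mathcal{L}$ is the kernel of the surjection $S\to\mathrm{Sym}(I)$ sending $w_{ij}$ to $g_{ij}\in \mathrm{Sym}_1(I)=I$, i.e. the ideal generated by all $\sum c_{ij}w_{ij}$ with $c_{ij}\in R$, $\sum c_{ij}g_{ij}=0$. Minors. $\mathcal{M}=[w_{ij}]$ is the $d\times d$ symmetric matrix with $w_{ij}=w_{ji}$, $w_{dd}=0$. For two-element sets $\{i,j\},\{k,l\}\subseteq\{1,\dots,d\}$, $[ij;kl]$ is the $2\times2$ submatrix of $\mathcal{M}$ with rows $i,j$ and columns $k,l$ (rows and columns in increasing order) and $[ij|kl]$ is its determinant; $[ij]=[ij|ij]$. For $s\in\{0,1,2\}$, $A_s$ is the set of minors $[ij|kl]$ with $|\{i,j\}\cap\{k,l\}|=s$. Two $2\times 2$ submatrices (and their minors) are complementary if there is a $4\times4$ principal submatrix of $\mathcal{M}$, with row and column index set $Q$ ($|Q|=4$), containing both, in which they share no rows and no columns; i.e. their row sets partition $Q$ and their column sets partition $Q$. The ideal $\Lambda$. $\Lambda_0$ is the ideal of $W$ generated by all minors in $A_0$. For a submatrix $m$ with $\det(m)\in A_1$, let $i$ be the unique index that is both a row and a column index of $m$; put $\delta(m)=0$ if the entry in position $(i,i)$ of $\mathcal{M}$ lies on the diagonal of $m$ and $\delta(m)=1$ if it lies on the antidiagonal of $m$. $\Lambda_1$ is generated by all $\det(m)-(-1)^{\delta(m)+\delta(n)}\det(n)$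 with $\det(m),\det(n)\in A_1$ complementary. $\Lambda_2$ is generated by all $(\det(m_1)+\det(n_1))-(\det(m_2)+\det(n_2))$ where $\det(m_1),\det(n_1)\in A_2$ are complementary, $\det(m_2),\det(n_2)\in A_2$ are complementary, and a single $4\times 4$ principal submatrix of $\mathcal{M}$ contains $m_1,n_1,m_2,n_2$. $\Lambda=\Lambda_0+\Lambda_1+\Lambda_2$. *)

theory Defs
  imports "HOL-Algebra.Algebra" "HOL-Algebra.Algebraic_Closure_Type" "HOL-Library.Poly_Mapping" "HOL-Computational_Algebra.Polynomial"
begin

text \<open>
  Polynomials in commuting variables of type \<^typ>\<open>'v\<close> are finitely supported functions on
  monomials, and monomials are finitely supported exponent vectors. All rings below are carriers
  inside such a type (or inside \<^typ>\<open>'a poly\<close>), with the operations of the type.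
\<close>

type_synonym ('v, 'a) mpoly = "('v \<Rightarrow>\<^sub>0 nat) \<Rightarrow>\<^sub>0 'a"

abbreviation ring_on :: "'a::comm_ring_1 set \<Rightarrow> 'a ring" where
  "ring_on C \<equiv> ring_of_type_algebra\<lparr>carrier := C\<rparr>"

definition Var :: "'v \<Rightarrow> ('v, 'a::comm_ring_1) mpoly" where
  "Var v = Poly_Mapping.single (Poly_Mapping.single v 1) 1"

definition Const :: "'a::comm_ring_1 \<Rightarrow> ('v, 'a) mpoly" where
  "Const c = Poly_Mapping.single 0 c"

text \<open>The carrier of \<open>C[V]\<close>, for a subring \<open>C\<close> of the coefficients and a set \<open>V\<close> of variables.\<close>

definition polys :: "'a::comm_ring_1 set \<Rightarrow> 'v set \<Rightarrow> ('v, 'a) mpoly set" where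
  "polys C V = {p. (\<forall>m. Poly_Mapping.lookup p m \<in> C) \<and> (\<forall>m\<in>Poly_Mapping.keys p. Poly_Mapping.keys m \<subseteq> V)}"

text \<open>The homomorphism that acts as \<open>h\<close> on coefficients and sends the variable \<open>v\<close> to \<open>f v\<close>.\<close>

definition eval_mpoly :: "('a::comm_ring_1 \<Rightarrow> 'b::comm_ring_1) \<Rightarrow> ('v \<Rightarrow> 'b) \<Rightarrow> ('v, 'a) mpoly \<Rightarrow> 'b" where
  "eval_mpoly h f p =
     (\<Sum>m\<in>Poly_Mapping.keys p. h (Poly_Mapping.lookup p m) *
        (\<Prod>v\<in>Poly_Mapping.keys m. f v ^ Poly_Mapping.lookup m v))"

subsection \<open>The ring R, the ideal I, and the rings W and S\<close>

text \<open>The field \<open>\<bbbK>\<close> is the type \<^typ>\<open>'k\<close>; the variable \<open>x\<^sub>i\<close> is \<^term>\<open>Var i\<close>.\<close>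

definition R_ring :: "nat \<Rightarrow> (nat, 'k::field) mpoly ring" where
  "R_ring d = ring_on (polys UNIV {1..d})"

definition I_ideal :: "nat \<Rightarrow> (nat, 'k::field) mpoly set" where
  "I_ideal d = genideal (R_ring d)
     ({Var i * Var j | i j. i \<in> {1..d} \<and> j \<in> {1..d} \<and> i \<noteq> j} \<union>
      {(Var k)\<^sup>2 - (Var d)\<^sup>2 | k. k \<in> {1..d} \<and> k \<noteq> d})"

text \<open>Only the indices in \<open>w_index d\<close> give variables \<open>w\<^sub>i\<^sub>j\<close>; there, \<open>i \<le> j\<close>.\<close>

definition w_index :: "nat \<Rightarrow> (nat \<times> nat) set" where
  "w_index d = {(i, j). 1 \<le> i \<and> i \<le> j \<and> j \<le> d \<and> (i, j) \<noteq> (d, d)}"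

definition gen :: "nat \<Rightarrow> nat \<times> nat \<Rightarrow> (nat, 'k::field) mpoly" where
  "gen d = (\<lambda>(i, j). if i = j then (Var i)\<^sup>2 - (Var d)\<^sup>2 else Var i * Var j)"

definition W_ring :: "nat \<Rightarrow> (nat \<times> nat, 'k::field) mpoly ring" where
  "W_ring d = ring_on (polys UNIV (w_index d))"

definition S_ring :: "nat \<Rightarrow> (nat \<times> nat, (nat, 'k::field) mpoly) mpoly ring" where
  "S_ring d = ring_on (polys (carrier (R_ring d)) (w_index d))"

subsection \<open>The Rees algebra\<close>

text \<open>
  \<open>R[t]\<close> is realised in \<^typ>\<open>(nat, 'k::field) mpoly poly\<close>, so that \<open>[:a:]\<close> is the constant \<open>a\<close> and
  \<open>[:0, a:]\<close> is \<open>a t\<close>; \<open>R[It]\<close> is the subring generated by \<open>R\<close> and \<open>It\<close>.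
\<close>

definition Rt_ring :: "nat \<Rightarrow> (nat, 'k::field) mpoly poly ring" where
  "Rt_ring d = ring_on {p. \<forall>n. poly.coeff p n \<in> carrier (R_ring d)}"

definition Rees_ring :: "nat \<Rightarrow> (nat, 'k::field) mpoly poly ring" where
  "Rees_ring d = (Rt_ring d)\<lparr>carrier := generate_ring (Rt_ring d)
     ({[:a:] | a. a \<in> carrier (R_ring d)} \<union> {[:0, a:] | a. a \<in> I_ideal d})\<rparr>"

definition rees_map :: "nat \<Rightarrow> (nat \<times> nat, (nat, 'k::field) mpoly) mpoly \<Rightarrow> (nat, 'k) mpoly poly" where
  "rees_map d = eval_mpoly (\<lambda>a. [:a:]) (\<lambda>ij. [:0, gen d ij:])"

definition J_ideal :: "nat \<Rightarrow> (nat \<times> nat, (nat, 'k::field) mpoly) mpoly set" where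
  "J_ideal d = a_kernel (S_ring d) (Rees_ring d) (rees_map d)"

subsection \<open>The special fiber ring\<close>

text \<open>
  For an ideal \<open>\<mm>\<close> of \<open>R\<close> and an \<open>R\<close>-algebra \<open>A\<close>, the tensor product of \<open>A\<close> with \<open>R/\<mm>\<close>
  over \<open>R\<close> is \<open>A/\<mm>A\<close>; here \<open>A = R[It]\<close> and \<open>\<mm>\<close> is generated by the variables of \<open>R\<close>.
\<close>

definition mRees :: "nat \<Rightarrow> (nat, 'k::field) mpoly poly set" where
  "mRees d = genideal (Rees_ring d) {[:a:] | a. a \<in> genideal (R_ring d) (Var ` {1..d})}"

definition Fiber_ring :: "nat \<Rightarrow> (nat, 'k::field) mpoly poly set ring" where
  "Fiber_ring d = Rees_ring d Quot mRees d"

text \<open>The inclusion of \<open>W = \<bbbK>[w\<^sub>i\<^sub>j]\<close> into \<open>S = R[w\<^sub>i\<^sub>j]\<close>.\<close>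

definition W_to_S :: "(nat \<times> nat, 'k::field) mpoly \<Rightarrow> (nat \<times> nat, (nat, 'k) mpoly) mpoly" where
  "W_to_S = Poly_Mapping.map Const"

definition fiber_map :: "nat \<Rightarrow> (nat \<times> nat, 'k::field) mpoly \<Rightarrow> (nat, 'k) mpoly poly set" where
  "fiber_map d p = mRees d +>\<^bsub>Rees_ring d\<^esub> rees_map d (W_to_S p)"

definition IX_ideal :: "nat \<Rightarrow> (nat \<times> nat, 'k::field) mpoly set" where
  "IX_ideal d = a_kernel (W_ring d) (Fiber_ring d) (fiber_map d)"

subsection \<open>The symmetric algebra\<close>

text \<open>
  \<open>Sym(I)\<close> is the polynomial ring over \<open>R\<close> with one variable \<^term>\<open>Var a\<close> for every element \<open>a\<close> of the
  \<open>R\<close>-module \<open>I\<close>, modulo the relations that make \<^term>\<open>Var\<close> an \<open>R\<close>-linear map.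
\<close>

definition SymP_ring :: "nat \<Rightarrow> ((nat, 'k::field) mpoly, (nat, 'k) mpoly) mpoly ring" where
  "SymP_ring d = ring_on (polys (carrier (R_ring d)) (I_ideal d))"

definition Sym_rels :: "nat \<Rightarrow> ((nat, 'k::field) mpoly, (nat, 'k) mpoly) mpoly set" where
  "Sym_rels d = genideal (SymP_ring d)
     ({Var (a + b) - (Var a + Var b) | a b. a \<in> I_ideal d \<and> b \<in> I_ideal d} \<union>
      {Var (r * a) - Const r * Var a | r a. r \<in> carrier (R_ring d) \<and> a \<in> I_ideal d})"

definition Sym_ring :: "nat \<Rightarrow> ((nat, 'k::field) mpoly, (nat, 'k) mpoly) mpoly set ring" where
  "Sym_ring d = SymP_ring d Quot Sym_rels d"

definition sym_map ::
    "nat \<Rightarrow> (nat \<times> nat, (nat, 'k::field) mpoly) mpoly \<Rightarrow> ((nat, 'k) mpoly, (nat, 'k) mpoly) mpoly set" where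
  "sym_map d p = Sym_rels d +>\<^bsub>SymP_ring d\<^esub> eval_mpoly Const (\<lambda>ij. Var (gen d ij)) p"

definition L_ideal :: "nat \<Rightarrow> (nat \<times> nat, (nat, 'k::field) mpoly) mpoly set" where
  "L_ideal d = a_kernel (S_ring d) (Sym_ring d) (sym_map d)"

subsection \<open>The matrix M and its two-by-two submatrices\<close>

definition M_entry :: "nat \<Rightarrow> nat \<Rightarrow> nat \<Rightarrow> (nat \<times> nat, 'k::field) mpoly" where
  "M_entry d i j = (if i = d \<and> j = d then 0 else Var (min i j, max i j))"

text \<open>
  A two-by-two submatrix is given by its set of rows and its set of columns. The sets \<open>A\<^sub>s\<close> and the
  notion of complementarity are kept on submatrices; \<open>minor\<close> passes to determinants.
\<close>

type_synonym submat = "nat set \<times> nat set"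

definition submats :: "nat \<Rightarrow> submat set" where
  "submats d = {(P, Q). P \<subseteq> {1..d} \<and> card P = 2 \<and> Q \<subseteq> {1..d} \<and> card Q = 2}"

definition minor :: "nat \<Rightarrow> submat \<Rightarrow> (nat \<times> nat, 'k::field) mpoly" where
  "minor d = (\<lambda>(P, Q). M_entry d (Min P) (Min Q) * M_entry d (Max P) (Max Q)
                      - M_entry d (Min P) (Max Q) * M_entry d (Max P) (Min Q))"

definition A_submats :: "nat \<Rightarrow> nat \<Rightarrow> submat set" where
  "A_submats d s = {(P, Q) \<in> submats d. card (P \<inter> Q) = s}"

definition principal_index :: "nat \<Rightarrow> nat set \<Rightarrow> bool" where
  "principal_index d T \<longleftrightarrow> T \<subseteq> {1..d} \<and> card T = 4"

definition inside :: "nat set \<Rightarrow> submat \<Rightarrow> bool" where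
  "inside T m \<longleftrightarrow> fst m \<subseteq> T \<and> snd m \<subseteq> T"

definition complementary :: "nat \<Rightarrow> submat \<Rightarrow> submat \<Rightarrow> bool" where
  "complementary d m n \<longleftrightarrow> (\<exists>T. principal_index d T \<and> inside T m \<and> inside T n \<and>
     fst m \<inter> fst n = {} \<and> snd m \<inter> snd n = {})"

text \<open>
  For \<open>(P, Q)\<close> with a unique common index \<open>i\<close>, the diagonal entry at \<open>(i, i)\<close> is on the diagonal of
  the submatrix iff \<open>i\<close> is the first element of both \<open>P\<close> and \<open>Q\<close>, or the last element of both.
\<close>

definition delta :: "submat \<Rightarrow> nat" where
  "delta = (\<lambda>(P, Q). let i = the_elem (P \<inter> Q) in
     if (i = Min P \<and> i = Min Q) \<or> (i = Max P \<and> i = Max Q) then 0 else 1)"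

subsection \<open>The ideal Lambda\<close>

definition Lambda0 :: "nat \<Rightarrow> (nat \<times> nat, 'k::field) mpoly set" where
  "Lambda0 d = genideal (W_ring d) (minor d ` A_submats d 0)"

definition Lambda1 :: "nat \<Rightarrow> (nat \<times> nat, 'k::field) mpoly set" where
  "Lambda1 d = genideal (W_ring d)
     {minor d m - (-1) ^ (delta m + delta n) * minor d n | m n.
        m \<in> A_submats d 1 \<and> n \<in> A_submats d 1 \<and> complementary d m n}"

definition Lambda2 :: "nat \<Rightarrow> (nat \<times> nat, 'k::field) mpoly set" where
  "Lambda2 d = genideal (W_ring d)
     {(minor d m1 + minor d n1) - (minor d m2 + minor d n2) | m1 n1 m2 n2.
        {m1, n1, m2, n2} \<subseteq> A_submats d 2 \<and> complementary d m1 n1 \<and> complementary d m2 n2 \<and>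
        (\<exists>T. principal_index d T \<and> inside T m1 \<and> inside T n1 \<and> inside T m2 \<and> inside T n2)}"

definition Lambda :: "nat \<Rightarrow> (nat \<times> nat, 'k::field) mpoly set" where
  "Lambda d = Lambda0 d <+>\<^bsub>W_ring d\<^esub> Lambda1 d <+>\<^bsub>W_ring d\<^esub> Lambda2 d"

definition LambdaS :: "nat \<Rightarrow> (nat \<times> nat, (nat, 'k::field) mpoly) mpoly set" where
  "LambdaS d = genideal (S_ring d) (W_to_S ` Lambda d)"

end

theory Submission
  imports Defs
begin

text \<open>
  Modulo \<open>P = L + \<Lambda>S\<close> one reconstructs, from the monomial alone, every element of \<open>S/P\<close>
  that lies over a monomial of the Rees algebra. For \<open>n \<ge> 2\<close> and a multiset \<open>M\<close> of \<open>2n\<close> indices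
  there is an element \<open>F\<^sub>n M\<close> of degree \<open>n\<close> in the \<open>w\<^sub>i\<^sub>j\<close> that stands for the monomial with exponent
  \<open>M\<close>; it satisfies \<open>w\<^sub>i\<^sub>j F\<^sub>n M = F\<^sub>n\<^sub>+\<^sub>1 (M + i + j)\<close>,
  \<open>(w\<^sub>i\<^sub>i - w\<^sub>j\<^sub>j) F\<^sub>n M = F\<^sub>n\<^sub>+\<^sub>1 (M + 2i) - F\<^sub>n\<^sub>+\<^sub>1 (M + 2j)\<close> and
  \<open>x\<^sub>i F\<^sub>n (M + j) = x\<^sub>j F\<^sub>n (M + i)\<close>. Existence is an induction whose start \<open>n = 2\<close> is the only
  place where the quadrics generating \<open>\<Lambda>\<close> are multiplied out. The \<open>F\<^sub>n\<close> assemble to a map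
  \<open>\<psi>\<close> from the Rees algebra to \<open>S/P\<close>, and every \<open>p\<close> in \<open>S\<close> is congruent to a linear form plus
  \<open>\<psi>\<close> of its image. Hence an element of \<open>J\<close> is congruent to a linear syzygy, which lies in \<open>L\<close>.
  The same argument with all \<open>x\<^sub>i\<close> set to \<open>0\<close> gives the fiber ring. The differences
  \<open>w\<^sub>i\<^sub>i - w\<^sub>j\<^sub>j\<close> treat all indices alike, although \<open>w\<^sub>d\<^sub>d = 0\<close> is not a variable.
\<close>

text \<open>The family starts at n = 2 because I is not a monomial ideal: it contains no pure square
  x_i^2. Its square, however, contains every monomial of degree 4. So in degree 1 there is nothing
  to reconstruct, and this is why a linear form survives the reduction. The obstacle is
  well-definedness. A multiset of size r + 2 can be reached from multisets of size r by removing
  different pairs, and pure powers are reached only through differences of squares. All resulting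
  values must agree modulo P. The clauses of \<open>coherent\<close> are exactly the overlaps of
  these ways, stated at size r, so that the values at size r + 2 can be picked by choice;
  \<open>extension_coherent\<close> then recovers the same clauses one level up. The condition 4
  \<le> d enters through \<open>fresh\<close>: given up to three indices there is one more, and the
  quadric relations between four distinct indices become applicable. The relations are used
  abstractly, as congruences modulo an ideal of a whole type. The ideals of S and W live in
  carriers, and are transported to a type as preimages under a ring homomorphism
  \<open>rho\<close>.\<close>

type_synonym 'k rpoly = "(nat, 'k) mpoly"
type_synonym 'k wpoly = "(nat \<times> nat, 'k) mpoly"
type_synonym 'k spoly = "(nat \<times> nat, 'k rpoly) mpoly"
type_synonym 'k sympoly = "('k rpoly, 'k rpoly) mpoly"

abbreviation R_set :: "nat \<Rightarrow> 'k::comm_ring_1 rpoly set" where "R_set d \<equiv> polys UNIV {1..d}"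
abbreviation W_set :: "nat \<Rightarrow> 'k::comm_ring_1 wpoly set" where "W_set d \<equiv> polys UNIV (w_index d)"
abbreviation S_set :: "nat \<Rightarrow> 'k::comm_ring_1 spoly set" where "S_set d \<equiv> polys (R_set d) (w_index d)"
abbreviation Sym_set :: "nat \<Rightarrow> 'k::field sympoly set" where "Sym_set d \<equiv> polys (R_set d) (I_ideal d)"

notation add_mset (infixr \<open>##\<close> 65)

abbreviation "keys \<equiv> Poly_Mapping.keys"
abbreviation "lookup \<equiv> Poly_Mapping.lookup"
abbreviation "single \<equiv> Poly_Mapping.single"

subsection \<open>Coherent families\<close>

text \<open>An ideal of the whole type instead of a carrier: congruences then carry no membership
  side conditions, and identities between their sides are plain ring identities.\<close>

locale type_ideal =
  fixes P :: "'a::comm_ring_1 set"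
  assumes zero_mem: "0 \<in> P"
    and add_mem: "\<lbrakk>a \<in> P; b \<in> P\<rbrakk> \<Longrightarrow> a + b \<in> P"
    and mult_mem: "a \<in> P \<Longrightarrow> c * a \<in> P"
begin

abbreviation eqv :: "'a \<Rightarrow> 'a \<Rightarrow> bool" (infix \<open>\<doteq>\<close> 50)
  where "a \<doteq> b \<equiv> a - b \<in> P"

text \<open>These rules take a certificate: the difference of the two sides is a combination of
  known congruences with explicit cofactors \<open>cp\<close>, \<open>cq\<close>, and so on. What
  remains is an identity in a commutative ring, left to \<open>algebra_simps\<close>.\<close>

lemma eqvI1: "\<lbrakk>p \<doteq> p'; a - b = cp * (p - p')\<rbrakk> \<Longrightarrow> a \<doteq> b"
  by (simp add: mult_mem)

lemma eqvI2: "\<lbrakk>p \<doteq> p'; q \<doteq> q'; a - b = cp * (p - p') + cq * (q - q')\<rbrakk> \<Longrightarrow> a \<doteq> b"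
  by (simp add: mult_mem add_mem)

lemma eqvI3:
  "\<lbrakk>p \<doteq> p'; q \<doteq> q'; r \<doteq> r'; a - b = cp * (p - p') + cq * (q - q') + cr * (r - r')\<rbrakk> \<Longrightarrow> a \<doteq> b"
  by (simp add: mult_mem add_mem)

lemma eqvI4:
  "\<lbrakk>p \<doteq> p'; q \<doteq> q'; r \<doteq> r'; s \<doteq> s';
    a - b = cp * (p - p') + cq * (q - q') + cr * (r - r') + cs * (s - s')\<rbrakk> \<Longrightarrow> a \<doteq> b"
  by (simp add: mult_mem add_mem)

lemma eqvI5:
  "\<lbrakk>p \<doteq> p'; q \<doteq> q'; r \<doteq> r'; s \<doteq> s'; t \<doteq> t';
    a - b = cp * (p - p') + cq * (q - q') + cr * (r - r') + cs * (s - s') + ct * (t - t')\<rbrakk> \<Longrightarrow> a \<doteq> b"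
  by (simp add: mult_mem add_mem)

declare zero_mem [simp]
lemma eqvI6:
  "\<lbrakk>p \<doteq> p'; q \<doteq> q'; r \<doteq> r'; s \<doteq> s'; t \<doteq> t'; u \<doteq> u';
    a - b = cp * (p - p') + cq * (q - q') + cr * (r - r') + cs * (s - s') + ct * (t - t') + cu * (u - u')\<rbrakk> \<Longrightarrow> a \<doteq> b"
  by (simp add: mult_mem add_mem)

lemma eqv_refl: "a \<doteq> a" by simp
lemma eqv_sym: "a \<doteq> b \<Longrightarrow> b \<doteq> a" by (erule eqvI1[where cp = "-1"]) simp
lemma eqv_trans [trans]: "\<lbrakk>a \<doteq> b; b \<doteq> c\<rbrakk> \<Longrightarrow> a \<doteq> c"
  by (rule eqvI2[of a b b c _ _ 1 1]) simp_all
lemma eqv_eq_trans [trans]: "\<lbrakk>a \<doteq> b; b = c\<rbrakk> \<Longrightarrow> a \<doteq> c" "\<lbrakk>a = b; b \<doteq> c\<rbrakk> \<Longrightarrow> a \<doteq> c" by simp_all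
lemma eqv_add: "\<lbrakk>a \<doteq> b; c \<doteq> d\<rbrakk> \<Longrightarrow> a + c \<doteq> b + d"
  by (erule eqvI2[where cp = 1 and cq = 1]) simp_all
lemma eqv_mult: "a \<doteq> b \<Longrightarrow> c * a \<doteq> c * b"
  by (erule eqvI1[where cp = c]) (simp add: algebra_simps)

end

text \<open>\<open>xw\<close> and \<open>xE\<close> are linear syzygies of the generators of I;
  \<open>ww\<close>, \<open>wE\<close> and \<open>EE\<close> are what the generators of
  \<open>Lambda\<close> from \<open>A_submats\<close> with s = 0, 1, 2 provide.\<close>

locale quadric_relations = type_ideal P for P :: "'a::comm_ring_1 set" +
  fixes D :: "nat set" and x :: "nat \<Rightarrow> 'a" and w :: "nat \<Rightarrow> nat \<Rightarrow> 'a"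
  assumes finite_D: "finite D" and card_D: "4 \<le> card D"
    and w_sym: "w i j = w j i"
    and xw: "\<lbrakk>{i, j, k} \<subseteq> D; distinct [i, j, k]\<rbrakk> \<Longrightarrow> x i * w j k \<doteq> x j * w i k"
    and xE: "\<lbrakk>{i, j, k} \<subseteq> D; distinct [i, j, k]\<rbrakk> \<Longrightarrow>
      x k * (w i i - w j j) \<doteq> x i * w i k - x j * w j k"
    and ww: "\<lbrakk>{i, j, k, l} \<subseteq> D; distinct [i, j, k, l]\<rbrakk> \<Longrightarrow> w i j * w k l \<doteq> w i k * w j l"
    and wE: "\<lbrakk>{i, j, k, l} \<subseteq> D; distinct [i, j, k, l]\<rbrakk> \<Longrightarrow>
      w j k * (w i i - w l l) \<doteq> w i j * w i k - w l j * w l k"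
    and EE: "\<lbrakk>{i, j, k, l} \<subseteq> D; distinct [i, j, k, l]\<rbrakk> \<Longrightarrow>
      (w i i - w l l) * (w j j - w k k) \<doteq> w i j * w i j + w k l * w k l - w i k * w i k - w j l * w j l"
begin

abbreviation E :: "nat \<Rightarrow> nat \<Rightarrow> 'a" where "E i j \<equiv> w i i - w j j"

abbreviation on_D :: "nat multiset \<Rightarrow> bool" where "on_D M \<equiv> set_mset M \<subseteq> D"

lemma fresh: assumes "finite B" "card B < 4" obtains m where "m \<in> D" "m \<notin> B"
proof -
  have "\<not> D \<subseteq> B" using card_mono[of B D] card_D assms by auto
  then show ?thesis using that by blast
qed

text \<open>The last three clauses are necessary for an extension to size r + 2. Both sides of the
  second stand for the monomial i + j + k + h; those of the third for the difference of j + j + i +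
  h and m + m + i + h; those of the fourth for the difference of 3i + j + h and i + 3j + h.\<close>

definition coherent :: "nat \<Rightarrow> (nat multiset \<Rightarrow> 'a) \<Rightarrow> bool" where
  "coherent r F \<longleftrightarrow>
    (\<forall>i j h. {i, j} \<subseteq> D \<longrightarrow> i \<noteq> j \<longrightarrow> on_D h \<longrightarrow> Suc (size h) = r \<longrightarrow>
       x i * F (j ## h) \<doteq> x j * F (i ## h)) \<and>
    (\<forall>i j k h. {i, j, k} \<subseteq> D \<longrightarrow> distinct [i, j, k] \<longrightarrow> on_D h \<longrightarrow> Suc (size h) = r \<longrightarrow>
       w j k * F (i ## h) \<doteq> w i k * F (j ## h)) \<and>
    (\<forall>i j m h. {i, j, m} \<subseteq> D \<longrightarrow> distinct [i, j, m] \<longrightarrow> on_D h \<longrightarrow> Suc (size h) = r \<longrightarrow>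
       E j m * F (i ## h) \<doteq> w i j * F (j ## h) - w i m * F (m ## h)) \<and>
    (\<forall>i j h. {i, j} \<subseteq> D \<longrightarrow> i \<noteq> j \<longrightarrow> on_D h \<longrightarrow> Suc (Suc (size h)) = r \<longrightarrow>
       E i j * F (i ## j ## h) \<doteq>
       w i j * (F (i ## i ## h) - F (j ## j ## h)))"

definition extends :: "nat \<Rightarrow> (nat multiset \<Rightarrow> 'a) \<Rightarrow> (nat multiset \<Rightarrow> 'a) \<Rightarrow> bool" where
  "extends r F F' \<longleftrightarrow>
    (\<forall>i j f. {i, j} \<subseteq> D \<longrightarrow> i \<noteq> j \<longrightarrow> on_D f \<longrightarrow> size f = r \<longrightarrow>
       F' (i ## j ## f) \<doteq> w i j * F f \<and>
       F' (i ## i ## f) - F' (j ## j ## f) \<doteq> E i j * F f)"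

lemma coherentD:
  assumes "coherent r F"
  shows "\<lbrakk>{i, j} \<subseteq> D; i \<noteq> j; on_D h; Suc (size h) = r\<rbrakk> \<Longrightarrow>
       x i * F (j ## h) \<doteq> x j * F (i ## h)"
    and "\<lbrakk>{i, j, k} \<subseteq> D; distinct [i, j, k]; on_D h; Suc (size h) = r\<rbrakk> \<Longrightarrow>
       w j k * F (i ## h) \<doteq> w i k * F (j ## h)"
    and "\<lbrakk>{i, j, m} \<subseteq> D; distinct [i, j, m]; on_D h; Suc (size h) = r\<rbrakk> \<Longrightarrow>
       E j m * F (i ## h) \<doteq> w i j * F (j ## h) - w i m * F (m ## h)"
    and "\<lbrakk>{i, j} \<subseteq> D; i \<noteq> j; on_D h; Suc (Suc (size h)) = r\<rbrakk> \<Longrightarrow>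
       E i j * F (i ## j ## h) \<doteq>
       w i j * (F (i ## i ## h) - F (j ## j ## h))"
  using assms unfolding coherent_def by blast+

lemma extendsD:
  assumes "extends r F F'" "{i, j} \<subseteq> D" "i \<noteq> j" "on_D f" "size f = r"
  shows "F' (i ## j ## f) \<doteq> w i j * F f"
    and "F' (i ## i ## f) - F' (j ## j ## f) \<doteq> E i j * F f"
  using assms unfolding extends_def by blast+

text \<open>Pairs with a common index differ by one use of the second clause of
  \<open>coherent\<close> (\<open>share\<close>). Disjoint pairs are connected through the mixed
  pair of \<open>i\<close> and \<open>k\<close>.\<close>

lemma pair_exchange:
  assumes F: "coherent r F" and D: "{i, j, k, l} \<subseteq> D" and ij: "i \<noteq> j" and kl: "k \<noteq> l"
    and f: "on_D f" "size f = r"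
    and eq: "i ## j ## f = k ## l ## f'"
  shows "w i j * F f \<doteq> w k l * F f'"
proof -
  have share: "w p q * F f \<doteq> w p s * F f'"
    if "{p, q, s} \<subseteq> D" "p \<noteq> q" "p \<noteq> s" "p ## q ## f = p ## s ## f'" for p q s
  proof (cases "q = s")
    case False
    have "q ## f = s ## f'" using that(4) by simp
    then obtain h where h: "f = s ## h" "f' = q ## h"
      using False by (metis add_eq_conv_ex)
    have "w q p * F (s ## h) \<doteq> w s p * F (q ## h)"
      using that(1-3) f h False by (intro coherentD(2)[OF F]) auto
    then show ?thesis by (simp add: h w_sym[of p])
  qed (use that in auto)
  have eqs: "i ## j ## f = l ## k ## f'"
    "j ## i ## f = k ## l ## f'"
    "j ## i ## f = l ## k ## f'"
    using eq by (simp_all only: add_mset_commute[of j i] add_mset_commute[of l k])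
  consider "i = k" | "i = l" | "j = k" | "j = l" | "i \<noteq> k" "i \<noteq> l" "j \<noteq> k" "j \<noteq> l" by blast
  then show ?thesis
  proof cases
    case 1
    then have "w i j * F f \<doteq> w i l * F f'" using D ij kl eq by (intro share) auto
    then show ?thesis using 1 by simp
  next
    case 2
    then have "w i j * F f \<doteq> w i k * F f'" using D ij kl eqs(1) by (intro share) auto
    then show ?thesis using 2 w_sym[of i k] by simp
  next
    case 3
    then have "w j i * F f \<doteq> w j l * F f'" using D ij kl eqs(2) by (intro share) auto
    then show ?thesis using 3 w_sym[of i j] by simp
  next
    case 4
    then have "w j i * F f \<doteq> w j k * F f'" using D ij kl eqs(3) by (intro share) auto
    then show ?thesis using 4 w_sym[of i j] w_sym[of k l] by simp
  next
    case 5
    have "k \<in># i ## j ## f" unfolding eq by simp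
    then have "k \<in># f" using 5 by auto
    then obtain u where u: "f = k ## u" by (metis insert_DiffM)
    have "k ## i ## j ## u = k ## l ## f'"
      using eq unfolding u add_mset_commute[of j k] add_mset_commute[of i k] .
    then have eq2: "i ## j ## u = l ## f'" by simp
    have "l \<in># i ## j ## u" unfolding eq2 by simp
    then have "l \<in># u" using 5 by auto
    then obtain h where h: "u = l ## h" by (metis insert_DiffM)
    have "l ## i ## j ## h = l ## f'"
      using eq2 unfolding h add_mset_commute[of j l] add_mset_commute[of i l] .
    then have f': "f' = i ## j ## h" by simp
    have "w j i * F (k ## l ## h) \<doteq> w k i * F (j ## l ## h)"
      using 5 D ij f h u by (intro coherentD(2)[OF F]) auto
    moreover have "w i k * F (l ## j ## h) \<doteq> w l k * F (i ## j ## h)"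
      using 5 D kl f h u by (intro coherentD(2)[OF F]) auto
    ultimately show ?thesis
      unfolding h f' u w_sym[of j i] w_sym[of k i] w_sym[of l k] add_mset_commute[of j l]
      by (rule eqv_trans)
  qed
qed

lemma multiset_pair_or_replicate:
  obtains i j f where "g = i ## j ## f" "i \<noteq> j" | i where "g = replicate_mset (size g) i"
proof (cases "\<exists>i. set_mset g \<subseteq> {i}")
  case True
  then obtain i where "set_mset g \<subseteq> {i}" by blast
  then have "g = replicate_mset (size g) i" by (rule set_mset_subset_singletonD)
  then show ?thesis using that(2) by blast
next
  case False
  then have "\<not> set_mset g \<subseteq> {undefined}" by blast
  then obtain i where i: "i \<in># g" by blast
  have "\<not> set_mset g \<subseteq> {i}" using False by blast
  then obtain j where j: "j \<in># g" "i \<noteq> j" by blast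
  obtain f where f: "g = i ## f" using multi_member_split[OF i] by blast
  then have "j \<in># f" using j by simp
  then obtain h where "f = j ## h" using multi_member_split by metis
  then show ?thesis using that(1) f j(2) by blast
qed

text \<open>A multiset with two different indices takes its value from removing such a pair. A pure
  power has no such pair and uses x_i^3 h = (x_i^2 - x_j^2) x_i h + (x_i x_j) x_j h.
  \<open>good\<close> collects the demands of all these ways at once; a single value that meets them
  all makes the choice harmless.\<close>

lemma extension_exists:
  assumes F: "coherent r F" and r: "1 \<le> r"
  shows "\<exists>F'. extends r F F'"
proof -
  define good where "good g y \<longleftrightarrow>
    (\<forall>i j f. {i, j} \<subseteq> D \<longrightarrow> i \<noteq> j \<longrightarrow> g = i ## j ## f \<longrightarrow> y \<doteq> w i j * F f) \<and>
    (\<forall>i j h. {i, j} \<subseteq> D \<longrightarrow> i \<noteq> j \<longrightarrow> g = i ## i ## i ## h \<longrightarrow> set_mset h \<subseteq> {i} \<longrightarrow>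
       y \<doteq> E i j * F (i ## h) + w i j * F (j ## h))" for g y
  define F' where "F' g = (SOME y. good g y)" for g
  have ex: "\<exists>y. good g y" if g: "on_D g" "size g = Suc (Suc r)" for g
  proof (cases rule: multiset_pair_or_replicate[of g])
    case (1 i j f)
    have ij: "{i, j} \<subseteq> D" "on_D f" "size f = r" using 1 g by auto
    have "good g (w i j * F f)" unfolding good_def
    proof (intro conjI allI impI)
      fix k l f' assume "{k, l} \<subseteq> D" "k \<noteq> l" "g = k ## l ## f'"
      then show "w i j * F f \<doteq> w k l * F f'"
        using 1 ij by (intro pair_exchange[OF F]) simp_all
    next
      fix k l h assume "g = k ## k ## k ## h" "set_mset h \<subseteq> {k}"
      then have "set_mset g \<subseteq> {k}" by auto
      moreover have "i \<in># g" "j \<in># g" using 1 by simp_all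
      ultimately have "i = j" by blast
      then show "w i j * F f \<doteq> E k l * F (k ## h) + w k l * F (l ## h)"
        using 1 by simp
    qed
    then show ?thesis by blast
  next
    case (2 i)
    \<comment> \<open>The subtraction is exact since \<open>1 \<le> r\<close>: of r + 2 copies of
      \<open>i\<close>, three are split off.\<close>
    define h where "h = replicate_mset (r - 1) i"
    have "g = replicate_mset (Suc (Suc r)) i" using 2 g by simp
    then have gi: "g = i ## i ## i ## h"
      using r unfolding h_def by (cases r) auto
    then have sg: "set_mset g \<subseteq> {i}" by (auto simp: h_def)
    have i: "i \<in> D" using gi g by simp
    obtain j where j: "j \<in> D" "j \<noteq> i" using fresh[of "{i}"] by auto
    have "good g (E i j * F (i ## h) + w i j * F (j ## h))" unfolding good_def
    proof (intro conjI allI impI)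
      fix k l f' assume "k \<noteq> l" "g = k ## l ## f'"
      then have "k \<in># g" "l \<in># g" by auto
      then have "k = i" "l = i" using sg by auto
      then show "E i j * F (i ## h) + w i j * F (j ## h) \<doteq> w k l * F f'" using \<open>k \<noteq> l\<close> by simp
    next
      fix k l h' assume kl: "{k, l} \<subseteq> D" "k \<noteq> l" and gk: "g = k ## k ## k ## h'"
      have "k \<in># g" using gk by simp
      then have k: "k = i" using sg by auto
      then have h': "h' = h" using gk gi by simp
      show "E i j * F (i ## h) + w i j * F (j ## h) \<doteq> E k l * F (k ## h') + w k l * F (l ## h')"
      proof (cases "j = l")
        case False
        have "on_D h" "Suc (size h) = r" using gi g by auto
        then have "E j l * F (i ## h) \<doteq> w i j * F (j ## h) - w i l * F (l ## h)"
          using False kl k i j by (intro coherentD(3)[OF F]) auto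
        then show ?thesis unfolding h' k
          by (rule eqvI1[where cp = "-1"]) (simp add: algebra_simps)
      qed (simp add: k h')
    qed
    then show ?thesis by blast
  qed
  have good: "good g (F' g)" if "on_D g" "size g = Suc (Suc r)" for g
    unfolding F'_def by (rule someI_ex[OF ex[OF that]])
  have E1: "F' (i ## j ## f) \<doteq> w i j * F f"
    if "{i, j} \<subseteq> D" "i \<noteq> j" "on_D f" "size f = r" for i j f
  proof -
    have "good (i ## j ## f) (F' (i ## j ## f))"
      using that by (intro good) auto
    then show ?thesis using that unfolding good_def by blast
  qed
  have E2: "F' (i ## i ## f) - F' (j ## j ## f) \<doteq> E i j * F f"
    if ij: "{i, j} \<subseteq> D" "i \<noteq> j" and f: "on_D f" "size f = r" for i j f
  proof -
    have pure: "F' (p ## p ## f) - F' (q ## q ## f) \<doteq> E p q * F f"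
      if pq: "{p, q} \<subseteq> D" "p \<noteq> q" and "set_mset f \<subseteq> {p}" for p q
    proof -
      have "f = replicate_mset r p" using set_mset_subset_singletonD[OF that(3)] f by simp
      then obtain h where h: "f = p ## h" "set_mset h \<subseteq> {p}" "Suc (size h) = r" using r by (cases r) auto
      have "F' (p ## p ## f) \<doteq> E p q * F (p ## h) + w p q * F (q ## h)"
      proof -
        have "good (p ## p ## p ## h) (F' (p ## p ## p ## h))"
          using pq h f by (intro good) auto
        then show ?thesis using pq h unfolding good_def h(1) by blast
      qed
      moreover have "F' (p ## q ## q ## h) \<doteq> w p q * F (q ## h)"
        using pq h by (intro E1) auto
      ultimately show ?thesis unfolding h add_mset_commute[of q p]
        by (rule eqvI2[where cp = 1 and cq = "-1"]) (simp add: algebra_simps add_mset_commute)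
    qed
    \<comment> \<open>Pure powers occur only in the first two cases. Otherwise both values come from
      removing a pair: with a third index \<open>k\<close> in \<open>f\<close> it is paired with
      \<open>i\<close> on one side and with \<open>j\<close> on the other, and the third clause of
      \<open>coherent\<close> compares; with both \<open>i\<close> and \<open>j\<close> in
      \<open>f\<close> the pair is i, j on both sides, and the fourth clause compares.\<close>
    consider "set_mset f \<subseteq> {i}" | "set_mset f \<subseteq> {j}" | k where "k \<in># f" "k \<noteq> i" "k \<noteq> j"
      | "i \<in># f" "j \<in># f" by blast
    then show ?thesis
    proof cases
      case 1 then show ?thesis using pure ij by blast
    next
      case 2
      then have "F' (j ## j ## f) - F' (i ## i ## f) \<doteq> E j i * F f"
        using pure ij by auto
      then show ?thesis by (rule eqvI1[where cp = "-1"]) (simp add: algebra_simps)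
    next
      case 3
      then obtain h where h: "f = k ## h" by (metis insert_DiffM)
      have "F' (i ## k ## i ## h) \<doteq> w i k * F (i ## h)"
        "F' (j ## k ## j ## h) \<doteq> w j k * F (j ## h)"
        using 3 ij f h by (auto intro!: E1)
      moreover have "E i j * F (k ## h) \<doteq> w k i * F (i ## h) - w k j * F (j ## h)"
        using 3 ij f h by (intro coherentD(3)[OF F]) auto
      ultimately show ?thesis unfolding h add_mset_commute[of i k] add_mset_commute[of j k] w_sym[of k]
        by (rule eqvI3[where cp = 1 and cq = "-1" and cr = "-1"]) (simp add: algebra_simps add_mset_commute)
    next
      case 4
      then obtain u where u: "f = i ## u" by (metis insert_DiffM)
      then have "j \<in># u" using 4 ij by auto
      then obtain h where h: "f = i ## j ## h" using u by (metis insert_DiffM)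
      have "F' (i ## j ## i ## i ## h) \<doteq> w i j * F (i ## i ## h)"
        "F' (i ## j ## j ## j ## h) \<doteq> w i j * F (j ## j ## h)"
        using ij f h by (auto intro!: E1)
      moreover have "E i j * F (i ## j ## h) \<doteq> w i j * (F (i ## i ## h) - F (j ## j ## h))"
        using ij f h by (intro coherentD(4)[OF F]) auto
      ultimately show ?thesis unfolding h
        by (rule eqvI3[where cp = 1 and cq = "-1" and cr = "-1"]) (simp add: algebra_simps add_mset_commute)
    qed
  qed
  show ?thesis
  proof (rule exI[where x = F'])
    show "extends r F F'"
      unfolding extends_def by (intro allI impI conjI E1 E2) assumption+
  qed
qed

text \<open>In the first three clauses a pair is taken off \<open>h\<close>. Two distinct indices
  reduce the clause for \<open>F'\<close> to the same clause for \<open>F\<close>. A repeated index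
  leaves by \<open>shift\<close> an additional term, and comparing these terms is an instance of
  \<open>xw\<close>, \<open>ww\<close> or \<open>wE\<close>. The fourth clause is formal: both sides
  reduce to E_ij w_ij F(h).\<close>

lemma extension_coherent:
  assumes F: "coherent r F" and F': "extends r F F'" and r: "1 \<le> r"
  shows "coherent (Suc (Suc r)) F'"
proof -
  note E1 = extendsD(1)[OF F'] and E2 = extendsD(2)[OF F']
  have pair: "F' (a ## p ## q ## g) \<doteq> w p q * F (a ## g)"
    if "{a, p, q} \<subseteq> D" "p \<noteq> q" "on_D g" "Suc (size g) = r" for a p q g
  proof -
    have "F' (p ## q ## a ## g) \<doteq> w p q * F (a ## g)"
      using that by (intro E1) auto
    then show ?thesis by (simp add: add_mset_commute)
  qed
  \<comment> \<open>a repeated index \<open>p\<close> is traded for a fresh \<open>m\<close>, so that later steps only meet products \<open>w a m\<close> with \<open>a \<noteq> m\<close>\<close>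
  have shift: "F' (a ## p ## p ## g) \<doteq> E p m * F (a ## g) + w a m * F (m ## g)"
    if "{a, p, m} \<subseteq> D" "m \<noteq> a" "on_D g" "Suc (size g) = r" for a p m g
  proof -
    have a: "F' (m ## m ## a ## g) \<doteq> w a m * F (m ## g)"
      using pair[of m a m g] that by (simp add: add_mset_commute)
    show ?thesis
    proof (cases "p = m")
      case False
      have "F' (p ## p ## a ## g) - F' (m ## m ## a ## g) \<doteq> E p m * F (a ## g)"
        using that False by (intro E2) auto
      from eqv_add[OF this a] show ?thesis by (simp add: add_mset_commute)
    qed (use a in \<open>simp add: add_mset_commute\<close>)
  qed
  have split: thesis
    if "on_D h" "Suc (size h) = Suc (Suc r)"
      and "\<And>p q g. \<lbrakk>{p, q} \<subseteq> D; p \<noteq> q; on_D g; Suc (size g) = r; h = (p ## q ## g)\<rbrakk> \<Longrightarrow> thesis"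
      and "\<And>p g. \<lbrakk>p \<in> D; on_D g; Suc (size g) = r; h = (p ## p ## g)\<rbrakk> \<Longrightarrow> thesis" for h thesis
  proof (cases rule: multiset_pair_or_replicate[of h])
    case (1 p q g)
    then show ?thesis using that(1,2) by (intro that(3)[of p q g]) auto
  next
    case (2 p)
    then have "h = replicate_mset (Suc r) p" using that by simp
    then have "h = (p ## p ## (replicate_mset (r - 1) p))" using r by (cases r) auto
    then show ?thesis using that(1,2) by (intro that(4)[of p "replicate_mset (r - 1) p"]) auto
  qed
  show ?thesis unfolding coherent_def
  proof (intro conjI allI impI)
    fix i j h assume ij: "{i, j} \<subseteq> D" "i \<noteq> j" and h: "on_D h" "Suc (size h) = Suc (Suc r)"
    from h show "x i * F' (j ## h) \<doteq> x j * F' (i ## h)"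
    proof (rule split)
      fix p q g assume g: "{p, q} \<subseteq> D" "p \<noteq> q" "on_D g" "Suc (size g) = r" "h = p ## q ## g"
      have "x i * F (j ## g) \<doteq> x j * F (i ## g)" using g ij by (intro coherentD(1)[OF F]) auto
      moreover have "F' (j ## p ## q ## g) \<doteq> w p q * F (j ## g)"
        "F' (i ## p ## q ## g) \<doteq> w p q * F (i ## g)"
        using ij g by (auto intro!: pair)
      ultimately show ?thesis unfolding g(5)
        by (rule eqvI3[where cp = "w p q" and cq = "x i" and cr = "- x j"]) (simp add: algebra_simps)
    next
      fix p g assume g: "p \<in> D" "on_D g" "Suc (size g) = r" "h = p ## p ## g"
      obtain m where m: "m \<in> D" "m \<notin> {i, j}" using fresh[of "{i, j}"] ij by auto
      have c: "x i * F (j ## g) \<doteq> x j * F (i ## g)" using g ij by (intro coherentD(1)[OF F]) auto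
      have b: "x i * w j m \<doteq> x j * w i m" using ij m by (intro xw) auto
      have s0: "F' (j ## p ## p ## g) \<doteq> E p m * F (j ## g) + w j m * F (m ## g)" using ij g m by (intro shift) auto
      have s1: "F' (i ## p ## p ## g) \<doteq> E p m * F (i ## g) + w i m * F (m ## g)" using ij g m by (intro shift) auto
      show ?thesis unfolding g(4)
        by (rule eqvI4[OF s0 s1 c b, where cp = "x i" and cq = "- x j" and cr = "E p m" and cs = "F (m ## g)"]) (simp add: algebra_simps)
    qed
  next
    fix i j k h assume ij: "{i, j, k} \<subseteq> D" "distinct [i, j, k]" and h: "on_D h" "Suc (size h) = Suc (Suc r)"
    from h show "w j k * F' (i ## h) \<doteq> w i k * F' (j ## h)"
    proof (rule split)
      fix p q g assume g: "{p, q} \<subseteq> D" "p \<noteq> q" "on_D g" "Suc (size g) = r" "h = p ## q ## g"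
      have "w j k * F (i ## g) \<doteq> w i k * F (j ## g)" using g ij by (intro coherentD(2)[OF F]) auto
      moreover have "F' (i ## p ## q ## g) \<doteq> w p q * F (i ## g)"
        "F' (j ## p ## q ## g) \<doteq> w p q * F (j ## g)"
        using ij g by (auto intro!: pair)
      ultimately show ?thesis unfolding g(5)
        by (rule eqvI3[where cp = "w p q" and cq = "w j k" and cr = "- w i k"]) (simp add: algebra_simps)
    next
      fix p g assume g: "p \<in> D" "on_D g" "Suc (size g) = r" "h = p ## p ## g"
      obtain m where m: "m \<in> D" "m \<notin> {i, j, k}" using fresh[of "{i, j, k}"] ij by (auto simp: card_insert_if)
      have c: "w j k * F (i ## g) \<doteq> w i k * F (j ## g)" using g ij by (intro coherentD(2)[OF F]) auto
      have b: "w k j * w i m \<doteq> w k i * w j m" using ij m by (intro ww) auto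
      have s0: "F' (i ## p ## p ## g) \<doteq> E p m * F (i ## g) + w i m * F (m ## g)" using ij g m by (intro shift) auto
      have s1: "F' (j ## p ## p ## g) \<doteq> E p m * F (j ## g) + w j m * F (m ## g)" using ij g m by (intro shift) auto
      show ?thesis unfolding g(4)
        by (rule eqvI4[OF s0 s1 c b, where cp = "w j k" and cq = "- w i k" and cr = "E p m" and cs = "F (m ## g)"]) (simp add: algebra_simps w_sym)
    qed
  next
    fix i j m h assume ij: "{i, j, m} \<subseteq> D" "distinct [i, j, m]" and h: "on_D h" "Suc (size h) = Suc (Suc r)"
    from h show "E j m * F' (i ## h) \<doteq> w i j * F' (j ## h) - w i m * F' (m ## h)"
    proof (rule split)
      fix p q g assume g: "{p, q} \<subseteq> D" "p \<noteq> q" "on_D g" "Suc (size g) = r" "h = p ## q ## g"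
      have c: "E j m * F (i ## g) \<doteq> w i j * F (j ## g) - w i m * F (m ## g)"
        using g ij by (intro coherentD(3)[OF F]) auto
      have s0: "F' (i ## p ## q ## g) \<doteq> w p q * F (i ## g)" using ij g by (intro pair) auto
      have s1: "F' (j ## p ## q ## g) \<doteq> w p q * F (j ## g)" using ij g by (intro pair) auto
      have s2: "F' (m ## p ## q ## g) \<doteq> w p q * F (m ## g)" using ij g by (intro pair) auto
      show ?thesis unfolding g(5)
        by (rule eqvI4[OF s0 s1 s2 c, where cp = "E j m" and cq = "- w i j" and cr = "w i m" and cs = "w p q"]) (simp add: algebra_simps)
    next
      fix p g assume g: "p \<in> D" "on_D g" "Suc (size g) = r" "h = p ## p ## g"
      obtain l where l: "l \<in> D" "l \<notin> {i, j, m}" using fresh[of "{i, j, m}"] ij by (auto simp: card_insert_if)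
      have c: "E j m * F (i ## g) \<doteq> w i j * F (j ## g) - w i m * F (m ## g)"
        using g ij by (intro coherentD(3)[OF F]) auto
      have b: "w i l * E j m \<doteq> w j i * w j l - w m i * w m l" using ij l by (intro wE) auto
      have s0: "F' (i ## p ## p ## g) \<doteq> E p l * F (i ## g) + w i l * F (l ## g)" using ij g l by (intro shift) auto
      have s1: "F' (j ## p ## p ## g) \<doteq> E p l * F (j ## g) + w j l * F (l ## g)" using ij g l by (intro shift) auto
      have s2: "F' (m ## p ## p ## g) \<doteq> E p l * F (m ## g) + w m l * F (l ## g)" using ij g l by (intro shift) auto
      show ?thesis unfolding g(4)
        by (rule eqvI5[OF s0 s1 s2 c b, where cp = "E j m" and cq = "- w i j" and cr = "w i m" and cs = "E p l" and ct = "F (l ## g)"]) (simp add: algebra_simps w_sym)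
    qed
  next
    fix i j h assume ij: "{i, j} \<subseteq> D" "i \<noteq> j" and h: "on_D h" "Suc (Suc (size h)) = Suc (Suc r)"
    show "E i j * F' (i ## j ## h) \<doteq>
       w i j * (F' (i ## i ## h) - F' (j ## j ## h))"
      by (rule eqvI2[OF E1[OF ij, of h] E2[OF ij, of h], where cp = "E i j" and cq = "- w i j"])
         (use h in simp_all, simp add: algebra_simps)
  qed
qed

end

section \<open>Degree two: values on the monomials of degree 4\<close>

lemma mset3_cases:
  assumes "{#a, b, c#} = {#i, j, k#}"
  shows "(a, b, c) \<in> {(i, j, k), (i, k, j), (j, i, k), (j, k, i), (k, i, j), (k, j, i)}"
  using assms by (auto simp: add_eq_conv_ex single_is_union)

lemma mset4_cases:
  assumes eq: "{#a, b, c, d#} = {#i, j, k, l#}"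
  shows "a = i \<and> {#b, c, d#} = {#j, k, l#} \<or> a = j \<and> {#b, c, d#} = {#i, k, l#} \<or>
         a = k \<and> {#b, c, d#} = {#i, j, l#} \<or> a = l \<and> {#b, c, d#} = {#i, j, k#}"
proof -
  have "{#i, j, k, l#} = {#j, i, k, l#}" "{#i, j, k, l#} = {#k, i, j, l#}" "{#i, j, k, l#} = {#l, i, j, k#}"
    by simp_all
  moreover have "a \<in># {#i, j, k, l#}" unfolding eq[symmetric] by simp
  then have "a = i \<or> a = j \<or> a = k \<or> a = l" by auto
  ultimately show ?thesis using eq by (metis add_mset_add_mset_same_iff)
qed

context quadric_relations begin

lemma fresh3: obtains m where "m \<in> D" "m \<noteq> i" "m \<noteq> j" "m \<noteq> k"
proof -
  have "card {i, j, k} < 4" by (auto simp: card_insert_if)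
  from fresh[OF _ this] that show thesis by auto
qed

text \<open>If \<open>i = l\<close> or \<open>j = k\<close>, the two products coincide by the
  symmetry of \<open>w\<close>; only four distinct indices need a relation.\<close>

lemma ww_weak:
  assumes "{i, j, k, l} \<subseteq> D" "i \<noteq> j" "k \<noteq> l" "i \<noteq> k" "j \<noteq> l"
  shows "w i j * w k l \<doteq> w i k * w j l"
proof (cases "i = l \<or> j = k")
  case True
  then have "w i j * w k l = w i k * w j l" by (auto simp: w_sym mult.commute)
  then show ?thesis by simp
next
  case False
  then show ?thesis using assms by (intro ww) auto
qed

text \<open>Four indices have at most three splittings into two pairs, and \<open>A\<close> and
  \<open>B\<close> link the other two to the given one.\<close>

lemma pair_product_exchange:
  assumes "{#a, b, c, d#} = {#i, j, k, l#}" and "{i, j, k, l} \<subseteq> D"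
    and "a \<noteq> b" "c \<noteq> d" "i \<noteq> j" "k \<noteq> l"
  shows "w a b * w c d \<doteq> w i j * w k l"
proof -
  have A: "w i k * w j l \<doteq> w i j * w k l" if "i \<noteq> k" "j \<noteq> l"
    using ww_weak[of i k j l] assms that by auto
  have B: "w i l * w j k \<doteq> w i j * w k l" if "i \<noteq> l" "j \<noteq> k"
    using ww_weak[of i l j k] assms that by (auto simp: w_sym)
  let ?goal = "w a b * w c d = w i j * w k l \<or> i \<noteq> k \<and> j \<noteq> l \<and> w a b * w c d = w i k * w j l \<or>
    i \<noteq> l \<and> j \<noteq> k \<and> w a b * w c d = w i l * w j k"
  have ?goal if "a = i" "{#b, c, d#} = {#j, k, l#}"
    using mset3_cases[OF that(2)] that(1) assms(3,4) by (elim insertE emptyE) (simp_all add: w_sym mult.commute)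
  moreover have ?goal if "a = j" "{#b, c, d#} = {#i, k, l#}"
    using mset3_cases[OF that(2)] that(1) assms(3,4) by (elim insertE emptyE) (simp_all add: w_sym mult.commute)
  moreover have ?goal if "a = k" "{#b, c, d#} = {#i, j, l#}"
    using mset3_cases[OF that(2)] that(1) assms(3,4) by (elim insertE emptyE) (simp_all add: w_sym mult.commute)
  moreover have ?goal if "a = l" "{#b, c, d#} = {#i, j, k#}"
    using mset3_cases[OF that(2)] that(1) assms(3,4) by (elim insertE emptyE) (simp_all add: w_sym mult.commute)
  ultimately consider "w a b * w c d = w i j * w k l" | "i \<noteq> k" "j \<noteq> l" "w a b * w c d = w i k * w j l"
    | "i \<noteq> l" "j \<noteq> k" "w a b * w c d = w i l * w j k"
    using mset4_cases[OF assms(1)] by metis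
  then show ?thesis by cases (use A B in auto)
qed

text \<open>The right hand sides are \<open>x\<^sub>i x\<^sub>j x\<^sub>k x\<^sub>l\<close>, \<open>x\<^sub>i\<^sup>3 x\<^sub>j = x\<^sub>i x\<^sub>j (x\<^sub>i\<^sup>2 - x\<^sub>k\<^sup>2) + x\<^sub>i x\<^sub>k \<cdot> x\<^sub>j x\<^sub>k\<close> and
  \<open>x\<^sub>i\<^sup>4 = (x\<^sub>i\<^sup>2 - x\<^sub>j\<^sup>2) (x\<^sub>i\<^sup>2 - x\<^sub>k\<^sup>2) + x\<^sub>i\<^sup>2 x\<^sub>j\<^sup>2 + x\<^sub>i\<^sup>2 x\<^sub>k\<^sup>2 - x\<^sub>j\<^sup>2 x\<^sub>k\<^sup>2\<close>, rewritten in the generators.\<close>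

definition quartic :: "(nat multiset \<Rightarrow> 'a) \<Rightarrow> bool" where
  "quartic F \<longleftrightarrow>
    (\<forall>i j k l. {i, j, k, l} \<subseteq> D \<longrightarrow> i \<noteq> j \<longrightarrow> k \<noteq> l \<longrightarrow> F {#i, j, k, l#} \<doteq> w i j * w k l) \<and>
    (\<forall>i j k. {i, j, k} \<subseteq> D \<longrightarrow> distinct [i, j, k] \<longrightarrow> F {#i, i, i, j#} \<doteq> w i j * E i k + w i k * w j k) \<and>
    (\<forall>i j k. {i, j, k} \<subseteq> D \<longrightarrow> distinct [i, j, k] \<longrightarrow>
       F {#i, i, i, i#} \<doteq> E i j * E i k + w i j * w i j + w i k * w i k - w j k * w j k)"

text \<open>The value prescribed for x_i^3 x_j must not depend on the auxiliary index. The
  difference of two choices is one instance of \<open>wE\<close>; for x_i^4 the same role is played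
  by \<open>EE\<close>.\<close>

lemma cubic_indep:
  assumes "{i, j, k, l} \<subseteq> D" "distinct [i, j, k]" "distinct [i, j, l]"
  shows "w i j * E i k + w i k * w j k \<doteq> w i j * E i l + w i l * w j l"
proof (cases "k = l")
  case False
  then have "w i j * E k l \<doteq> w k i * w k j - w l i * w l j" using assms by (intro wE) auto
  then show ?thesis by (rule eqvI1[where cp = "-1"]) (simp add: algebra_simps w_sym)
qed simp

lemma quad_indep1:
  assumes "{i, j, k, l} \<subseteq> D" "distinct [i, j, k]" "distinct [i, j, l]"
  shows "E i j * E i k + w i j * w i j + w i k * w i k - w j k * w j k \<doteq>
         E i j * E i l + w i j * w i j + w i l * w i l - w j l * w j l"
proof (cases "k = l")
  case False
  then have "E i j * E l k \<doteq> w i l * w i l + w k j * w k j - w i k * w i k - w l j * w l j"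
    using assms by (intro EE) auto
  then show ?thesis by (rule eqvI1[where cp = 1]) (simp add: algebra_simps w_sym)
qed simp

lemma quad_indep:
  assumes "{i, j, k, p, q} \<subseteq> D" "distinct [i, j, k]" "distinct [i, p, q]"
  shows "E i j * E i k + w i j * w i j + w i k * w i k - w j k * w j k \<doteq>
         E i p * E i q + w i p * w i p + w i q * w i q - w p q * w p q"
proof -
  define Q where "Q j k = E i j * E i k + w i j * w i j + w i k * w i k - w j k * w j k" for j k
  have sym: "Q j k = Q k j" for j k unfolding Q_def by (simp add: algebra_simps w_sym)
  have step: "Q j k \<doteq> Q j l" if "{i, j, k, l} \<subseteq> D" "distinct [i, j, k]" "distinct [i, j, l]" for j k l
    unfolding Q_def using that by (rule quad_indep1)
  have "Q j k \<doteq> Q p q"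
  \<comment> \<open>The auxiliary indices change one at a time, and every intermediate pair has to
    be distinct. The route passes through \<open>Q j q\<close>, which is not admissible for
    \<open>j = q\<close>; there one change and the symmetry of \<open>Q\<close> suffice.\<close>
  proof (cases "j = q")
    case True
    then have "Q j k \<doteq> Q j p" using assms by (intro step) auto
    then show ?thesis using True sym by simp
  next
    case False
    then have "Q j k \<doteq> Q j q" using assms by (intro step) auto
    also have "Q j q = Q q j" by (rule sym)
    also have "Q q j \<doteq> Q q p" using False assms by (intro step) auto
    also have "Q q p = Q p q" by (rule sym)
    finally show ?thesis .
  qed
  then show ?thesis unfolding Q_def .
qed

text \<open>A monomial of degree 4 either splits into two pairs of distinct indices or has an index
  of multiplicity at least three. \<open>no31\<close> keeps these classes apart, so each demand in
  \<open>good\<close> is met either vacuously or by the independence results above.\<close>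

lemma quartic_exists: "\<exists>F. quartic F"
proof -
  define good where "good g y \<longleftrightarrow>
    (\<forall>i j k l. {i, j, k, l} \<subseteq> D \<longrightarrow> i \<noteq> j \<longrightarrow> k \<noteq> l \<longrightarrow> g = {#i, j, k, l#} \<longrightarrow> y \<doteq> w i j * w k l) \<and>
    (\<forall>i j k. {i, j, k} \<subseteq> D \<longrightarrow> distinct [i, j, k] \<longrightarrow> g = {#i, i, i, j#} \<longrightarrow> y \<doteq> w i j * E i k + w i k * w j k) \<and>
    (\<forall>i j k. {i, j, k} \<subseteq> D \<longrightarrow> distinct [i, j, k] \<longrightarrow> g = {#i, i, i, i#} \<longrightarrow>
       y \<doteq> E i j * E i k + w i j * w i j + w i k * w i k - w j k * w j k)" for g y
  have no31: "{#i, j, k, l#} \<noteq> {#p, p, p, q#}" if "i \<noteq> j" "k \<noteq> l" for i j k l p q :: nat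
  proof
    assume "{#i, j, k, l#} = {#p, p, p, q#}"
    from mset4_cases[OF this] mset3_cases[of j k l] that show False by blast
  qed
  have pair: "good {#i, j, k, l#} (w i j * w k l)" if "{i, j, k, l} \<subseteq> D" "i \<noteq> j" "k \<noteq> l" for i j k l
    unfolding good_def
  proof (intro conjI allI impI)
    fix a b c d assume "a \<noteq> b" "c \<noteq> d" "{#i, j, k, l#} = {#a, b, c, d#}" "{a, b, c, d} \<subseteq> D"
    then show "w i j * w k l \<doteq> w a b * w c d" using that by (intro pair_product_exchange) simp_all
  next
    fix a b c assume "{#i, j, k, l#} = {#a, a, a, b#}"
    then show "w i j * w k l \<doteq> w a b * E a c + w a c * w b c" using no31[OF that(2,3)] by metis
  next
    fix a b c assume "{#i, j, k, l#} = {#a, a, a, a#}"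
    then show "w i j * w k l \<doteq> E a b * E a c + w a b * w a b + w a c * w a c - w b c * w b c"
      using no31[OF that(2,3)] by metis
  qed
  have cubic: "\<exists>y. good {#i, i, i, j#} y" if ij: "{i, j} \<subseteq> D" "i \<noteq> j" for i j
  proof -
    obtain k where k: "k \<in> D" "k \<noteq> i" "k \<noteq> j" by (rule fresh3)
    have "good {#i, i, i, j#} (w i j * E i k + w i k * w j k)"
      unfolding good_def
    proof (intro conjI allI impI)
      fix a b c d assume "a \<noteq> b" "c \<noteq> d" "{#i, i, i, j#} = {#a, b, c, d#}"
      then show "w i j * E i k + w i k * w j k \<doteq> w a b * w c d" using no31 by metis
    next
      fix a b c assume abc: "{a, b, c} \<subseteq> D" "distinct [a, b, c]" and eq: "{#i, i, i, j#} = {#a, a, a, b#}"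
      have "a = i" "b = j" using mset4_cases[OF eq] mset3_cases[of i i j] ij by auto
      then show "w i j * E i k + w i k * w j k \<doteq> w a b * E a c + w a c * w b c"
        using cubic_indep[of i j k c] abc ij k by auto
    next
      fix a b c assume eq: "{#i, i, i, j#} = {#a, a, a, a#}"
      have "i = a" "j = a" using mset4_cases[OF eq] mset3_cases[of i i j] by auto
      then show "w i j * E i k + w i k * w j k \<doteq> E a b * E a c + w a b * w a b + w a c * w a c - w b c * w b c"
        using ij by simp
    qed
    then show ?thesis by blast
  qed
  have quad: "\<exists>y. good {#i, i, i, i#} y" if i: "i \<in> D" for i
  proof -
    obtain j where j: "j \<in> D" "j \<noteq> i" by (rule fresh3)
    obtain k where k: "k \<in> D" "k \<noteq> i" "k \<noteq> j" by (rule fresh3)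
    have "good {#i, i, i, i#} (E i j * E i k + w i j * w i j + w i k * w i k - w j k * w j k)"
      unfolding good_def
    proof (intro conjI allI impI)
      fix a b c d assume "a \<noteq> b" "c \<noteq> d" "{#i, i, i, i#} = {#a, b, c, d#}"
      then show "E i j * E i k + w i j * w i j + w i k * w i k - w j k * w j k \<doteq> w a b * w c d" using no31 by metis
    next
      fix a b c assume abc: "distinct [a, b, c]" and eq: "{#i, i, i, i#} = {#a, a, a, b#}"
      have "i = a" "i = b" using mset4_cases[OF eq] mset3_cases[of i i i] by auto
      then show "E i j * E i k + w i j * w i j + w i k * w i k - w j k * w j k \<doteq> w a b * E a c + w a c * w b c"
        using abc by simp
    next
      fix a b c assume abc: "{a, b, c} \<subseteq> D" "distinct [a, b, c]" and eq: "{#i, i, i, i#} = {#a, a, a, a#}"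
      have "i = a" using mset4_cases[OF eq] by auto
      then show "E i j * E i k + w i j * w i j + w i k * w i k - w j k * w j k \<doteq>
          E a b * E a c + w a b * w a b + w a c * w a c - w b c * w b c"
        using quad_indep[of i j k b c] abc i j k by auto
    qed
    then show ?thesis by blast
  qed
  have triple: "\<exists>y. good {#i, i, i, j#} y" if "{i, j} \<subseteq> D" for i j
    using cubic[of i j] quad[of i] that by (cases "i = j") simp_all
  have ex: "\<exists>y. good {#i, j, k, l#} y" if D: "{i, j, k, l} \<subseteq> D" for i j k l
  proof -
    consider "i \<noteq> j" "k \<noteq> l" | "i \<noteq> k" "j \<noteq> l" | "i \<noteq> l" "j \<noteq> k"
      | "i = j" "j = k" | "i = j" "j = l" | "i = k" "k = l" | "j = k" "k = l" by metis
    then show ?thesis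
    proof cases
      case 1 then show ?thesis using pair D by blast
    next
      case 2
      then have "good {#i, k, j, l#} (w i k * w j l)" using D by (intro pair) auto
      moreover have "{#i, k, j, l#} = {#i, j, k, l#}" by simp
      ultimately show ?thesis by metis
    next
      case 3
      then have "good {#i, l, j, k#} (w i l * w j k)" using D by (intro pair) auto
      moreover have "{#i, l, j, k#} = {#i, j, k, l#}" by simp
      ultimately show ?thesis by metis
    next
      case 4
      then show ?thesis using triple[of i l] D by simp
    next
      case 5
      then have eq: "{#i, j, k, l#} = {#i, i, i, k#}" by simp
      show ?thesis unfolding eq using D by (intro triple) simp
    next
      case 6
      then have eq: "{#i, j, k, l#} = {#i, i, i, j#}" by simp
      show ?thesis unfolding eq using D by (intro triple) simp
    next
      case 7
      then have eq: "{#i, j, k, l#} = {#j, j, j, i#}" by simp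
      show ?thesis unfolding eq using D by (intro triple) simp
    qed
  qed
  define F where "F g = (SOME y. good g y)" for g
  have F: "good {#i, j, k, l#} (F {#i, j, k, l#})" if "{i, j, k, l} \<subseteq> D" for i j k l
    unfolding F_def by (rule someI_ex[OF ex[OF that]])
  show ?thesis
  proof (rule exI[where x = F], unfold quartic_def, intro conjI allI impI)
    fix i j k l assume "{i, j, k, l} \<subseteq> D" "i \<noteq> j" "k \<noteq> l"
    then show "F {#i, j, k, l#} \<doteq> w i j * w k l" using F[of i j k l] unfolding good_def by blast
  next
    fix i j k assume "{i, j, k} \<subseteq> D" "distinct [i, j, k]"
    moreover have "good {#i, i, i, j#} (F {#i, i, i, j#})" using calculation by (intro F) auto
    ultimately show "F {#i, i, i, j#} \<doteq> w i j * E i k + w i k * w j k" unfolding good_def by blast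
  next
    fix i j k assume "{i, j, k} \<subseteq> D" "distinct [i, j, k]"
    moreover have "good {#i, i, i, i#} (F {#i, i, i, i#})" using calculation by (intro F) auto
    ultimately show "F {#i, i, i, i#} \<doteq> E i j * E i k + w i j * w i j + w i k * w i k - w j k * w j k"
      unfolding good_def by blast
  qed
qed

end

section \<open>Coherence in degree two\<close>

lemma size_three_mset:
  assumes "size h = 3"
  obtains p q s where "h = {#p, q, s#}"
proof -
  obtain p M where "h = p ## M" "size M = 2"
    using size_eq_Suc_imp_eq_union[of h 2] assms by (auto simp: numeral_eq_Suc)
  moreover obtain q N where "M = q ## N" "size N = 1"
    using size_eq_Suc_imp_eq_union[of M 1] calculation by (auto simp: numeral_eq_Suc)
  moreover obtain s where "N = {#s#}" using calculation size_1_singleton_mset by blast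
  ultimately show thesis using that by blast
qed

context quadric_relations begin

context
  fixes F assumes quartic: "quartic F"
begin

lemma quartic_pair:
  assumes "M = {#i, j, k, l#}" "{i, j, k, l} \<subseteq> D" "i \<noteq> j" "k \<noteq> l"
  shows "F M \<doteq> w i j * w k l"
  using quartic assms unfolding quartic_def by blast

lemma quartic_cubic:
  assumes "M = {#i, i, i, j#}" "{i, j, k} \<subseteq> D" "distinct [i, j, k]"
  shows "F M \<doteq> w i j * E i k + w i k * w j k"
  using quartic assms unfolding quartic_def by blast

lemma quartic_quad:
  assumes "{i, j, k} \<subseteq> D" "distinct [i, j, k]"
  shows "F {#i, i, i, i#} \<doteq> E i j * E i k + w i j * w i j + w i k * w i k - w j k * w j k"
  using quartic assms unfolding quartic_def by blast

text \<open>Reads x_a x_b x_p^2 as x_a x_b (x_p^2 - x_m^2) + (x_a x_m)(x_b x_m). This single formula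
  covers every coincidence of \<open>p\<close> with \<open>a\<close>, \<open>b\<close> or
  \<open>m\<close>.\<close>

lemma quartic_square:
  assumes M: "M = {#a, b, p, p#}" and "{a, b, p, m} \<subseteq> D" "distinct [a, b, m]"
  shows "F M \<doteq> w a b * E p m + w a m * w b m"
proof -
  consider "p = m" | "p = a" | "p = b" | "p \<notin> {a, b, m}" by blast
  then show ?thesis
  proof cases
    case 1
    then have "F M \<doteq> w a m * w b m" using assms by (intro quartic_pair) auto
    then show ?thesis using 1 by simp
  next
    case 2
    then have "F M \<doteq> w a b * E a m + w a m * w b m" using assms by (intro quartic_cubic) auto
    then show ?thesis using 2 by simp
  next
    case 3
    then have "F M \<doteq> w b a * E b m + w b m * w a m" using assms by (intro quartic_cubic) auto
    then show ?thesis using 3 by (simp add: w_sym mult.commute)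
  next
    case 4
    then have "F M \<doteq> w a p * w b p" using assms by (intro quartic_pair) auto
    moreover have "w a b * E p m \<doteq> w p a * w p b - w m a * w m b" using 4 assms by (intro wE) auto
    ultimately show ?thesis
      by (rule eqvI2[where cp = 1 and cq = "-1"]) (simp add: algebra_simps w_sym)
  qed
qed

lemma quartic_square_diff:
  assumes "{a, b, p, q} \<subseteq> D" "a \<noteq> b" "M = {#a, b, p, p#}" "N = {#a, b, q, q#}"
  shows "F M - F N \<doteq> w a b * E p q"
proof -
  obtain m where "m \<in> D" "m \<noteq> a" "m \<noteq> b" by (rule fresh3)
  then have "F M \<doteq> w a b * E p m + w a m * w b m" "F N \<doteq> w a b * E q m + w a m * w b m"
    using assms by (auto intro!: quartic_square)
  then show ?thesis by (rule eqvI2[where cp = 1 and cq = "-1"]) (simp add: algebra_simps)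
qed

text \<open>Together with their mirror images under exchanging \<open>i\<close> and
  \<open>j\<close>, the two congruences settle all four multisets of size 3 over these indices. The
  index \<open>m\<close> is the auxiliary one in the values of \<open>F\<close>, and
  \<open>v\<close> is needed only at \<open>i\<close>, \<open>j\<close> and
  \<open>m\<close>.\<close>

lemma row_pure:
  assumes D: "{i, j, m} \<subseteq> D" "distinct [i, j, m]"
    and v1: "v i * w j m \<doteq> v j * w i m" and v2: "v m * w i j \<doteq> v j * w i m"
    and v3: "E i m * v j \<doteq> w i j * v i - w j m * v m"
    and v4: "E i j * v m \<doteq> w i m * v i - w j m * v j"
    and v5: "E j m * v i \<doteq> w i j * v j - w i m * v m"
  shows "v i * F {#i, i, j, j#} \<doteq> v j * F {#i, i, i, j#}"
    and "v i * F {#i, i, i, j#} \<doteq> v j * F {#i, i, i, i#}"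
proof -
  have "F {#i, i, j, j#} \<doteq> w i j * w i j" "F {#i, i, i, j#} \<doteq> w i j * E i m + w i m * w j m"
    "F {#i, i, i, i#} \<doteq> E i m * E i j + w i m * w i m + w i j * w i j - w m j * w m j"
    using D by (auto intro!: quartic_pair quartic_cubic quartic_quad)
  note f = this
  show "v i * F {#i, i, j, j#} \<doteq> v j * F {#i, i, i, j#}"
    by (rule eqvI4[OF f(1) f(2) v3 v2, where cp = "v i" and cq = "- v j" and cr = "- w i j" and cs = "w j m"])
       (simp add: algebra_simps w_sym)
  show "v i * F {#i, i, i, j#} \<doteq> v j * F {#i, i, i, i#}"
    \<comment> \<open>\<open>v1\<close> is needed twice and \<open>v2\<close> once reversed, all
      with the cofactor \<open>w i m\<close>; they are added up beforehand so that six congruences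
      suffice.\<close>
    by (rule eqvI6[OF f(2) f(3) v3 v4 v5 eqv_add[OF eqv_add[OF v1 v1] eqv_sym[OF v2]],
          where cp = "v i" and cq = "- v j" and cr = "- E i j" and cs = "w j m" and ct = "w i j" and cu = "w i m"])
       (simp add: algebra_simps w_sym)
qed

text \<open>Used for \<open>v = x\<close> and for \<open>v\<close> a row of the matrix, whose diagonal entry is never touched.\<close>

lemma row_quartic:
  assumes D: "{i, j, m} \<subseteq> D" "distinct [i, j, m]"
    and v1: "\<And>s. \<lbrakk>s \<in> D; s \<noteq> i; s \<noteq> j\<rbrakk> \<Longrightarrow> v i * w j s \<doteq> v j * w i s"
    and v2: "v m * w i j \<doteq> v j * w i m"
    and v3: "E i m * v j \<doteq> w i j * v i - w j m * v m"
    and v4: "E i j * v m \<doteq> w i m * v i - w j m * v j"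
    and v5: "E j m * v i \<doteq> w i j * v j - w i m * v m"
    and h: "on_D h" "size h = 3"
  shows "v i * F (j ## h) \<doteq> v j * F (i ## h)"
proof -
  have v1m: "v i * w j m \<doteq> v j * w i m" using D by (intro v1) auto
  have pure: "v i * F {#i, i, j, j#} \<doteq> v j * F {#i, i, i, j#}" "v i * F {#i, i, i, j#} \<doteq> v j * F {#i, i, i, i#}"
    using row_pure[OF D v1m v2 v3 v4 v5] by blast+
  have v2': "v m * w j i \<doteq> v i * w j m" using eqv_trans[OF v2 eqv_sym[OF v1m]] by (simp add: w_sym)
  have v3': "E j m * v i \<doteq> w j i * v j - w i m * v m" using v5 by (simp add: w_sym)
  have v5': "E i m * v j \<doteq> w j i * v i - w j m * v m" using v3 by (simp add: w_sym)
  have v4': "E j i * v m \<doteq> w j m * v j - w i m * v i"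
    using v4 by (rule eqvI1[where cp = "-1"]) (simp add: algebra_simps)
  have D': "{j, i, m} \<subseteq> D" "distinct [j, i, m]" using D by auto
  have pure': "v j * F {#j, j, i, i#} \<doteq> v i * F {#j, j, j, i#}" "v j * F {#j, j, j, i#} \<doteq> v i * F {#j, j, j, j#}"
    using row_pure[OF D' eqv_sym[OF v1m] v2' v3' v4' v5'] by blast+
  have other: "v i * F (j ## {#s, p, q#}) \<doteq> v j * F (i ## {#s, p, q#})"
    if s: "{s, p, q} \<subseteq> D" "s \<noteq> i" "s \<noteq> j" for s p q
  proof (cases "p = q")
    case False
    have "v i * w j s \<doteq> v j * w i s" using s by (intro v1) auto
    moreover have "F {#j, s, p, q#} \<doteq> w j s * w p q" "F {#i, s, p, q#} \<doteq> w i s * w p q"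
      using s D False by (auto intro!: quartic_pair)
    ultimately show ?thesis
      by (rule eqvI3[where cp = "w p q" and cq = "v i" and cr = "- v j"]) (simp add: algebra_simps)
  next
    case True
    obtain n where n: "n \<in> D" "n \<noteq> i" "n \<noteq> j" "n \<noteq> s" by (rule fresh3)
    have "v i * w j s \<doteq> v j * w i s" "v i * w j n \<doteq> v j * w i n" using s n by (auto intro!: v1)
    moreover have "F {#j, s, p, p#} \<doteq> w j s * E p n + w j n * w s n" "F {#i, s, p, p#} \<doteq> w i s * E p n + w i n * w s n"
      using s D n by (auto intro!: quartic_square)
    ultimately show ?thesis unfolding True[symmetric]
      by (rule eqvI4[where cp = "E p n" and cq = "w s n" and cr = "v i" and cs = "- v j"]) (simp add: algebra_simps)
  qed
  obtain p q s where pqs: "h = {#p, q, s#}" using size_three_mset h by blast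
  show ?thesis
  proof (cases "{p, q, s} \<subseteq> {i, j}")
    case False
    then consider "p \<noteq> i" "p \<noteq> j" | "q \<noteq> i" "q \<noteq> j" | "s \<noteq> i" "s \<noteq> j" by blast
    then show ?thesis
    proof cases
      case 1 then show ?thesis using other[of p q s] h pqs by simp
    next
      case 2
      moreover have "h = {#q, p, s#}" using pqs by simp
      ultimately show ?thesis using other[of q p s] h by simp
    next
      case 3
      moreover have "h = {#s, p, q#}" using pqs by simp
      ultimately show ?thesis using other[of s p q] h by simp
    qed
  next
    case True
    then have "h \<in> {{#i, i, i#}, {#i, i, j#}, {#i, j, j#}, {#j, j, j#}}" unfolding pqs by auto
    moreover have "{#j, i, i, i#} = {#i, i, i, j#}" "{#j, i, i, j#} = {#i, i, j, j#}" "{#i, i, i, j#} = {#i, i, i, j#}"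
      "{#j, i, j, j#} = {#j, j, j, i#}" "{#i, i, j, j#} = {#j, j, i, i#}" "{#i, j, j, j#} = {#j, j, j, i#}" by simp_all
    ultimately show ?thesis using pure eqv_sym[OF pure'(1)] eqv_sym[OF pure'(2)] by (elim insertE emptyE) (simp_all only:)
  qed
qed

lemma quartic_x:
  assumes ij: "{i, j} \<subseteq> D" "i \<noteq> j" and h: "on_D h" "size h = 3"
  shows "x i * F (j ## h) \<doteq> x j * F (i ## h)"
proof -
  obtain m where m: "m \<in> D" "m \<noteq> i" "m \<noteq> j" by (rule fresh3)
  have E: "E a b * x c \<doteq> w a c * x a - w b c * x b" if "{a, b, c} \<subseteq> D" "distinct [a, b, c]" for a b c
    using xE[OF that] by (simp add: mult.commute)
  show ?thesis
  proof (rule row_quartic[of i j m x, OF _ _ _ _ _ _ _ h])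
    show "E i m * x j \<doteq> w i j * x i - w j m * x m" using E[of i m j] ij m by (simp add: w_sym)
    show "E i j * x m \<doteq> w i m * x i - w j m * x j" using E[of i j m] ij m by simp
    show "E j m * x i \<doteq> w i j * x j - w i m * x m" using E[of j m i] ij m by (simp add: w_sym)
    show "x m * w i j \<doteq> x j * w i m" using xw[of m j i] ij m by (simp add: w_sym)
  qed (use ij m in \<open>auto intro!: xw\<close>)
qed

lemma quartic_w:
  assumes ij: "{i, j, k} \<subseteq> D" "distinct [i, j, k]" and h: "on_D h" "size h = 3"
  shows "w j k * F (i ## h) \<doteq> w i k * F (j ## h)"
proof -
  obtain m where m: "m \<in> D" "m \<noteq> i" "m \<noteq> j" "m \<noteq> k" by (rule fresh3)
  have E: "E a b * w c k \<doteq> w a c * w a k - w b c * w b k" if "{a, b, c} \<subseteq> D" "distinct [a, b, c, k]" for a b c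
    using wE[of a c k b] that ij by (simp add: mult.commute)
  have "w i k * F (j ## h) \<doteq> w j k * F (i ## h)"
  proof (rule row_quartic[of i j m "\<lambda>i. w i k", OF _ _ _ _ _ _ _ h])
    show "E i m * w j k \<doteq> w i j * w i k - w j m * w m k" using E[of i m j] ij m by (simp add: w_sym)
    show "E i j * w m k \<doteq> w i m * w i k - w j m * w j k" using E[of i j m] ij m by simp
    show "E j m * w i k \<doteq> w i j * w j k - w i m * w m k" using E[of j m i] ij m by (simp add: w_sym)
    show "w m k * w i j \<doteq> w j k * w i m" using ww_weak[of k m j i] ij m by (simp add: w_sym)
    \<comment> \<open>The value \<open>s = k\<close> is included; it belongs to the trivial case of
      \<open>ww_weak\<close>.\<close>
    show "w i k * w j s \<doteq> w j k * w i s" if "s \<in> D" "s \<noteq> i" "s \<noteq> j" for s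
      using ww_weak[of k i j s] ij that by (simp add: w_sym)
  qed (use ij m in auto)
  then show ?thesis by (rule eqv_sym)
qed

text \<open>Here F(i + h) is w_pq w_is. The product of w_pq with E_jm is a difference of two values
  of \<open>F\<close>, and \<open>row\<close> exchanges the remaining index \<open>s\<close> of w_is
  for \<open>j\<close> or \<open>m\<close>.\<close>

lemma quartic_E_distinct:
  assumes ij: "{i, j, m} \<subseteq> D" "distinct [i, j, m]"
    and h: "h = {#p, q, s#}" "{p, q, s} \<subseteq> D" "p \<noteq> q" "s \<noteq> i"
  shows "E j m * F (i ## h) \<doteq> w i j * F (j ## h) - w i m * F (m ## h)"
proof -
  have row: "w i s * F {#p, q, a, a#} \<doteq> w i a * F (a ## h)" if "a \<in> {j, m}" for a
  proof (cases "a = s")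
    case True
    have "{#p, q, s, s#} = s ## h" using h by simp
    then show ?thesis using True by (simp only: eqv_refl)
  next
    case False
    then have "w s i * F (a ## {#p, q, a#}) \<doteq> w a i * F (s ## {#p, q, a#})"
      using that ij h by (intro quartic_w) auto
    moreover have "a ## {#p, q, a#} = {#p, q, a, a#}" "s ## {#p, q, a#} = a ## h" using h by simp_all
    ultimately show ?thesis by (simp only: w_sym[of s i] w_sym[of a i])
  qed
  have "F (i ## h) \<doteq> w p q * w i s" using ij h by (intro quartic_pair) auto
  moreover have "F {#p, q, j, j#} - F {#p, q, m, m#} \<doteq> w p q * E j m"
    using ij h by (intro quartic_square_diff) auto
  ultimately show ?thesis
    by (rule eqvI4[OF _ _ row[of j] row[of m], where cp = "E j m" and cq = "- w i s" and cr = 1 and cs = "-1"])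
       (simp_all add: algebra_simps)
qed

text \<open>Exchanging \<open>j\<close> and \<open>m\<close> only negates the claim, so
  \<open>s = m\<close> can be left out. If \<open>s\<close> differs from \<open>j\<close>, then
  \<open>s\<close> itself is the fourth index in the relations; for \<open>s = j\<close> a fresh
  \<open>l\<close> takes this place. \<open>quartic_E_sss\<close> follows the same pattern.\<close>

lemma quartic_E_iis:
  assumes ij: "{i, j, m} \<subseteq> D" "distinct [i, j, m]" and s: "s \<in> D" "s \<noteq> i" "s \<noteq> m"
  shows "E j m * F {#i, i, i, s#} \<doteq> w i j * F {#j, i, i, s#} - w i m * F {#m, i, i, s#}"
proof (cases "s = j")
  case False
  have f: "F {#i, i, i, s#} \<doteq> w i s * E i m + w i m * w s m"
    "F {#j, i, i, s#} \<doteq> w i j * w i s" "F {#m, i, i, s#} \<doteq> w i m * w i s"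
    using ij s False by (auto intro!: quartic_cubic quartic_pair)
  have g: "w i s * E j m \<doteq> w j i * w j s - w m i * w m s" "w j s * E i m \<doteq> w i j * w i s - w m j * w m s"
    "w m s * E i j \<doteq> w i m * w i s - w j m * w j s"
    using ij s False by (auto intro!: wE)
  have g': "w i m * w s j \<doteq> w i j * w m s"
    using ij s False ww_weak[of i m j s] by (simp add: w_sym)
  have "E j m * (w i s * E i m + w i m * w s m) \<doteq> w i j * (w i j * w i s) - w i m * (w i m * w i s)"
    by (rule eqvI4[OF g g', where cp = "E i m" and cq = "w i j" and cr = "- w i m" and cs = "w j m"])
       (simp add: algebra_simps w_sym)
  then show ?thesis
    by (rule eqvI4[OF f, where cp = "E j m" and cq = "- w i j" and cr = "w i m" and cs = 1])
       (simp add: algebra_simps)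
next
  case True
  obtain l where l: "l \<in> D" "l \<noteq> i" "l \<noteq> j" "l \<noteq> m" by (rule fresh3)
  have f: "F {#i, i, i, j#} \<doteq> w i j * E i l + w i l * w j l"
    "F {#j, i, i, j#} \<doteq> w i j * w i j" "F {#m, i, i, j#} \<doteq> w i m * w i j"
    using ij l by (auto intro!: quartic_cubic quartic_pair)
  have g: "E i l * E j m \<doteq> w i j * w i j + w m l * w m l - w i m * w i m - w j l * w j l"
    "w i l * E j m \<doteq> w j i * w j l - w m i * w m l" "w i j * w m l \<doteq> w i m * w j l"
    using ij l by (auto intro!: wE EE ww)
  have "E j m * (w i j * E i l + w i l * w j l) \<doteq> w i j * (w i j * w i j) - w i m * (w i m * w i j)"
    by (rule eqvI3[OF g, where cp = "w i j" and cq = "w j l" and cr = "w m l"])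
       (simp add: algebra_simps w_sym)
  then show ?thesis unfolding True
    by (rule eqvI4[OF f, where cp = "E j m" and cq = "- w i j" and cr = "w i m" and cs = 1])
       (simp add: algebra_simps)
qed

lemma quartic_E_sss:
  assumes ij: "{i, j, m} \<subseteq> D" "distinct [i, j, m]" and s: "s \<in> D" "s \<noteq> i" "s \<noteq> m"
  shows "E j m * F {#i, s, s, s#} \<doteq> w i j * F {#j, s, s, s#} - w i m * F {#m, s, s, s#}"
proof (cases "s = j")
  case False
  have f: "F {#i, s, s, s#} \<doteq> w i s * E s m + w i m * w s m"
    "F {#j, s, s, s#} \<doteq> w j s * E s m + w j m * w s m" "F {#m, s, s, s#} \<doteq> w m s * E s j + w m j * w s j"
    using ij s False by (auto intro!: quartic_square)
  have g: "w i s * E j m \<doteq> w j i * w j s - w m i * w m s"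
    using ij s False by (auto intro!: wE)
  have g': "w i m * w s j \<doteq> w i j * w m s"
    using ij s False ww_weak[of i m j s] by (simp add: w_sym)
  have "E j m * (w i s * E s m + w i m * w s m) \<doteq>
      w i j * (w j s * E s m + w j m * w s m) - w i m * (w m s * E s j + w m j * w s j)"
    by (rule eqvI2[OF g g', where cp = "E s m" and cq = "w j m"]) (simp add: algebra_simps w_sym)
  then show ?thesis
    by (rule eqvI4[OF f, where cp = "E j m" and cq = "- w i j" and cr = "w i m" and cs = 1])
       (simp add: algebra_simps)
next
  case True
  obtain l where l: "l \<in> D" "l \<noteq> i" "l \<noteq> j" "l \<noteq> m" by (rule fresh3)
  have f: "F {#i, j, j, j#} \<doteq> w i j * E j l + w i l * w j l"
    "F {#j, j, j, j#} \<doteq> E j m * E j l + w j m * w j m + w j l * w j l - w m l * w m l"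
    "F {#m, j, j, j#} \<doteq> w m j * E j l + w m l * w j l"
    using ij l by (auto intro!: quartic_square quartic_quad)
  have g: "w i l * E j m \<doteq> w j i * w j l - w m i * w m l" "w i m * E j l \<doteq> w j i * w j m - w l i * w l m"
    "w i j * w l m \<doteq> w i l * w j m"
    using ij l by (auto intro!: wE ww)
  have "E j m * (w i j * E j l + w i l * w j l) \<doteq>
      w i j * (E j m * E j l + w j m * w j m + w j l * w j l - w m l * w m l) - w i m * (w m j * E j l + w m l * w j l)"
    by (rule eqvI3[OF g, where cp = "w j l" and cq = "w j m" and cr = "w l m"])
       (simp add: algebra_simps w_sym)
  then show ?thesis unfolding True
    by (rule eqvI4[OF f, where cp = "E j m" and cq = "- w i j" and cr = "w i m" and cs = 1])
       (simp add: algebra_simps)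
qed

text \<open>The claim involves only three indices, whereas the relations need four. The auxiliary
  \<open>l\<close> occurs in every relation used and cancels in their combination.\<close>

lemma quartic_E_iii:
  assumes ij: "{i, j, m} \<subseteq> D" "distinct [i, j, m]"
  shows "E j m * F {#i, i, i, i#} \<doteq> w i j * F {#j, i, i, i#} - w i m * F {#m, i, i, i#}"
proof -
  obtain l where l: "l \<in> D" "l \<noteq> i" "l \<noteq> j" "l \<noteq> m" by (rule fresh3)
  have f: "F {#i, i, i, i#} \<doteq> E i j * E i m + w i j * w i j + w i m * w i m - w j m * w j m"
    "F {#j, i, i, i#} \<doteq> w i j * E i m + w i m * w j m" "F {#m, i, i, i#} \<doteq> w i m * E i j + w i j * w m j"
    using ij by (auto intro!: quartic_cubic quartic_quad)
  have g: "E i l * E j m \<doteq> w i j * w i j + w m l * w m l - w i m * w i m - w j l * w j l"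
    "E i m * E l j \<doteq> w i l * w i l + w j m * w j m - w i j * w i j - w l m * w l m"
    "w m l * E i j \<doteq> w i m * w i l - w j m * w j l" "w j l * E i m \<doteq> w i j * w i l - w m j * w m l"
    "w i l * E j m \<doteq> w j i * w j l - w m i * w m l"
    using ij l by (auto intro!: wE EE)
  have "E j m * (E i j * E i m + w i j * w i j + w i m * w i m - w j m * w j m) \<doteq>
      w i j * (w i j * E i m + w i m * w j m) - w i m * (w i m * E i j + w i j * w m j)"
    by (rule eqvI5[OF g, where cp = "E i m" and cq = "E j m" and cr = "w m l" and cs = "- w j l" and ct = "w i l"])
       (simp add: algebra_simps w_sym)
  then show ?thesis
    by (rule eqvI4[OF f, where cp = "E j m" and cq = "- w i j" and cr = "w i m" and cs = 1])
       (simp add: algebra_simps)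
qed

text \<open>Up to order, \<open>h\<close> consists of two distinct indices and one different from
  \<open>i\<close>, or it is i, i, t, or it is a triple power; the case distinction below sorts
  \<open>h\<close> into these shapes.\<close>

lemma quartic_E:
  assumes ij: "{i, j, m} \<subseteq> D" "distinct [i, j, m]" and h: "on_D h" "size h = 3"
  shows "E j m * F (i ## h) \<doteq> w i j * F (j ## h) - w i m * F (m ## h)"
proof -
  obtain p q s where pqs: "h = {#p, q, s#}" using size_three_mset h by blast
  have swap: "E j m * F (i ## h) \<doteq> w i j * F (j ## h) - w i m * F (m ## h)"
    if "E m j * F (i ## h) \<doteq> w i m * F (m ## h) - w i j * F (j ## h)"
    using that by (rule eqvI1[where cp = "-1"]) (simp add: algebra_simps)
  have ij': "{i, m, j} \<subseteq> D" "distinct [i, m, j]" using ij by auto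
  have iis: ?thesis if "h = {#i, i, t#}" "t \<noteq> i" for t
  proof (cases "t = m")
    case False
    then show ?thesis using quartic_E_iis[OF ij, of t] that h by simp
  next
    case True
    then have "t \<noteq> j" using ij by auto
    then show ?thesis using quartic_E_iis[OF ij', of t] that h by (intro swap) simp
  qed
  have distinct: ?thesis if "h = {#a, b, c#}" "a \<noteq> b" "c \<noteq> i" for a b c
    using quartic_E_distinct[OF ij that(1)] that h by auto
  consider "p = q" "q = s" "s = i" | "p = q" "q = s" "s \<noteq> i" | "p \<noteq> q" "s \<noteq> i" | "p \<noteq> s" "q \<noteq> i"
    | "q \<noteq> s" "p \<noteq> i" | "p \<noteq> q" "s = i" | "p \<noteq> s" "q = i" | "q \<noteq> s" "p = i" by metis
  note cases = this
  have perm: "h = {#p, s, q#}" "h = {#q, s, p#}" using pqs by simp_all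
  show ?thesis
  proof (rule cases)
    assume "p = q" "q = s" "s = i"
    then show ?thesis using quartic_E_iii[OF ij] pqs by simp
  next
    assume pq: "p = q" "q = s" "s \<noteq> i"
    show ?thesis
    proof (cases "s = m")
      case False
      then show ?thesis using quartic_E_sss[OF ij, of s] pq pqs h by simp
    next
      case True
      then have "s \<noteq> j" using ij by auto
      then show ?thesis using quartic_E_sss[OF ij', of s] pq pqs h by (intro swap) simp
    qed
  next
    assume "p \<noteq> q" "s \<noteq> i" then show ?thesis using distinct pqs by blast
  next
    assume "p \<noteq> s" "q \<noteq> i" then show ?thesis using distinct perm by blast
  next
    assume "q \<noteq> s" "p \<noteq> i" then show ?thesis using distinct perm by blast
  next
    assume a: "p \<noteq> q" "s = i"
    consider "p = i" | "q = i" | "p \<noteq> i" "q \<noteq> i" by blast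
    then show ?thesis
    proof cases
      case 1
      have "h = {#i, i, q#}" using pqs 1 a by simp
      then show ?thesis using iis a 1 by blast
    next
      case 2
      have "h = {#i, i, p#}" using pqs 2 a by simp
      then show ?thesis using iis a 2 by blast
    next
      case 3
      then have "q \<noteq> s" using a by simp
      then show ?thesis using distinct perm(2) 3 by blast
    qed
  next
    assume a: "p \<noteq> s" "q = i"
    show ?thesis
    proof (cases "p = i")
      case True
      have "h = {#i, i, s#}" using pqs True a by simp
      then show ?thesis using iis a True by blast
    next
      case False
      show ?thesis
      proof (cases "s = i")
        case True
        have "h = {#i, i, p#}" using pqs True a by simp
        then show ?thesis using iis False by blast
      next
        case s: False
        then show ?thesis using distinct[of p q s] pqs False a by blast
      qed
    qed
  next
    assume a: "q \<noteq> s" "p = i"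
    show ?thesis
    proof (cases "q = i")
      case True
      have "h = {#i, i, s#}" using pqs True a by simp
      then show ?thesis using iis a True by blast
    next
      case False
      show ?thesis
      proof (cases "s = i")
        case True
        have "h = {#i, i, q#}" using pqs True a by simp
        then show ?thesis using iis False by blast
      next
        case s: False
        then show ?thesis using distinct[of p q s] pqs False a by blast
      qed
    qed
  qed
qed

text \<open>Splitting E_ij as E_il + E_lj allows one use of \<open>wE\<close> for each summand; the
  terms with \<open>l\<close> that remain cancel by \<open>ww_weak\<close>.\<close>

lemma E_w_w:
  assumes "{i, j, p, l} \<subseteq> D" "distinct [i, j, p, l]"
  shows "E i j * (w i p * w j p) \<doteq> w i j * (w i p * w i p - w j p * w j p)"
proof -
  have "w j p * E i l \<doteq> w i j * w i p - w l j * w l p" "w i p * E l j \<doteq> w l i * w l p - w j i * w j p"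
    using assms by (auto intro!: wE)
  moreover have "w i l * w j p \<doteq> w i p * w l j"
    using assms ww_weak[of i l p j] by (simp add: w_sym)
  ultimately show ?thesis
    by (rule eqvI3[where cp = "w i p" and cq = "w j p" and cr = "w l p"]) (simp add: algebra_simps w_sym)
qed

lemma quartic_E_pair:
  assumes ij: "{i, j} \<subseteq> D" "i \<noteq> j" and h: "on_D h" "size h = 2"
  shows "E i j * F (i ## j ## h) \<doteq>
    w i j * (F (i ## i ## h) - F (j ## j ## h))"
proof -
  obtain p M where "h = p ## M" "size M = 1"
    using size_eq_Suc_imp_eq_union[of h 1] h by (auto simp: numeral_eq_Suc)
  then obtain q where pq: "h = {#p, q#}" using size_1_singleton_mset by blast
  have pure: "E a b * F {#a, b, a, a#} \<doteq> w a b * (F {#a, a, a, a#} - F {#b, b, a, a#})"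
    if ab: "{a, b} \<subseteq> D" "a \<noteq> b" for a b
  proof -
    obtain l where l: "l \<in> D" "l \<noteq> a" "l \<noteq> b" by (rule fresh3)
    obtain k where k: "k \<in> D" "k \<noteq> a" "k \<noteq> b" "k \<noteq> l" by (rule fresh3)
    have f: "F {#a, b, a, a#} \<doteq> w a b * E a l + w a l * w b l" "F {#b, b, a, a#} \<doteq> w a b * w a b"
      "F {#a, a, a, a#} \<doteq> E a b * E a l + w a b * w a b + w a l * w a l - w b l * w b l"
      using ab l by (auto intro!: quartic_cubic quartic_pair quartic_quad)
    have "E a b * (w a l * w b l) \<doteq> w a b * (w a l * w a l - w b l * w b l)"
      using ab k l by (intro E_w_w[of a b l k]) auto
    then show ?thesis
      by (rule eqvI4[OF f, where cp = "E a b" and cq = "w a b" and cr = "- w a b" and cs = 1])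
         (simp add: algebra_simps)
  qed
  consider "p \<noteq> q" | "p = q" "p = i" | "p = q" "p = j" | "p = q" "p \<noteq> i" "p \<noteq> j" by blast
  then show ?thesis
  proof cases
    case 1
    have "F {#i, j, p, q#} \<doteq> w i j * w p q" "F {#i, i, p, q#} - F {#j, j, p, q#} \<doteq> w p q * E i j"
      using 1 ij h pq by (auto intro!: quartic_pair quartic_square_diff)
    then show ?thesis unfolding pq
      by (rule eqvI2[where cp = "E i j" and cq = "- w i j"]) (simp add: algebra_simps)
  next
    case 2
    then show ?thesis using pure[OF ij] pq by simp
  next
    case 3
    have "E j i * F {#j, i, j, j#} \<doteq> w j i * (F {#j, j, j, j#} - F {#i, i, j, j#})"
      using ij by (intro pure) auto
    then have "E i j * F {#j, i, j, j#} \<doteq> w j i * (F {#i, i, j, j#} - F {#j, j, j, j#})"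
      by (rule eqvI1[where cp = "-1"]) (simp add: algebra_simps)
    moreover have "{#j, i, j, j#} = {#i, j, j, j#}" by simp
    ultimately show ?thesis using 3 pq by (simp add: w_sym)
  next
    case 4
    obtain l where l: "l \<in> D" "l \<noteq> i" "l \<noteq> j" "l \<noteq> p" by (rule fresh3)
    have f: "F {#i, j, p, p#} \<doteq> w i p * w j p" "F {#i, i, p, p#} \<doteq> w i p * w i p" "F {#j, j, p, p#} \<doteq> w j p * w j p"
      using 4 ij h pq by (auto intro!: quartic_pair)
    have "E i j * (w i p * w j p) \<doteq> w i j * (w i p * w i p - w j p * w j p)"
      using ij 4 l h pq by (intro E_w_w[of i j p l]) auto
    then show ?thesis unfolding pq 4(1)[symmetric]
      by (rule eqvI4[OF f, where cp = "E i j" and cq = "- w i j" and cr = "w i j" and cs = 1])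
         (simp add: algebra_simps)
  qed
qed

lemma coherent_quartic: "coherent 4 F"
proof -
  have [simp]: "Suc n = 4 \<longleftrightarrow> n = 3" "Suc n = 3 \<longleftrightarrow> n = 2" for n by auto
  show ?thesis unfolding coherent_def
    using quartic_x quartic_w quartic_E quartic_E_pair by simp
qed

end

lemma coherent_family:
  "\<exists>F. quartic (F 2) \<and> (\<forall>n\<ge>2. coherent (2 * n) (F n) \<and> extends (2 * n) (F n) (F (Suc n)))"
proof -
  obtain F0 where F0: "quartic F0" using quartic_exists by blast
  have "\<exists>G. \<forall>n. (coherent (2 * n + 4) (G n) \<and> (n = 0 \<longrightarrow> quartic (G n))) \<and> extends (2 * n + 4) (G n) (G (Suc n))"
  proof (rule dependent_nat_choice)
    show "\<exists>G. coherent (2 * 0 + 4) G \<and> (0 = (0::nat) \<longrightarrow> quartic G)"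
      using F0 coherent_quartic[OF F0] by auto
  next
    fix G n assume G: "coherent (2 * n + 4) G \<and> (n = 0 \<longrightarrow> quartic G)"
    obtain G' where G': "extends (2 * n + 4) G G'" using extension_exists[of "2 * n + 4" G] G by auto
    have "coherent (Suc (Suc (2 * n + 4))) G'" using G G' by (intro extension_coherent) auto
    then have "coherent (2 * Suc n + 4) G'" by (simp add: eval_nat_numeral)
    then show "\<exists>G'. (coherent (2 * Suc n + 4) G' \<and> (Suc n = 0 \<longrightarrow> quartic G')) \<and> extends (2 * n + 4) G G'"
      using G' by blast
  qed
  then obtain G where G: "\<And>n. coherent (2 * n + 4) (G n)" "\<And>n. extends (2 * n + 4) (G n) (G (Suc n))" "quartic (G 0)"
    by blast
  show ?thesis
  \<comment> \<open>The recursion counts from 0, with size 2n + 4 at level n. After the shift only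
    levels n \<ge> 2 carry meaning; lower ones repeat the start because of truncated
    subtraction.\<close>
  proof (intro exI[where x = "\<lambda>n. G (n - 2)"] conjI allI impI)
    show "quartic (G (2 - 2))" using G(3) by simp
    fix n :: nat assume "2 \<le> n"
    then obtain m where m: "n = m + 2" by (metis le_Suc_ex add.commute)
    have e: "2 * n = 2 * m + 4" "n - 2 = m" "Suc n - 2 = Suc m" using m by auto
    show "coherent (2 * n) (G (n - 2))" unfolding e by (rule G(1))
    show "extends (2 * n) (G (n - 2)) (G (Suc n - 2))" unfolding e by (rule G(2))
  qed
qed

section \<open>From coherent families to arbitrary monomials\<close>

definition xprod :: "nat multiset \<Rightarrow> 'a" where "xprod M = prod_mset (image_mset x M)"

lemma xprod_simps [simp]: "xprod {#} = 1" "xprod (i ## M) = x i * xprod M"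
  by (simp_all add: xprod_def)

text \<open>It does not matter which part of a monomial is absorbed by \<open>F\<close> and which
  part remains as a product of the x_i. \<open>K\<close> is the part on which both sides already
  agree. Each step moves one index of \<open>N\<close> into it; if that index is missing in
  \<open>N'\<close>, it sits in \<open>R'\<close> and is first fetched by the first clause of
  \<open>coherent\<close>.\<close>

lemma coherent_exchange:
  assumes F: "coherent r F"
  shows "\<lbrakk>N + R = N' + R'; size N = size N'; size (K + N) = r; on_D K; on_D N; on_D R\<rbrakk> \<Longrightarrow>
    xprod R * F (K + N) \<doteq> xprod R' * F (K + N')"
proof (induction "size N" arbitrary: N N' R R' K)
  case 0
  then show ?case by simp
next
  case (Suc n)
  from size_eq_Suc_imp_eq_union[OF Suc.hyps(2)[symmetric]]
  obtain i h where N: "N = i ## h" by blast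
  have i: "i \<in> D" and hD: "on_D h" using Suc.prems(5) unfolding N by auto
  have size: "n = size h" "Suc (size K + size h) = r" and K: "on_D K"
    using Suc.prems(3,4) Suc.hyps(2) unfolding N by simp_all
  have "on_D (N' + R')" unfolding Suc.prems(1)[symmetric] using Suc.prems(5,6) by simp
  then have D': "on_D N'" "on_D R'" by simp_all
  show ?case
  proof (cases "i \<in># N'")
    case True
    then obtain h' where N': "N' = i ## h'" by (metis insert_DiffM)
    have "xprod R * F ((i ## K) + h) \<doteq> xprod R' * F ((i ## K) + h')"
    proof (rule Suc.hyps(1))
      show "h + R = h' + R'" using Suc.prems(1) unfolding N N' by simp
      show "size h = size h'" using Suc.prems(2) unfolding N N' by simp
    qed (use size K i hD Suc.prems(6) in simp_all)
    then show ?thesis unfolding N N' by simp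
  next
    case False
    have "i \<in># N' + R'" unfolding Suc.prems(1)[symmetric] N by simp
    then have "i \<in># R'" using False by simp
    then obtain R1 where R': "R' = i ## R1" by (metis insert_DiffM)
    have "size N' = Suc n" using Suc.prems(2) Suc.hyps(2) by simp
    from size_eq_Suc_imp_eq_union[OF this] obtain j h' where N': "N' = j ## h'" by blast
    have j: "j \<in> D" "on_D h'" "on_D R1" using D' unfolding N' R' by simp_all
    have ij: "i \<noteq> j" using False N' by auto
    have "(i ## (h + R)) = (i ## j ## (h' + R1))"
      using Suc.prems(1) unfolding N N' R' union_mset_add_mset_left union_mset_add_mset_right add_mset_commute[of j i] .
    then have eq: "h + R = h' + (j ## R1)" by (simp only: add_mset_add_mset_same_iff union_mset_add_mset_right)
    have "xprod R * F ((i ## K) + h) \<doteq> xprod (j ## R1) * F ((i ## K) + h')"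
    proof (rule Suc.hyps(1))
      show "h + R = h' + (j ## R1)" by (rule eq)
      show "size h = size h'" using Suc.prems(2) unfolding N N' by simp
    qed (use size K i hD Suc.prems(6) in simp_all)
    moreover have "x j * F (i ## (K + h')) \<doteq> x i * F (j ## (K + h'))"
    proof (intro coherentD(1)[OF F])
      have "size h' = size h" using Suc.prems(2) unfolding N N' by simp
      then show "Suc (size (K + h')) = r" using size by simp
    qed (use i j ij K in simp_all)
    ultimately show ?thesis unfolding N N' R'
      by (rule eqvI2[where cp = 1 and cq = "xprod R1"]) (simp add: ring_distribs mult.assoc mult.left_commute)
  qed
qed

text \<open>\<open>T n M\<close> stands for the monomial \<open>M\<close> times t^n, where
  \<open>M\<close> may have more than 2n indices. The part \<open>sel\<close> handed to
  \<open>F n\<close> is arbitrary, which \<open>coherent_exchange\<close> permits. The last three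
  properties start the induction with products of two generators; in the application
  \<open>q\<close> is d wherever a square generator occurs.\<close>

lemma monomial_section:
  obtains T where
    "\<And>n M i j. \<lbrakk>2 \<le> n; on_D M; 2 * n \<le> size M; {i, j} \<subseteq> D; i \<noteq> j\<rbrakk> \<Longrightarrow>
      w i j * T n M \<doteq> T (Suc n) (i ## j ## M)"
    "\<And>n M i j. \<lbrakk>2 \<le> n; on_D M; 2 * n \<le> size M; {i, j} \<subseteq> D; i \<noteq> j\<rbrakk> \<Longrightarrow>
      E i j * T n M \<doteq> T (Suc n) (i ## i ## M) - T (Suc n) (j ## j ## M)"
    "\<And>R i j k l. \<lbrakk>on_D R; {i, j, k, l} \<subseteq> D; i \<noteq> j; k \<noteq> l\<rbrakk> \<Longrightarrow>
      xprod R * (w i j * w k l) \<doteq> T 2 ({#i, j, k, l#} + R)"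
    "\<And>R i j p q. \<lbrakk>on_D R; {i, j, p, q} \<subseteq> D; i \<noteq> j; p \<noteq> q\<rbrakk> \<Longrightarrow>
      xprod R * (w i j * E p q) \<doteq> T 2 ({#i, j, p, p#} + R) - T 2 ({#i, j, q, q#} + R)"
    "\<And>R p q r. \<lbrakk>on_D R; {p, q, r} \<subseteq> D; p \<noteq> q; r \<noteq> q\<rbrakk> \<Longrightarrow>
      xprod R * (E p q * E r q) \<doteq>
        T 2 ({#p, p, r, r#} + R) - T 2 ({#p, p, q, q#} + R) - T 2 ({#q, q, r, r#} + R) + T 2 ({#q, q, q, q#} + R)"
proof -
  obtain F where F2: "quartic (F 2)"
    and family: "\<forall>n\<ge>2. coherent (2 * n) (F n) \<and> extends (2 * n) (F n) (F (Suc n))"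
    using coherent_family by (elim exE conjE) blast
  have F: "coherent (2 * n) (F n)" and F': "extends (2 * n) (F n) (F (Suc n))" if "2 \<le> n" for n
    using family that by simp_all
  define sel where "sel n M = (SOME N. N \<subseteq># M \<and> size N = 2 * n)" for n :: nat and M :: "nat multiset"
  have sel: "sel n M \<subseteq># M \<and> size (sel n M) = 2 * n" if "2 * n \<le> size M" for n M
  proof -
    obtain xs where xs: "mset xs = M" using ex_mset by blast
    have "mset (take (2 * n) xs) \<subseteq># M"
      using mset_subset_eq_add_left[of "mset (take (2 * n) xs)" "mset (drop (2 * n) xs)"] xs
      by (simp flip: mset_append)
    moreover have "size (mset (take (2 * n) xs)) = 2 * n" using that xs by auto
    ultimately have "\<exists>N. N \<subseteq># M \<and> size N = 2 * n" by blast
    then show ?thesis unfolding sel_def by (rule someI_ex)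
  qed
  define T where "T n M = xprod (M - sel n M) * F n (sel n M)" for n M
  have T: "xprod R * F n N \<doteq> T n (N + R)" if "2 \<le> n" "on_D N" "on_D R" "size N = 2 * n" for n N R
  proof -
    let ?N = "sel n (N + R)"
    have s: "?N \<subseteq># N + R" "size ?N = 2 * n" using sel[of n "N + R"] that by auto
    have "xprod R * F n ({#} + N) \<doteq> xprod (N + R - ?N) * F n ({#} + ?N)"
      using that s by (intro coherent_exchange[OF F]) auto
    then show ?thesis by (simp add: T_def)
  qed
  have split: thesis
    if "2 * n \<le> size M" "on_D M"
      "\<And>N R. \<lbrakk>M = N + R; on_D N; on_D R; size N = 2 * n\<rbrakk> \<Longrightarrow> thesis" for n M thesis
  proof (rule that(3))
    show "M = sel n M + (M - sel n M)" "size (sel n M) = 2 * n" using sel[OF that(1)] by auto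
    show "on_D (sel n M)" using sel[OF that(1)] that(2) by (meson set_mset_mono subset_trans)
    show "on_D (M - sel n M)" using that(2) by (meson diff_subset_eq_self set_mset_mono subset_trans)
  qed
  show thesis
  proof (rule that[of T])
    fix n M i j assume n: "2 \<le> n" and M: "on_D M" "2 * n \<le> size M" and ij: "{i, j} \<subseteq> D" "i \<noteq> j"
    from M(2,1) obtain N R where NR: "M = N + R" "on_D N" "on_D R" "size N = 2 * n" by (rule split)
    have t: "xprod R * F n N \<doteq> T n M" unfolding NR(1) using NR n by (intro T) auto
    have t2: "xprod R * F (Suc n) (a ## b ## N) \<doteq> T (Suc n) (a ## b ## M)"
      if "{a, b} \<subseteq> D" for a b
      using T[of "Suc n" "(a ## b ## N)" R] NR n that by simp
    have e: "F (Suc n) (i ## j ## N) \<doteq> w i j * F n N"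
      "F (Suc n) (i ## i ## N) - F (Suc n) (j ## j ## N) \<doteq> E i j * F n N"
      using extendsD[OF F'[OF n] ij] NR by auto
    show "w i j * T n M \<doteq> T (Suc n) (i ## j ## M)"
      by (rule eqvI3[OF t t2[OF ij(1)] e(1), where cp = "- w i j" and cq = 1 and cr = "- xprod R"])
         (simp add: algebra_simps)
    have "xprod R * F (Suc n) (i ## i ## N) \<doteq> T (Suc n) (i ## i ## M)"
      "xprod R * F (Suc n) (j ## j ## N) \<doteq> T (Suc n) (j ## j ## M)"
      using t2[of i i] t2[of j j] ij by auto
    then show "E i j * T n M \<doteq> T (Suc n) (i ## i ## M) - T (Suc n) (j ## j ## M)"
      by (rule eqvI4[OF t e(2), where cp = "- E i j" and cr = 1 and cs = "-1" and cq = "- xprod R"])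
         (simp add: algebra_simps)
  next
    fix R i j k l assume R: "on_D R" and D: "{i, j, k, l} \<subseteq> D" and ij: "i \<noteq> j" and "k \<noteq> l"
    then have "F 2 {#i, j, k, l#} \<doteq> w i j * w k l" by (intro quartic_pair[OF F2]) auto
    moreover have "xprod R * F 2 {#i, j, k, l#} \<doteq> T 2 ({#i, j, k, l#} + R)" using D R by (intro T) auto
    ultimately show "xprod R * (w i j * w k l) \<doteq> T 2 ({#i, j, k, l#} + R)"
      by (rule eqvI2[where cp = "- xprod R" and cq = 1]) (simp add: algebra_simps)
  next
    fix R i j p q assume R: "on_D R" and D: "{i, j, p, q} \<subseteq> D" and ij: "i \<noteq> j" and "p \<noteq> q"
    then have "F 2 {#i, j, p, p#} - F 2 {#i, j, q, q#} \<doteq> w i j * E p q"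
      by (intro quartic_square_diff[OF F2]) auto
    moreover have "xprod R * F 2 {#i, j, p, p#} \<doteq> T 2 ({#i, j, p, p#} + R)"
      "xprod R * F 2 {#i, j, q, q#} \<doteq> T 2 ({#i, j, q, q#} + R)" using D R by (auto intro!: T simp del: union_mset_add_mset_left)
    ultimately show "xprod R * (w i j * E p q) \<doteq> T 2 ({#i, j, p, p#} + R) - T 2 ({#i, j, q, q#} + R)"
      by (rule eqvI3[where cp = "- xprod R" and cq = 1 and cr = "-1"]) (simp add: algebra_simps)
  next
    fix R p q r assume R: "on_D R" and D: "{p, q, r} \<subseteq> D" and pq: "p \<noteq> q" "r \<noteq> q"
    have "F 2 {#p, p, r, r#} - F 2 {#p, p, q, q#} - F 2 {#q, q, r, r#} + F 2 {#q, q, q, q#} \<doteq> E p q * E r q"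
    proof (cases "p = r")
      case False
      have "F 2 {#p, p, r, r#} \<doteq> w p r * w p r" "F 2 {#p, p, q, q#} \<doteq> w p q * w p q" "F 2 {#q, q, r, r#} \<doteq> w q r * w q r"
        "F 2 {#q, q, q, q#} \<doteq> E q p * E q r + w q p * w q p + w q r * w q r - w p r * w p r"
        using False D pq by (auto intro!: quartic_pair[OF F2] quartic_quad[OF F2])
      then show ?thesis
        by (rule eqvI4[where cp = 1 and cq = "-1" and cr = "-1" and cs = 1]) (simp add: algebra_simps w_sym)
    next
      case True
      obtain m where m: "m \<in> D" "m \<noteq> p" "m \<noteq> q" by (rule fresh3)
      have "F 2 {#p, p, p, p#} \<doteq> E p q * E p m + w p q * w p q + w p m * w p m - w q m * w q m"
        "F 2 {#p, p, q, q#} \<doteq> w p q * w p q" "F 2 {#q, q, p, p#} \<doteq> w q p * w q p"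
        "F 2 {#q, q, q, q#} \<doteq> E q p * E q m + w q p * w q p + w q m * w q m - w p m * w p m"
        using D pq m by (auto intro!: quartic_pair[OF F2] quartic_quad[OF F2])
      then show ?thesis unfolding True[symmetric]
        by (rule eqvI4[where cp = 1 and cq = "-1" and cr = "-1" and cs = 1]) (simp add: algebra_simps w_sym)
    qed
    moreover have "xprod R * F 2 {#p, p, r, r#} \<doteq> T 2 ({#p, p, r, r#} + R)"
      "xprod R * F 2 {#p, p, q, q#} \<doteq> T 2 ({#p, p, q, q#} + R)"
      "xprod R * F 2 {#q, q, r, r#} \<doteq> T 2 ({#q, q, r, r#} + R)"
      "xprod R * F 2 {#q, q, q, q#} \<doteq> T 2 ({#q, q, q, q#} + R)"
      using D R by (auto intro!: T simp del: union_mset_add_mset_left)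
    ultimately show "xprod R * (E p q * E r q) \<doteq>
        T 2 ({#p, p, r, r#} + R) - T 2 ({#p, p, q, q#} + R) - T 2 ({#q, q, r, r#} + R) + T 2 ({#q, q, q, q#} + R)"
      by (rule eqvI5[where cp = "- xprod R" and cq = 1 and cr = "-1" and cs = "-1" and ct = 1]) (simp add: algebra_simps)
  qed
qed

end

subsection \<open>Evaluation of polynomials\<close>

lemma poly_mapping_sum_singles:
  fixes p :: "'a \<Rightarrow>\<^sub>0 'b::comm_monoid_add"
  shows "p = (\<Sum>m\<in>keys p. single m (lookup p m))"
proof (rule poly_mapping_eqI)
  fix k
  have "(\<Sum>m\<in>keys p. lookup (single m (lookup p m)) k) =
    (\<Sum>m\<in>keys p. if m = k then lookup p k else 0)"
    by (rule sum.cong) (auto simp: lookup_single when_def)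
  also have "\<dots> = lookup p k" by (simp add: sum.delta in_keys_iff)
  finally show "lookup p k =
    lookup (\<Sum>m\<in>keys p. single m (lookup p m)) k"
    by (simp add: lookup_sum)
qed

lemma poly_mapping_single_induct:
  fixes p :: "'a \<Rightarrow>\<^sub>0 'b::comm_monoid_add"
  assumes "Q 0" and "\<And>a b. \<lbrakk>Q a; Q b\<rbrakk> \<Longrightarrow> Q (a + b)"
    and "\<And>m. m \<in> keys p \<Longrightarrow> Q (single m (lookup p m))"
  shows "Q p"
proof -
  have "Q (\<Sum>m\<in>A. single m (lookup p m))" if "A \<subseteq> keys p" for A
    using finite_subset[OF that finite_keys] that by (induction A rule: finite_induct) (auto intro!: assms)
  from this[of "keys p"] show ?thesis by (simp flip: poly_mapping_sum_singles)
qed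

text \<open>Evaluation with an arbitrary function \<open>g\<close> on monomials. For multiplicative
  \<open>g\<close> this is \<open>eval_mpoly\<close>; the map from the Rees algebra to S uses a
  \<open>g\<close> that is not multiplicative, so only additivity is available for it.\<close>

definition lincomb :: "('a::zero \<Rightarrow> 'b::comm_ring_1) \<Rightarrow> ('m \<Rightarrow> 'b) \<Rightarrow> ('m \<Rightarrow>\<^sub>0 'a) \<Rightarrow> 'b" where
  "lincomb h g p = (\<Sum>m\<in>keys p. h (lookup p m) * g m)"

definition monom_eval :: "('v \<Rightarrow> 'b::comm_ring_1) \<Rightarrow> ('v \<Rightarrow>\<^sub>0 nat) \<Rightarrow> 'b" where
  "monom_eval f m = (\<Prod>v\<in>keys m. f v ^ lookup m v)"

lemma eval_mpoly_lincomb: "eval_mpoly h f = lincomb h (monom_eval f)"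
  by (simp add: fun_eq_iff eval_mpoly_def lincomb_def monom_eval_def)

lemma monom_eval_superset:
  assumes "finite A" "keys m \<subseteq> A"
  shows "monom_eval f m = (\<Prod>v\<in>A. f v ^ lookup m v)"
  unfolding monom_eval_def by (rule prod.mono_neutral_left) (use assms in \<open>auto simp: in_keys_iff\<close>)

lemma monom_eval_0 [simp]: "monom_eval f 0 = 1"
  by (simp add: monom_eval_def)

lemma monom_eval_single [simp]: "monom_eval f (single v n) = f v ^ n"
  by (simp add: monom_eval_superset[of "{v}"])

lemma monom_eval_add [simp]: "monom_eval f (m + n) = monom_eval f m * monom_eval f n"
proof -
  let ?A = "keys m \<union> keys n"
  have "keys (m + n) \<subseteq> ?A" by (rule keys_add)
  then show ?thesis
    by (simp add: monom_eval_superset[of ?A] lookup_add power_add prod.distrib)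
qed

locale additive_map =
  fixes h :: "'a::comm_ring_1 \<Rightarrow> 'b::comm_ring_1"
  assumes hom_zero [simp]: "h 0 = 0" and hom_add [simp]: "h (a + b) = h a + h b"
begin

lemma hom_uminus [simp]: "h (- a) = - h a"
  using hom_add[of a "- a"] by (simp add: eq_neg_iff_add_eq_0 add.commute)

lemma hom_diff [simp]: "h (a - b) = h a - h b"
  using hom_add[of a "- b"] by simp

lemma hom_sum: "h (sum f A) = (\<Sum>i\<in>A. h (f i))"
  by (induction A rule: infinite_finite_induct) auto

lemma lincomb_superset:
  assumes "finite A" "keys p \<subseteq> A"
  shows "lincomb h g p = (\<Sum>m\<in>A. h (lookup p m) * g m)"
  unfolding lincomb_def by (rule sum.mono_neutral_left) (use assms in \<open>auto simp: in_keys_iff\<close>)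

lemma lincomb_single [simp]: "lincomb h g (single m c) = h c * g m"
  by (simp add: lincomb_superset[of "{m}"])

lemma additive_lincomb: "additive_map (lincomb h g)"
proof
  show "lincomb h g 0 = 0" by (simp add: lincomb_def)
  fix p q :: "'c \<Rightarrow>\<^sub>0 'a"
  let ?A = "keys p \<union> keys q"
  have "keys (p + q) \<subseteq> ?A" by (rule keys_add)
  then show "lincomb h g (p + q) = lincomb h g p + lincomb h g q"
    by (simp add: lincomb_superset[of ?A] lookup_add distrib_right sum.distrib)
qed

end

locale type_hom = additive_map +
  assumes hom_one [simp]: "h 1 = 1" and hom_mult [simp]: "h (a * b) = h a * h b"
begin

lemma hom_power [simp]: "h (a ^ n) = h a ^ n"
  by (induction n) auto

lemma type_hom_eval: "type_hom (eval_mpoly h f)"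
proof -
  interpret e: additive_map "lincomb h (monom_eval f)" by (rule additive_lincomb)
  have one: "(1 :: ('c \<Rightarrow>\<^sub>0 nat) \<Rightarrow>\<^sub>0 'a) = single 0 1" by simp
  have single: "lincomb h (monom_eval f) (single m c * q) =
      lincomb h (monom_eval f) (single m c) * lincomb h (monom_eval f) q" for m c q
    by (induction q rule: poly_mapping_single_induct) (simp_all add: distrib_left, simp add: mult_single mult_ac)
  have "lincomb h (monom_eval f) (p * q) = lincomb h (monom_eval f) p * lincomb h (monom_eval f) q" for p q
    by (induction p rule: poly_mapping_single_induct) (simp_all add: single distrib_right)
  then show ?thesis unfolding eval_mpoly_lincomb
    by unfold_locales (simp_all add: one del: single_one)
qed

lemma eval_Var [simp]: "eval_mpoly h f (Var v) = f v"
  by (simp add: eval_mpoly_lincomb Var_def)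

lemma eval_Const [simp]: "eval_mpoly h f (Const c) = h c"
  by (simp add: eval_mpoly_lincomb Const_def)

end

lemma type_hom_comp: "\<lbrakk>type_hom h; type_hom k\<rbrakk> \<Longrightarrow> type_hom (\<lambda>a. k (h a))"
  by (simp add: type_hom_def type_hom_axioms_def additive_map_def)

lemma type_hom_id: "type_hom (\<lambda>a. a)"
  by (simp add: type_hom_def type_hom_axioms_def additive_map_def)

lemma type_hom_Const: "type_hom (Const :: 'a::comm_ring_1 \<Rightarrow> ('v, 'a) mpoly)"
  by unfold_locales (simp_all add: Const_def single_add mult_single)

lemma type_hom_pCons: "type_hom (\<lambda>a::'a::comm_ring_1. [:a:])"
  by unfold_locales (simp_all add: one_pCons)

lemma monom_eval_Var: "monom_eval Var m = (single m 1 :: ('v, 'a::comm_ring_1) mpoly)"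
proof -
  have pow: "Var v ^ n = (single (single v n) 1 :: ('v, 'a) mpoly)" for v n
    by (induction n) (simp_all add: Var_def mult_single single_add[symmetric])
  have "(\<Prod>v\<in>A. single (k v) 1 :: ('v, 'a) mpoly) = single (\<Sum>v\<in>A. k v) 1"
    if "finite A" for A :: "'v set" and k
    using that by (induction A rule: finite_induct) (simp_all add: mult_single)
  then show ?thesis
    unfolding monom_eval_def pow by (simp flip: poly_mapping_sum_singles)
qed

subsection \<open>Subrings and ideals inside a type\<close>

text \<open>The bridge from carriers to types: inside \<open>ring_on C\<close> the notions of ideal,
  generated ideal, sum and coset are rewritten with the operations of the type.\<close>

locale subring_of_type =
  fixes C :: "'a::comm_ring_1 set"
  assumes zero_closed: "0 \<in> C" and one_closed: "1 \<in> C"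
    and add_closed: "\<lbrakk>a \<in> C; b \<in> C\<rbrakk> \<Longrightarrow> a + b \<in> C"
    and uminus_closed: "a \<in> C \<Longrightarrow> - a \<in> C"
    and mult_closed: "\<lbrakk>a \<in> C; b \<in> C\<rbrakk> \<Longrightarrow> a * b \<in> C"
begin

lemma diff_closed: "\<lbrakk>a \<in> C; b \<in> C\<rbrakk> \<Longrightarrow> a - b \<in> C"
  using add_closed[of a "- b"] uminus_closed by simp

lemma power_closed: "a \<in> C \<Longrightarrow> a ^ n \<in> C"
  by (induction n) (auto intro: one_closed mult_closed)

lemma sum_closed: "(\<And>i. i \<in> A \<Longrightarrow> f i \<in> C) \<Longrightarrow> sum f A \<in> C"
  by (induction A rule: infinite_finite_induct) (auto intro: zero_closed add_closed)

lemma prod_closed: "(\<And>i. i \<in> A \<Longrightarrow> f i \<in> C) \<Longrightarrow> prod f A \<in> C"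
  by (induction A rule: infinite_finite_induct) (auto intro: one_closed mult_closed)

lemma eval_closed:
  assumes "\<And>m. m \<in> keys p \<Longrightarrow> h (lookup p m) \<in> C"
    and "\<And>m v. \<lbrakk>m \<in> keys p; v \<in> keys m\<rbrakk> \<Longrightarrow> f v \<in> C"
  shows "eval_mpoly h f p \<in> C"
  unfolding eval_mpoly_def by (intro sum_closed mult_closed prod_closed power_closed assms)

lemma cring_on: "cring (ring_on C)"
proof -
  have "\<exists>y\<in>C. x + y = 0" if "x \<in> C" for x
    using uminus_closed[OF that] by (intro bexI[of _ "- x"]) auto
  then show ?thesis
    by unfold_locales
      (auto simp: ring_of_type_algebra_def zero_closed one_closed add_closed mult_closed algebra_simps Units_def)
qed

lemma a_inv_on: "a \<in> C \<Longrightarrow> \<ominus>\<^bsub>ring_on C\<^esub> a = - a"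
proof -
  interpret R: cring "ring_on C" by (rule cring_on)
  assume a: "a \<in> C"
  have "\<ominus>\<^bsub>ring_on C\<^esub> a = - a"
    by (rule R.minus_equality) (use a in \<open>auto simp: ring_of_type_algebra_def uminus_closed\<close>)
  then show ?thesis .
qed

lemma ideal_onI:
  assumes "I \<subseteq> C" "0 \<in> I" "\<And>a b. \<lbrakk>a \<in> I; b \<in> I\<rbrakk> \<Longrightarrow> a + b \<in> I" "\<And>a c. \<lbrakk>a \<in> I; c \<in> C\<rbrakk> \<Longrightarrow> c * a \<in> I"
  shows "ideal I (ring_on C)"
proof (rule idealI)
  interpret R: cring "ring_on C" by (rule cring_on)
  show "ring (ring_on C)" by (rule R.ring_axioms)
  have "- a \<in> I" if "a \<in> I" for a
    using assms(4)[OF that, of "- 1"] uminus_closed[OF one_closed] by simp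
  then show "subgroup I (add_monoid (ring_on C))"
    using assms(1-3) a_inv_on
    by unfold_locales (auto simp: ring_of_type_algebra_def a_inv_def)
qed (use assms(4) in \<open>auto simp: ring_of_type_algebra_def mult.commute\<close>)

lemma idealD:
  assumes "ideal I (ring_on C)"
  shows "I \<subseteq> C" "0 \<in> I" "\<lbrakk>a \<in> I; b \<in> I\<rbrakk> \<Longrightarrow> a + b \<in> I" "\<lbrakk>a \<in> I; c \<in> C\<rbrakk> \<Longrightarrow> c * a \<in> I"
proof -
  interpret ideal I "ring_on C" by (rule assms)
  show "I \<subseteq> C" using a_subset by (simp add: ring_of_type_algebra_def)
  show "0 \<in> I"
    using additive_subgroup.zero_closed[OF ideal.axioms(1)[OF assms]] by (simp add: ring_of_type_algebra_def)
  show "\<lbrakk>a \<in> I; b \<in> I\<rbrakk> \<Longrightarrow> a + b \<in> I" 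
    using additive_subgroup.a_closed[OF ideal.axioms(1)[OF assms], of a b] by (simp add: ring_of_type_algebra_def)
  show "\<lbrakk>a \<in> I; c \<in> C\<rbrakk> \<Longrightarrow> c * a \<in> I" using I_l_closed[of a c] by (simp add: ring_of_type_algebra_def)
qed

lemma ideal_on_uminus: "\<lbrakk>ideal I (ring_on C); a \<in> I\<rbrakk> \<Longrightarrow> - a \<in> I"
  using idealD(4)[of I a "- 1"] uminus_closed[OF one_closed] by simp

lemma ideal_on_diff: "\<lbrakk>ideal I (ring_on C); a \<in> I; b \<in> I\<rbrakk> \<Longrightarrow> a - b \<in> I"
  using idealD(3)[of I a "- b"] ideal_on_uminus[of I b] by simp

lemma ideal_zero: "ideal {0} (ring_on C)"
  by (rule ideal_onI) (auto simp: zero_closed)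

lemma ideal_genideal: "G \<subseteq> C \<Longrightarrow> ideal (genideal (ring_on C) G) (ring_on C)"
proof -
  interpret R: cring "ring_on C" by (rule cring_on)
  show "G \<subseteq> C \<Longrightarrow> ideal (genideal (ring_on C) G) (ring_on C)"
    by (rule R.genideal_ideal) (simp add: ring_of_type_algebra_def)
qed

lemma genideal_superset: "G \<subseteq> C \<Longrightarrow> G \<subseteq> genideal (ring_on C) G"
proof -
  interpret R: cring "ring_on C" by (rule cring_on)
  show "G \<subseteq> C \<Longrightarrow> G \<subseteq> genideal (ring_on C) G"
    by (rule R.genideal_self) (simp add: ring_of_type_algebra_def)
qed

lemma genideal_least: "\<lbrakk>ideal I (ring_on C); G \<subseteq> I\<rbrakk> \<Longrightarrow> genideal (ring_on C) G \<subseteq> I"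
proof -
  interpret R: cring "ring_on C" by (rule cring_on)
  show "\<lbrakk>ideal I (ring_on C); G \<subseteq> I\<rbrakk> \<Longrightarrow> genideal (ring_on C) G \<subseteq> I"
    by (rule R.genideal_minimal)
qed

lemma set_add_on: "I <+>\<^bsub>ring_on C\<^esub> J = {a + b | a b. a \<in> I \<and> b \<in> J}"
  by (auto simp: AbelCoset.set_add_def Coset.set_mult_def ring_of_type_algebra_def)

lemma ideal_set_add: "\<lbrakk>ideal I (ring_on C); ideal J (ring_on C)\<rbrakk> \<Longrightarrow> ideal (I <+>\<^bsub>ring_on C\<^esub> J) (ring_on C)"
proof -
  interpret R: cring "ring_on C" by (rule cring_on)
  show "\<lbrakk>ideal I (ring_on C); ideal J (ring_on C)\<rbrakk> \<Longrightarrow> ideal (I <+>\<^bsub>ring_on C\<^esub> J) (ring_on C)"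
    by (rule R.add_ideals)
qed

lemma a_r_coset_on: "I +>\<^bsub>ring_on C\<^esub> a = {i + a | i. i \<in> I}"
  by (auto simp: AbelCoset.a_r_coset_def Coset.r_coset_def ring_of_type_algebra_def)

text \<open>Kernels of maps into a quotient ring are stated through cosets; with this they become
  preimages of ideals.\<close>

lemma coset_eq_ideal_iff:
  assumes "ideal I (ring_on C)"
  shows "I +>\<^bsub>ring_on C\<^esub> a = I \<longleftrightarrow> a \<in> I"
proof
  assume "I +>\<^bsub>ring_on C\<^esub> a = I"
  moreover have "0 + a \<in> I +>\<^bsub>ring_on C\<^esub> a" unfolding a_r_coset_on using idealD(2)[OF assms] by blast
  ultimately show "a \<in> I" by simp
next
  assume a: "a \<in> I"
  have "i \<in> I +>\<^bsub>ring_on C\<^esub> a" if "i \<in> I" for i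
    unfolding a_r_coset_on using ideal_on_diff[OF assms that a] by (intro CollectI exI[of _ "i - a"]) simp
  then show "I +>\<^bsub>ring_on C\<^esub> a = I" using a idealD(3)[OF assms] unfolding a_r_coset_on by auto
qed

end

lemma ideal_vimage:
  assumes "subring_of_type A" "subring_of_type B" "ideal I (ring_on B)" "type_hom h" "h ` A \<subseteq> B"
  shows "ideal {a \<in> A. h a \<in> I} (ring_on A)"
proof -
  interpret A: subring_of_type A by fact
  interpret B: subring_of_type B by fact
  interpret h: type_hom h by fact
  note I = B.idealD[OF assms(3)]
  show ?thesis
    by (rule A.ideal_onI) (use assms(5) I in \<open>auto intro: A.zero_closed A.add_closed A.mult_closed\<close>)
qed

lemma subring_of_type_UNIV: "subring_of_type UNIV"
  by unfold_locales auto

lemma subring_polys: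
  assumes "subring_of_type C"
  shows "subring_of_type (polys C V)"
proof -
  interpret C: subring_of_type C by fact
  have zero: "0 \<in> polys C V" by (simp add: polys_def C.zero_closed)
  have add: "p + q \<in> polys C V" if "p \<in> polys C V" "q \<in> polys C V" for p q
  proof -
    have "keys m \<subseteq> V" if "m \<in> keys (p + q)" for m
      using that keys_add[of p q] \<open>p \<in> polys C V\<close> \<open>q \<in> polys C V\<close> unfolding polys_def by blast
    then show ?thesis using that by (auto simp: polys_def lookup_add intro: C.add_closed)
  qed
  have single: "single m c \<in> polys C V \<longleftrightarrow> c \<in> C \<and> (c = 0 \<or> keys m \<subseteq> V)" for m c
    by (auto simp: polys_def lookup_single when_def C.zero_closed split: if_splits)
  have "p * q \<in> polys C V" if p: "p \<in> polys C V" and q: "q \<in> polys C V" for p q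
  proof (rule poly_mapping_single_induct[of "\<lambda>p. p * q \<in> polys C V"])
    fix m assume m: "m \<in> keys p"
    show "single m (lookup p m) * q \<in> polys C V"
    proof (rule poly_mapping_single_induct[of "\<lambda>q. single m (lookup p m) * q \<in> polys C V"])
      fix n assume n: "n \<in> keys q"
      have "keys (m + n) \<subseteq> V" using p q m n keys_add[of m n] unfolding polys_def by blast
      then show "single m (lookup p m) * single n (lookup q n) \<in> polys C V"
        using p q unfolding mult_single single by (auto simp: polys_def intro: C.mult_closed)
    qed (simp_all add: zero add distrib_left)
  qed (simp_all add: zero add distrib_right)
  moreover have "1 \<in> polys C V" by (auto simp: polys_def lookup_one when_def C.zero_closed C.one_closed)
  moreover have "- p \<in> polys C V" if "p \<in> polys C V" for p
    using that by (auto simp: polys_def intro: C.uminus_closed)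
  ultimately show ?thesis using zero add by unfold_locales blast+
qed

lemma single_in_polys:
  "\<lbrakk>c \<in> C; 0 \<in> C; keys m \<subseteq> V\<rbrakk> \<Longrightarrow> single m c \<in> polys C V"
  by (auto simp: polys_def lookup_single when_def)

lemma Const_in_polys: "\<lbrakk>c \<in> C; 0 \<in> C\<rbrakk> \<Longrightarrow> Const c \<in> polys C V"
  unfolding Const_def by (rule single_in_polys) auto

lemma Var_in_polys: "\<lbrakk>v \<in> V; 0 \<in> C; 1 \<in> C\<rbrakk> \<Longrightarrow> Var v \<in> polys C V"
  unfolding Var_def by (rule single_in_polys) auto

lemma eval_cong:
  assumes "\<And>m. m \<in> keys p \<Longrightarrow> h (lookup p m) = h' (lookup p m)"
    and "\<And>m v. \<lbrakk>m \<in> keys p; v \<in> keys m\<rbrakk> \<Longrightarrow> f v = f' v"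
  shows "eval_mpoly h f p = eval_mpoly h' f' p"
  unfolding eval_mpoly_def using assms by (intro sum.cong arg_cong2[where f = times] prod.cong) auto

lemma eval_Const_Var [simp]: "eval_mpoly Const Var p = (p :: ('v, 'a::comm_ring_1) mpoly)"
proof -
  have "eval_mpoly Const Var p = (\<Sum>m\<in>keys p. single m (lookup p m))"
    by (simp add: eval_mpoly_lincomb lincomb_def monom_eval_Var Const_def mult_single)
  then show ?thesis by (simp flip: poly_mapping_sum_singles)
qed

subsection \<open>Spanning monomials\<close>

text \<open>Translates exponent vectors into the multisets on which \<open>F\<close> and
  \<open>T\<close> are defined.\<close>

definition mset_of :: "('v \<Rightarrow>\<^sub>0 nat) \<Rightarrow> 'v multiset" where
  "mset_of b = (\<Sum>v\<in>keys b. replicate_mset (lookup b v) v)"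

lemma count_mset_of [simp]: "count (mset_of b) v = lookup b v"
proof -
  have "count (mset_of b) v = (\<Sum>u\<in>keys b. if u = v then lookup b v else 0)"
    unfolding mset_of_def count_sum by (rule sum.cong) auto
  also have "\<dots> = lookup b v" by (simp add: sum.delta in_keys_iff)
  finally show ?thesis .
qed

lemma mset_of_add [simp]: "mset_of (a + b) = mset_of a + mset_of b"
  by (rule multiset_eqI) (simp add: lookup_add)

lemma mset_of_0 [simp]: "mset_of 0 = {#}"
  by (rule multiset_eqI) simp

lemma mset_of_single [simp]: "mset_of (single v n) = replicate_mset n v"
  by (rule multiset_eqI) (simp add: lookup_single when_def)

lemma set_mset_of [simp]: "set_mset (mset_of b) = keys b"
  by (auto simp: set_mset_def in_keys_iff)

text \<open>A monomial as a list of variables: its degree is the length, and list induction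
  multiplies by one variable at a time.\<close>

definition var_prod :: "'v list \<Rightarrow> ('v, 'a::comm_ring_1) mpoly" where
  "var_prod vs = prod_list (map Var vs)"

lemma var_prod_simps [simp]: "var_prod [] = 1" "var_prod (v # vs) = Var v * var_prod vs"
  by (simp_all add: var_prod_def)

lemma var_prod_append: "var_prod (us @ vs) = var_prod us * var_prod vs"
  by (simp add: var_prod_def)

lemma single_var_prod:
  fixes m :: "'v \<Rightarrow>\<^sub>0 nat"
  obtains vs where "mset vs = mset_of m"
    and "\<And>c. single m c = Const (c :: 'a::comm_ring_1) * var_prod vs"
proof -
  have ex: "\<exists>vs. mset vs = mset_of m \<and> single m 1 = (var_prod vs :: ('v, 'a) mpoly)" for m :: "'v \<Rightarrow>\<^sub>0 nat"
  proof (rule poly_mapping_single_induct[where p = m])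
    show "\<exists>vs. mset vs = mset_of 0 \<and> single 0 1 = (var_prod vs :: ('v, 'a) mpoly)"
      by (rule exI[where x = "[]"]) simp
  next
    fix a b :: "'v \<Rightarrow>\<^sub>0 nat"
    assume "\<exists>vs. mset vs = mset_of a \<and> single a 1 = (var_prod vs :: ('v, 'a) mpoly)"
      and "\<exists>vs. mset vs = mset_of b \<and> single b 1 = (var_prod vs :: ('v, 'a) mpoly)"
    then obtain us vs where "mset us = mset_of a" "single a 1 = (var_prod us :: ('v, 'a) mpoly)"
      "mset vs = mset_of b" "single b 1 = (var_prod vs :: ('v, 'a) mpoly)" by blast
    then show "\<exists>vs. mset vs = mset_of (a + b) \<and> single (a + b) 1 = (var_prod vs :: ('v, 'a) mpoly)"
      using mult_single[of a "1::'a" b 1] by (intro exI[where x = "us @ vs"]) (simp add: var_prod_append)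
  next
    fix v
    let ?n = "lookup m v"
    have "single (single v n) 1 = (var_prod (replicate n v) :: ('v, 'a) mpoly)" for n
    proof (induction n)
      case (Suc n)
      have "single (single v (Suc n)) 1 =
          (Var v * single (single v n) 1 :: ('v, 'a) mpoly)"
        by (simp add: Var_def mult_single single_add[symmetric])
      then show ?case using Suc by simp
    qed simp
    moreover have "mset (replicate n v) = mset_of (single v n)" for n
      by (rule multiset_eqI) (simp add: lookup_single when_def)
    ultimately show "\<exists>vs. mset vs = mset_of (single v ?n) \<and>
        single (single v ?n) 1 = (var_prod vs :: ('v, 'a) mpoly)" by blast
  qed
  from ex[of m] obtain vs where vs: "mset vs = mset_of m" "single m 1 = (var_prod vs :: ('v, 'a) mpoly)"
    by blast
  have "single m c = Const c * var_prod vs" for c :: 'a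
    unfolding vs(2)[symmetric] by (simp add: Const_def mult_single)
  with vs(1) show thesis by (rule that)
qed

lemma var_prod_single:
  obtains b where "mset_of b = mset vs"
    and "\<And>c. Const (c :: 'a::comm_ring_1) * var_prod vs = single b c"
proof -
  have "\<exists>b. mset_of b = mset vs \<and> (\<forall>c::'a. Const c * var_prod vs = single b c)"
  proof (induction vs)
    case Nil
    then show ?case by (intro exI[where x = 0]) (simp add: Const_def)
  next
    case (Cons v vs)
    then obtain b where b: "mset_of b = mset vs" "\<And>c::'a. Const c * var_prod vs = single b c" by blast
    have "Const c * var_prod (v # vs) = single (single v 1 + b) c" for c :: 'a
    proof -
      have "Const c * var_prod (v # vs) = Var v * (Const c * var_prod vs)" by (simp add: mult_ac)
      then show ?thesis unfolding b(2) by (simp add: Var_def mult_single)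
    qed
    then show ?case using b(1) by (intro exI[where x = "single v 1 + b"]) simp
  qed
  then show thesis using that by blast
qed

lemma polys_induct:
  fixes p :: "('a, 'b::comm_ring_1) mpoly"
  assumes p: "p \<in> polys C V"
    and zero: "Q 0" and add: "\<And>a b. \<lbrakk>Q a; Q b\<rbrakk> \<Longrightarrow> Q (a + b)"
    and mono: "\<And>c vs. \<lbrakk>c \<in> C; set vs \<subseteq> V\<rbrakk> \<Longrightarrow> Q (Const c * var_prod vs)"
  shows "Q p"
proof (rule poly_mapping_single_induct[of Q])
  fix m assume m: "m \<in> keys p"
  obtain vs where vs: "mset vs = mset_of m"
    and *: "\<And>c::'b. single m c = Const c * var_prod vs"
    by (rule single_var_prod) blast
  have "set vs = keys m" using vs by (metis set_mset_mset set_mset_of)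
  then show "Q (single m (lookup p m))"
    unfolding * using p m by (intro mono) (auto simp: polys_def)
qed (fact zero add)+

section \<open>The Rees map on monomials, and degrees\<close>

lemma type_hom_rees: "type_hom (rees_map d)"
  unfolding rees_map_def by (rule type_hom.type_hom_eval[OF type_hom_pCons])

lemma rees_map_simps [simp]:
  "rees_map d (Var v) = [:0, gen d v:]" "rees_map d (Const c) = [:c:]"
  unfolding rees_map_def
  by (simp_all add: type_hom.eval_Var[OF type_hom_pCons] type_hom.eval_Const[OF type_hom_pCons])

definition gen_prod :: "nat \<Rightarrow> (nat \<times> nat) list \<Rightarrow> 'k::field rpoly" where
  "gen_prod d vs = prod_list (map (gen d) vs)"

lemma gen_prod_simps [simp]: "gen_prod d [] = 1" "gen_prod d (v # vs) = gen d v * gen_prod d vs"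
  by (simp_all add: gen_prod_def)

lemma rees_map_monomial:
  fixes c :: "'k::field rpoly"
  shows "rees_map d (Const c * var_prod vs) = Polynomial.monom (c * gen_prod d vs) (length vs)"
proof -
  interpret type_hom "rees_map d :: _ \<Rightarrow> 'k rpoly poly" by (rule type_hom_rees)
  have "rees_map d (var_prod vs) = Polynomial.monom (gen_prod d vs :: 'k rpoly) (length vs)"
  proof (induction vs)
    case (Cons v vs)
    have "[:0, gen d v:] * Polynomial.monom (gen_prod d vs) (length vs) =
      Polynomial.monom (gen d v * gen_prod d vs) (Suc (length vs))"
      using mult_monom[of "gen d v" 1 "gen_prod d vs" "length vs"] by (simp add: monom_altdef)
    then show ?case using Cons by simp
  qed (simp add: monom_0 one_pCons)
  then show ?thesis by (simp add: smult_monom)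
qed

text \<open>\<open>M_entry\<close> is typed for coefficients in a field. This version allows any
  commutative ring, so the same matrix is available over R, that is, in S.\<close>

definition entry :: "nat \<Rightarrow> nat \<Rightarrow> nat \<Rightarrow> (nat \<times> nat, 'a::comm_ring_1) mpoly" where
  "entry d i j = (if i = d \<and> j = d then 0 else Var (min i j, max i j))"

lemma finite_w_index [simp]: "finite (w_index d)"
  by (rule finite_subset[of _ "{1..d} \<times> {1..d}"]) (auto simp: w_index_def)

lemma subring_R: "subring_of_type (R_set d :: 'k::field rpoly set)"
  by (rule subring_polys[OF subring_of_type_UNIV])

text \<open>A lower bound for the degree is all that is needed: the properties of
  \<open>T n M\<close> require at least 2n indices in \<open>M\<close>, and coefficients from R may
  add more.\<close>

definition graded :: "nat \<Rightarrow> nat \<Rightarrow> (nat, 'a::zero) mpoly \<Rightarrow> bool" where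
  "graded d n f \<longleftrightarrow> (\<forall>b\<in>keys f. keys b \<subseteq> {1..d} \<and> n \<le> size (mset_of b))"

lemma keys_gen:
  assumes "v \<in> w_index d" "b \<in> keys (gen d v :: 'k::field rpoly)"
  shows "keys b \<subseteq> {1..d}" "size (mset_of b) = 2"
proof -
  obtain i j where v: "v = (i, j)" by fastforce
  have D: "{i, j, d} \<subseteq> {1..d}" using assms(1) by (auto simp: v w_index_def)
  define e :: "nat \<Rightarrow> nat \<Rightarrow> nat \<Rightarrow>\<^sub>0 nat" where "e k l = single k 1 + single l 1" for k l
  have mult: "Var k * Var l = (single (e k l) 1 :: 'k rpoly)" for k l
    by (simp add: Var_def mult_single e_def)
  have "b \<in> {e i j, e i i, e d d}"
    using assms(2) keys_diff[of "single (e i i) (1::'k)" "single (e d d) 1"]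
    by (auto simp: v gen_def power2_eq_square mult split: if_splits)
  moreover have "keys (e k l) \<subseteq> {k, l}" "size (mset_of (e k l)) = 2" for k l
    using keys_add[of "single k (1::nat)" "single l 1"] by (auto simp: e_def split: if_splits)
  ultimately show "keys b \<subseteq> {1..d}" "size (mset_of b) = 2" using D by blast+
qed

lemma graded_gen_mult:
  fixes f :: "'k::field rpoly"
  assumes "v \<in> w_index d" "graded d n f"
  shows "graded d (n + 2) (gen d v * f)"
  unfolding graded_def
proof
  fix b assume "b \<in> keys (gen d v * f)"
  then obtain a c where ac: "b = a + c" "a \<in> keys (gen d v :: 'k rpoly)" "c \<in> keys f"
    using keys_mult[of "gen d v" f] by blast
  have "keys c \<subseteq> {1..d}" "n \<le> size (mset_of c)" using assms(2) ac by (auto simp: graded_def)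
  then show "keys b \<subseteq> {1..d} \<and> n + 2 \<le> size (mset_of b)"
    using keys_gen[OF assms(1) ac(2)] keys_add[of a c] unfolding ac(1) by auto
qed

lemma graded_monomial: "set is \<subseteq> {1..d} \<Longrightarrow> graded d 0 (Const (a :: 'a::comm_ring_1) * var_prod is)"
proof -
  obtain b where b: "mset_of b = mset is" "\<And>c::'a. Const c * var_prod is = single b c"
    by (rule var_prod_single) blast
  have "keys b = set is" using b(1) by (metis set_mset_mset set_mset_of)
  then show "set is \<subseteq> {1..d} \<Longrightarrow> graded d 0 (Const a * var_prod is)"
    unfolding b(2) by (auto simp: graded_def)
qed

subsection \<open>Reduction to linear forms\<close>

locale fiber_relations =
  fixes d :: nat and P :: "'k::field spoly set"
  assumes relations: "quadric_relations P {1..d} (\<lambda>i. Const (Var i)) (entry d)"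
begin

sublocale quadric_relations P "{1..d}" "\<lambda>i. Const (Var i)" "entry d"
  by (rule relations)

text \<open>\<open>psi n f\<close> stands for f t^n. Products of at least two variables are
  recovered from their image by induction on their number. The parts of degree 0 and 1 in the w_ij
  cannot be recovered, but the coefficients of t^0 and t^1 in the image control them: if the image
  is zero, the constant vanishes and the linear part is a syzygy.\<close>

lemma reduce_to_linear:
  assumes p: "p \<in> S_set d" and rees: "rees_map d p = 0"
  obtains c where "\<And>v. c v \<in> R_set d" "(\<Sum>v\<in>w_index d. c v * gen d v) = 0"
    and "p - (\<Sum>v\<in>w_index d. Const (c v) * Var v) \<in> P"
proof -
  interpret R: subring_of_type "(R_set d :: 'k rpoly set)" by (rule subring_R)
  interpret rees: type_hom "rees_map d :: _ \<Rightarrow> 'k rpoly poly" by (rule type_hom_rees)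
  define emb :: "'k \<Rightarrow> 'k spoly" where "emb a = Const (Const a)" for a
  interpret emb: type_hom emb
    using type_hom_comp[OF type_hom_Const type_hom_Const] by (simp add: emb_def[abs_def])
  obtain T where T:
    "\<And>n M i j. \<lbrakk>2 \<le> n; on_D M; 2 * n \<le> size M; {i, j} \<subseteq> {1..d}; i \<noteq> j\<rbrakk> \<Longrightarrow>
      entry d i j * T n M \<doteq> T (Suc n) (i ## j ## M)"
    "\<And>n M i j. \<lbrakk>2 \<le> n; on_D M; 2 * n \<le> size M; {i, j} \<subseteq> {1..d}; i \<noteq> j\<rbrakk> \<Longrightarrow>
      E i j * T n M \<doteq> T (Suc n) (i ## i ## M) - T (Suc n) (j ## j ## M)"
    "\<And>R i j k l. \<lbrakk>on_D R; {i, j, k, l} \<subseteq> {1..d}; i \<noteq> j; k \<noteq> l\<rbrakk> \<Longrightarrow>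
      xprod R * (entry d i j * entry d k l) \<doteq> T 2 ({#i, j, k, l#} + R)"
    "\<And>R i j p q. \<lbrakk>on_D R; {i, j, p, q} \<subseteq> {1..d}; i \<noteq> j; p \<noteq> q\<rbrakk> \<Longrightarrow>
      xprod R * (entry d i j * E p q) \<doteq> T 2 ({#i, j, p, p#} + R) - T 2 ({#i, j, q, q#} + R)"
    "\<And>R p q r. \<lbrakk>on_D R; {p, q, r} \<subseteq> {1..d}; p \<noteq> q; r \<noteq> q\<rbrakk> \<Longrightarrow>
      xprod R * (E p q * E r q) \<doteq>
        T 2 ({#p, p, r, r#} + R) - T 2 ({#p, p, q, q#} + R) - T 2 ({#q, q, r, r#} + R) + T 2 ({#q, q, q, q#} + R)"
    by (rule monomial_section) blast
  define psi where "psi n = lincomb emb (\<lambda>b. T n (mset_of b))" for n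
  interpret psi: additive_map "psi n" for n
    unfolding psi_def by (rule emb.additive_lincomb)
  have psi_single: "psi n (single b a) = emb a * T n (mset_of b)" for n b a
    by (simp add: psi_def)
  have psi_mono: "psi n (Const a * var_prod is) = emb a * T n (mset is)" for n a "is"
  proof -
    obtain b where "mset_of b = mset is" "\<And>c::'k. Const c * var_prod is = single b c"
      by (rule var_prod_single) blast
    then show ?thesis by (simp add: psi_single)
  qed
  have entry_offdiag: "entry d i j = Var (i, j)" if "(i, j) \<in> w_index d" "i \<noteq> j" for i j
    using that by (auto simp: entry_def w_index_def)
  \<comment> \<open>Since w_dd = 0, the variable w_ii is itself a difference of diagonal entries and
    falls under the rules for \<open>E\<close>.\<close>
  have entry_diag: "E i d = Var (i, i)" if "(i, i) \<in> w_index d" for i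
    using that by (auto simp: entry_def w_index_def)
  have emb_mult: "emb a * s \<doteq> emb a * t" if "s \<doteq> t" for a s t
    using that by (rule eqv_mult)

  \<comment> \<open>From degree 2 on, \<open>psi\<close> turns multiplication by g_v t into
    multiplication by w_v: \<open>T(1)\<close> treats a mixed generator and \<open>T(2)\<close>,
    with second index d, a difference of squares.\<close>
  have step: "Var v * psi n f \<doteq> psi (Suc n) (gen d v * f)"
    if v: "v \<in> w_index d" and n: "2 \<le> n" and f: "graded d (2 * n) f" for v n f
  proof (rule poly_mapping_single_induct[where p = f])
    show "Var v * psi n 0 \<doteq> psi (Suc n) (gen d v * 0)" by simp
    show "Var v * psi n (a + b) \<doteq> psi (Suc n) (gen d v * (a + b))"
      if "Var v * psi n a \<doteq> psi (Suc n) (gen d v * a)" "Var v * psi n b \<doteq> psi (Suc n) (gen d v * b)" for a b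
      using eqv_add[OF that] by (simp add: distrib_left)
    fix b assume "b \<in> keys f"
    then have b: "on_D (mset_of b)" "2 * n \<le> size (mset_of b)" using f by (auto simp: graded_def)
    let ?a = "lookup f b"
    obtain i j where ij: "v = (i, j)" by fastforce
    then have D: "i \<in> {1..d}" "j \<in> {1..d}" "d \<in> {1..d}" using v by (auto simp: w_index_def)
    have mult2: "Var k * Var l * single b ?a =
        single (single k 1 + single l 1 + b) ?a" for k l
      by (simp add: Var_def mult_single)
    show "Var v * psi n (single b ?a) \<doteq> psi (Suc n) (gen d v * single b ?a)"
    proof (cases "i = j")
      case False
      have "entry d i j * T n (mset_of b) \<doteq> T (Suc n) (i ## j ## (mset_of b))"
        using b n D False by (intro T(1)) auto
      note this[unfolded add_mset_commute[of i j]]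
      moreover have e: "entry d i j = Var v" using v False unfolding ij by (rule entry_offdiag)
      ultimately show ?thesis using False emb_mult[of "entry d i j * T n (mset_of b)" _ ?a] unfolding e
        by (simp add: ij gen_def mult2 psi_single mult.left_commute)
    next
      case True
      then have "i \<noteq> d" using v by (auto simp: ij w_index_def)
      have e: "E i d = Var v" using v unfolding ij True by (intro entry_diag) simp
      have "E i d * T n (mset_of b) \<doteq> T (Suc n) (i ## i ## (mset_of b)) - T (Suc n) (d ## d ## (mset_of b))"
        using b n D \<open>i \<noteq> d\<close> by (intro T(2)) auto
      from emb_mult[OF this, of ?a] show ?thesis unfolding e using True
        by (simp add: ij gen_def power2_eq_square left_diff_distrib mult2 psi_single mult.left_commute right_diff_distrib)
    qed
  qed
  have xprod: "emb a * xprod (mset is) = Const (Const a * var_prod is)" for a "is"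
  proof -
    interpret c: type_hom "Const :: _ \<Rightarrow> 'k spoly" by (rule type_hom_Const)
    have "xprod (mset is) = Const (var_prod is)" by (induction "is") simp_all
    then show ?thesis by (simp add: emb_def)
  qed
  have base: "Const (Const a * var_prod is) * var_prod [u, v] \<doteq> psi 2 (Const a * var_prod is * gen_prod d [u, v])"
    if uv: "u \<in> w_index d" "v \<in> w_index d" and "is": "set is \<subseteq> {1..d}" for a "is" u v
  proof -
    have D: "d \<in> {1..d}" using uv(1) by (auto simp: w_index_def)
    have sq: "Const a * var_prod is * (Var i * Var j * (Var k * Var l)) = Const a * var_prod (i # j # k # l # is)" for i j k l
      by (simp add: mult_ac)
    obtain i j k l where ij: "u = (i, j)" and kl: "v = (k, l)" by fastforce
    have DD: "{i, j, k, l, d} \<subseteq> {1..d}" using uv D unfolding ij kl by (auto simp: w_index_def)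
    have "is'": "on_D (mset is)" using "is" by simp
    let ?R = "mset is"
    have mix: "emb a * (xprod ?R * (entry d i j * E k d)) \<doteq>
        psi 2 (Const a * var_prod is * (Var i * Var j * ((Var k)\<^sup>2 - (Var d)\<^sup>2)))"
      if "{i, j, k} \<subseteq> {1..d}" "i \<noteq> j" "k \<noteq> d" for i j k
    proof -
      have f: "Const a * var_prod is * (Var i * Var j * ((Var k)\<^sup>2 - (Var d)\<^sup>2)) =
        Const a * var_prod (i # j # k # k # is) - Const a * var_prod (i # j # d # d # is)"
        by (simp add: algebra_simps power2_eq_square)
      have "xprod ?R * (entry d i j * E k d) \<doteq> T 2 ({#i, j, k, k#} + ?R) - T 2 ({#i, j, d, d#} + ?R)"
        using "is'" that D by (intro T(4)) auto
      from emb_mult[OF this, of a] show ?thesis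
        unfolding f by (simp add: psi_mono right_diff_distrib del: var_prod_simps)
    qed
    have "emb a * (xprod ?R * (Var u * Var v)) \<doteq> psi 2 (Const a * var_prod is * (gen d u * gen d v))"
    proof (cases "i = j"; cases "k = l")
      assume ne: "i \<noteq> j" "k \<noteq> l"
      have e: "entry d i j = Var u" "entry d k l = Var v" using uv ne unfolding ij kl by (simp_all add: entry_offdiag)
      have "xprod ?R * (entry d i j * entry d k l) \<doteq> T 2 ({#i, j, k, l#} + ?R)"
        using "is'" DD ne by (intro T(3)) auto
      from emb_mult[OF this, of a] show ?thesis using ne unfolding e
        by (simp add: ij kl gen_def sq psi_mono del: var_prod_simps)
    next
      assume ne: "i \<noteq> j" "k = l"
      then have "k \<noteq> d" using uv kl by (auto simp: w_index_def)
      have e: "entry d i j = Var u" "E k d = Var v" using uv ne unfolding ij kl by (simp_all add: entry_offdiag entry_diag)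
      show ?thesis using mix[of i j k, unfolded e] \<open>k \<noteq> d\<close> DD ne by (simp add: ij kl gen_def)
    next
      assume ne: "i = j" "k \<noteq> l"
      then have "i \<noteq> d" using uv ij by (auto simp: w_index_def)
      have e: "entry d k l = Var v" "E i d = Var u" using uv ne unfolding ij kl by (simp_all add: entry_offdiag entry_diag)
      show ?thesis using mix[of k l i, unfolded e] \<open>i \<noteq> d\<close> DD ne by (simp add: ij kl gen_def mult_ac)
    next
      assume ne: "i = j" "k = l"
      then have nd: "i \<noteq> d" "k \<noteq> d" using uv ij kl by (auto simp: w_index_def)
      have e: "E i d = Var u" "E k d = Var v" using uv ne unfolding ij kl by (simp_all add: entry_diag)
      have f: "Const a * var_prod is * (gen d u * gen d v) =
          Const a * var_prod (i # i # k # k # is) - Const a * var_prod (i # i # d # d # is) -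
          Const a * var_prod (d # d # k # k # is) + Const a * var_prod (d # d # d # d # is)"
        using ne by (simp add: ij kl gen_def algebra_simps power2_eq_square)
      have "xprod ?R * (E i d * E k d) \<doteq> T 2 ({#i, i, k, k#} + ?R) - T 2 ({#i, i, d, d#} + ?R) -
          T 2 ({#d, d, k, k#} + ?R) + T 2 ({#d, d, d, d#} + ?R)"
        using "is'" DD nd by (intro T(5)) auto
      from emb_mult[OF this, of a] show ?thesis unfolding e f
        by (simp add: psi_mono right_diff_distrib distrib_left del: var_prod_simps)
    qed
    then show ?thesis by (simp add: xprod[symmetric] mult.assoc)
  qed
  have monomial: "Const (Const a * var_prod is) * var_prod vs \<doteq> psi (length vs) (Const a * var_prod is * gen_prod d vs)
      \<and> graded d (2 * length vs) (Const a * var_prod is * gen_prod d vs)"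
    if "2 \<le> length vs" "set vs \<subseteq> w_index d" "set is \<subseteq> {1..d}" for a "is" vs
    using that
  proof (induction vs)
    case (Cons v vs)
    let ?f = "Const a * var_prod is * gen_prod d vs"
    have f: "Const a * var_prod is * gen_prod d (v # vs) = gen d v * ?f" by (simp add: mult_ac)
    have "graded d 0 (Const a * var_prod is)" using Cons.prems(3) by (rule graded_monomial)
    then have g: "graded d (2 * length us) (Const a * var_prod is * gen_prod d us)" if "set us \<subseteq> w_index d" for us
      using that
    proof (induction us)
      case (Cons u us)
      have "graded d (2 * length us + 2) (gen d u * (Const a * var_prod is * gen_prod d us))"
        using Cons by (intro graded_gen_mult) auto
      then show ?case by (simp add: mult_ac)
    qed simp
    show ?case
    proof (cases "length vs = 1")
      case True
      then obtain u where u: "vs = [u]" by (auto simp: length_Suc_conv)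
      then show ?thesis using base[of v u "is" a] g[of "v # vs"] Cons.prems by (simp add: numeral_2_eq_2)
    next
      case False
      then have len: "2 \<le> length vs" using Cons.prems(1) by simp
      then have "Const (Const a * var_prod is) * var_prod vs \<doteq> psi (length vs) ?f"
        using Cons by simp
      then have "Var v * (Const (Const a * var_prod is) * var_prod vs) \<doteq> Var v * psi (length vs) ?f"
        by (rule eqv_mult)
      also have "Var v * psi (length vs) ?f \<doteq> psi (Suc (length vs)) (gen d v * ?f)"
        using Cons.prems len g[of vs] by (intro step) auto
      finally show ?thesis using g[of "v # vs"] Cons.prems(2) f by (simp add: mult_ac)
    qed
  qed simp
  \<comment> \<open>The sum starts at 2, the first degree in which \<open>T\<close> has properties;
    the two lower coefficients are kept apart in the induction below as \<open>c0\<close> and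
    \<open>c\<close>.\<close>
  define psi_total where "psi_total q = (\<Sum>n\<in>{2..Polynomial.degree q}. psi n (Polynomial.coeff q n))"
    for q :: "'k rpoly poly"
  have psi_total: "psi_total q = (\<Sum>n\<in>{2..N}. psi n (Polynomial.coeff q n))" if "Polynomial.degree q \<le> N" for q N
    unfolding psi_total_def
    by (rule sum.mono_neutral_left) (use that in \<open>auto simp: coeff_eq_0\<close>)
  have psi_total_add: "psi_total (q + r) = psi_total q + psi_total r" for q r
  proof -
    let ?N = "max (Polynomial.degree q) (Polynomial.degree r)"
    have "Polynomial.degree (q + r) \<le> ?N" by (rule degree_add_le_max)
    then show ?thesis by (simp add: psi_total[of _ ?N] sum.distrib)
  qed
  have psi_total_monom: "psi_total (Polynomial.monom f n) = (if 2 \<le> n then psi n f else 0)" for f n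
  proof -
    have "psi_total (Polynomial.monom f n) = (\<Sum>m\<in>{2..n}. if m = n then psi n f else 0)"
      unfolding psi_total[OF degree_monom_le] by (intro sum.cong) auto
    then show ?thesis by (simp add: sum.delta)
  qed
  note R_zero = R.zero_closed R.zero_closed[simplified]
  let ?lin = "\<lambda>c. \<Sum>v\<in>w_index d. Const (c v) * Var v :: 'k spoly"
  let ?R = "(R_set d :: 'k rpoly set)"
  interpret cst: type_hom "Const :: _ \<Rightarrow> 'k spoly" by (rule type_hom_Const)
  have "\<exists>c0 c. (\<forall>v. c v \<in> ?R) \<and> p \<doteq> Const c0 + ?lin c + psi_total (rees_map d p) \<and>
      Polynomial.coeff (rees_map d p) 0 = c0 \<and>
      Polynomial.coeff (rees_map d p) 1 = (\<Sum>v\<in>w_index d. c v * gen d v)" (is "?Q p")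
    using p
  proof (rule polys_induct[where Q = ?Q])
    show "?Q 0"
      by (intro exI[where x = 0] exI[where x = "\<lambda>_. 0"]) (simp add: R_zero psi_total_def)
  next
    fix p q assume "?Q p" "?Q q"
    then obtain c0 c e0 e where c: "\<forall>v. c v \<in> ?R" "p \<doteq> Const c0 + ?lin c + psi_total (rees_map d p)"
      "Polynomial.coeff (rees_map d p) 0 = c0" "Polynomial.coeff (rees_map d p) 1 = (\<Sum>v\<in>w_index d. c v * gen d v)"
      and e: "\<forall>v. e v \<in> ?R" "q \<doteq> Const e0 + ?lin e + psi_total (rees_map d q)"
      "Polynomial.coeff (rees_map d q) 0 = e0" "Polynomial.coeff (rees_map d q) 1 = (\<Sum>v\<in>w_index d. e v * gen d v)"
      by blast
    show "?Q (p + q)"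
    proof (intro exI conjI)
      show "\<forall>v. c v + e v \<in> ?R" using c(1) e(1) R.add_closed by blast
      have eq: "Const (c0 + e0) + ?lin (\<lambda>v. c v + e v) + psi_total (rees_map d (p + q)) =
          Const c0 + ?lin c + psi_total (rees_map d p) + (Const e0 + ?lin e + psi_total (rees_map d q))"
        by (simp add: psi_total_add distrib_right sum.distrib)
      show "p + q \<doteq> Const (c0 + e0) + ?lin (\<lambda>v. c v + e v) + psi_total (rees_map d (p + q))"
        unfolding eq by (rule eqv_add[OF c(2) e(2)])
    qed (simp_all add: c(3) c(4)[simplified] e(3) e(4)[simplified] distrib_right sum.distrib)
  next
    fix r and vs :: "(nat \<times> nat) list"
    assume r: "r \<in> ?R" and vs: "set vs \<subseteq> w_index d"
    from r show "?Q (Const r * var_prod vs)"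
    proof (cases vs rule: list.exhaust[case_names Nil Cons])
      case Nil
      then show ?thesis
        by (intro exI[where x = r] exI[where x = "\<lambda>_. 0"]) (simp add: R_zero psi_total_def)
    next
      case (Cons v us)
      show ?thesis
      proof (cases us)
        case Nil
        have "psi_total [:0, gen d v * r:] = 0"
          using psi_total_monom[of "gen d v * r" 1] by (simp add: monom_altdef)
        moreover have "?lin (\<lambda>u. if u = v then r else 0) = Const r * Var v"
          using vs Cons by (simp add: if_distrib[of Const] if_distrib[of "\<lambda>x. x * _"] sum.delta cong: if_cong)
        ultimately show ?thesis using r vs unfolding Cons Nil
          by (intro exI[where x = 0] exI[where x = "\<lambda>u. if u = v then r else 0"])
             (auto simp: R_zero if_distrib[of "\<lambda>x. x * _"] sum.delta cong: if_cong)
      next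
        case (Cons v' us')
        then have len: "2 \<le> length vs" using \<open>vs = v # us\<close> by simp
        have approx: "Const r * var_prod vs \<doteq> psi (length vs) (r * gen_prod d vs)"
          using r
        proof (rule polys_induct)
          fix a "is" assume "set is \<subseteq> {1..d}"
          then show "Const (Const a * var_prod is) * var_prod vs \<doteq> psi (length vs) (Const a * var_prod is * gen_prod d vs)"
            using monomial[of vs "is" a] len vs by blast
        next
          fix a b assume "Const a * var_prod vs \<doteq> psi (length vs) (a * gen_prod d vs)"
            "Const b * var_prod vs \<doteq> psi (length vs) (b * gen_prod d vs)"
          from eqv_add[OF this] show "Const (a + b) * var_prod vs \<doteq> psi (length vs) ((a + b) * gen_prod d vs)"
            by (simp add: distrib_right)
        qed simp
        show ?thesis
          unfolding rees_map_monomial psi_total_monom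
          using len approx
          by (intro exI[where x = 0] exI[where x = "\<lambda>_. 0"]) (auto simp: R_zero)
      qed
    qed
  qed
  then obtain c where c: "\<forall>v. c v \<in> ?R" "p \<doteq> ?lin c" "(\<Sum>v\<in>w_index d. c v * gen d v) = 0"
    using rees by (auto simp: psi_total_def)
  show thesis
    by (rule that[of c]) (use c in auto)
qed

end

context subring_of_type begin
lemma set_add_mem: "\<lbrakk>a \<in> I; b \<in> J\<rbrakk> \<Longrightarrow> a + b \<in> I <+>\<^bsub>ring_on C\<^esub> J"
  unfolding set_add_on by blast

lemma set_add_least: "\<lbrakk>ideal K (ring_on C); I \<subseteq> K; J \<subseteq> K\<rbrakk> \<Longrightarrow> I <+>\<^bsub>ring_on C\<^esub> J \<subseteq> K"
  unfolding set_add_on using idealD(3)[of K] by blast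
end

subsection \<open>The minors of the symmetric matrix\<close>

lemma entry_sym: "entry d i j = entry d j i"
  by (simp add: entry_def min.commute max.commute)

lemma M_entry_eq: "M_entry d i j = entry d i j"
  by (simp add: M_entry_def entry_def)

text \<open>Rows and columns stay in the order written. \<open>minor\<close> sorts both, so the two
  differ by a sign.\<close>

definition det2 :: "nat \<Rightarrow> nat \<Rightarrow> nat \<Rightarrow> nat \<Rightarrow> nat \<Rightarrow> (nat \<times> nat, 'a::comm_ring_1) mpoly" where
  "det2 d a b c e = entry d a c * entry d b e - entry d a e * entry d b c"

lemma minor_eq_det2:
  assumes "a \<noteq> b" "c \<noteq> e"
  shows "minor d ({a, b}, {c, e}) = (if (a < b) = (c < e) then 1 else - 1) * det2 d a b c e"
  using assms by (cases a b rule: linorder_cases; cases c e rule: linorder_cases)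
    (simp_all add: minor_def M_entry_eq det2_def min_def max_def mult.commute)

text \<open>When the common index is written first among the rows and among the columns,
  \<open>delta\<close> is the parity of the sorting. The sign in the generators of
  \<open>Lambda1\<close> therefore compensates for the sorting, and up to an overall sign such a
  generator is a difference of two \<open>det2\<close>.\<close>

lemma delta_eq:
  assumes "distinct [i, j, k]"
  shows "delta ({i, j}, {i, k}) = (if (i < j) = (i < k) then 0 else 1)"
proof -
  have "{i, j} \<inter> {i, k} = {i}" using assms by auto
  then show ?thesis using assms by (auto simp: delta_def Let_def min_def max_def)
qed

lemma minor_A1:
  assumes "distinct [i, j, k]"
  shows "minor d ({i, j}, {i, k}) = (- 1) ^ delta ({i, j}, {i, k}) * det2 d i j i k"
  using assms by (simp add: minor_eq_det2 delta_eq)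

lemma minor_A2: "i \<noteq> j \<Longrightarrow> minor d ({i, j}, {i, j}) = det2 d i j i j"
  by (simp add: minor_eq_det2)

lemma subring_W: "subring_of_type (polys (UNIV :: 'a::comm_ring_1 set) (w_index d))"
  by (rule subring_polys[OF subring_of_type_UNIV])

lemma subring_S: "subring_of_type (S_set d :: 'k::field spoly set)"
  by (rule subring_polys[OF subring_R])

lemma entry_in_polys:
  assumes "subring_of_type C" "i \<in> {1..d}" "j \<in> {1..d}"
  shows "entry d i j \<in> polys C (w_index d)"
proof -
  interpret C: subring_of_type C by fact
  interpret P: subring_of_type "polys C (w_index d)" by (rule subring_polys) fact
  have "(min i j, max i j) \<in> w_index d" if "\<not> (i = d \<and> j = d)"
    using assms(2,3) that by (auto simp: w_index_def min_def max_def)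
  then show ?thesis unfolding entry_def
    using P.zero_closed C.zero_closed C.one_closed by (auto intro!: Var_in_polys)
qed

lemma det2_in_polys:
  assumes "subring_of_type C" "{a, b, c, e} \<subseteq> {1..d}"
  shows "det2 d a b c e \<in> polys C (w_index d)"
proof -
  interpret P: subring_of_type "polys C (w_index d)" by (rule subring_polys) fact
  show ?thesis unfolding det2_def
    using assms(2) by (auto intro!: P.diff_closed P.mult_closed entry_in_polys assms(1))
qed

lemma submats_cases:
  assumes "m \<in> submats d"
  obtains a b c e where "m = ({a, b}, {c, e})" "a \<noteq> b" "c \<noteq> e" "{a, b, c, e} \<subseteq> {1..d}"
proof -
  obtain P Q where m: "m = (P, Q)" and P: "card P = 2" "P \<subseteq> {1..d}" and Q: "card Q = 2" "Q \<subseteq> {1..d}"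
    using assms by (auto simp: submats_def)
  obtain a b where "P = {a, b}" "a \<noteq> b" using P(1) by (auto simp: card_2_iff)
  moreover obtain c e where "Q = {c, e}" "c \<noteq> e" using Q(1) by (auto simp: card_2_iff)
  ultimately show thesis using that[of a b c e] m P Q by auto
qed

lemma minor_in_W:
  assumes "m \<in> submats d"
  shows "minor d m \<in> (W_set d :: 'k::field wpoly set)"
proof -
  interpret W: subring_of_type "(W_set d :: 'k wpoly set)" by (rule subring_W)
  obtain a b c e where m: "m = ({a, b}, {c, e})" "a \<noteq> b" "c \<noteq> e" "{a, b, c, e} \<subseteq> {1..d}"
    using assms by (rule submats_cases)
  then show ?thesis
    by (auto simp: minor_eq_det2 intro!: W.uminus_closed det2_in_polys subring_of_type_UNIV)
qed

definition gens1 :: "nat \<Rightarrow> 'k::field wpoly set" where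
  "gens1 d = {minor d m - (-1) ^ (delta m + delta n) * minor d n | m n.
        m \<in> A_submats d 1 \<and> n \<in> A_submats d 1 \<and> complementary d m n}"

definition gens2 :: "nat \<Rightarrow> 'k::field wpoly set" where
  "gens2 d = {(minor d m1 + minor d n1) - (minor d m2 + minor d n2) | m1 n1 m2 n2.
        {m1, n1, m2, n2} \<subseteq> A_submats d 2 \<and> complementary d m1 n1 \<and> complementary d m2 n2 \<and>
        (\<exists>T. principal_index d T \<and> inside T m1 \<and> inside T n1 \<and> inside T m2 \<and> inside T n2)}"

definition Lambda_gens :: "nat \<Rightarrow> 'k::field wpoly set" where
  "Lambda_gens d = minor d ` A_submats d 0 \<union>
     gens1 d \<union>
     gens2 d"

lemma Lambda_gens_in_W: "Lambda_gens d \<subseteq> (W_set d :: 'k::field wpoly set)"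
proof -
  interpret W: subring_of_type "(W_set d :: 'k wpoly set)" by (rule subring_W)
  have A: "minor d m \<in> (W_set d :: 'k wpoly set)" if "m \<in> A_submats d s" for m s
    using that by (intro minor_in_W) (auto simp: A_submats_def)
  have sgn: "(-1) ^ n * p \<in> (W_set d :: 'k wpoly set)" if "p \<in> W_set d" for n p
    using that by (cases "even n") (auto intro: W.uminus_closed)
  show ?thesis unfolding Lambda_gens_def gens1_def gens2_def
    by (auto intro!: W.diff_closed W.add_closed sgn A)
qed

text \<open>Replaces the sum of three generated ideals by its universal property.\<close>

lemma
  fixes I :: "'k::field wpoly set"
  shows Lambda_ideal: "ideal (Lambda d :: 'k wpoly set) (ring_on (W_set d))"
    and Lambda_gens_subset: "Lambda_gens d \<subseteq> (Lambda d :: 'k wpoly set)"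
    and Lambda_least: "\<lbrakk>ideal I (ring_on (W_set d)); Lambda_gens d \<subseteq> I\<rbrakk> \<Longrightarrow> Lambda d \<subseteq> I"
proof -
  interpret W: subring_of_type "(W_set d :: 'k wpoly set)" by (rule subring_W)
  let ?W = "ring_on (W_set d :: 'k wpoly set)"
  let ?G0 = "minor d ` A_submats d 0 :: 'k wpoly set"
  let ?G1 = "gens1 d :: 'k wpoly set" and ?G2 = "gens2 d :: 'k wpoly set"
  have gens: "Lambda_gens d = ?G0 \<union> ?G1 \<union> ?G2"
    unfolding Lambda_gens_def ..
  have G: "?G0 \<subseteq> W_set d" "?G1 \<subseteq> W_set d" "?G2 \<subseteq> W_set d"
    using Lambda_gens_in_W[of d, where 'k = 'k] unfolding gens by auto
  have L: "Lambda d = genideal ?W ?G0 <+>\<^bsub>?W\<^esub> genideal ?W ?G1 <+>\<^bsub>?W\<^esub> genideal ?W ?G2"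
    by (simp add: Lambda_def Lambda0_def Lambda1_def Lambda2_def W_ring_def gens1_def gens2_def)
  note ideals = W.ideal_genideal[OF G(1)] W.ideal_genideal[OF G(2)] W.ideal_genideal[OF G(3)]
  show "ideal (Lambda d) ?W"
    unfolding L by (intro W.ideal_set_add ideals)
  have zero: "0 \<in> genideal ?W ?G0" "0 \<in> genideal ?W ?G1" "0 \<in> genideal ?W ?G2"
    by (rule W.idealD(2)[OF ideals(1)], rule W.idealD(2)[OF ideals(2)], rule W.idealD(2)[OF ideals(3)])
  have mem: "(a + b) + c \<in> Lambda d" if "a \<in> genideal ?W ?G0" "b \<in> genideal ?W ?G1" "c \<in> genideal ?W ?G2" for a b c
    unfolding L using that by (intro W.set_add_mem)
  have sub: "?G0 \<subseteq> genideal ?W ?G0" "?G1 \<subseteq> genideal ?W ?G1" "?G2 \<subseteq> genideal ?W ?G2"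
    by (rule W.genideal_superset[OF G(1)], rule W.genideal_superset[OF G(2)], rule W.genideal_superset[OF G(3)])
  show "Lambda_gens d \<subseteq> (Lambda d :: 'k wpoly set)"
  proof
    fix g :: "'k wpoly" assume "g \<in> Lambda_gens d"
    then consider "g \<in> ?G0" | "g \<in> ?G1" | "g \<in> ?G2" unfolding gens by blast
    then show "g \<in> Lambda d"
    proof cases
      case 1
      then show ?thesis using mem[of g 0 0] sub(1) zero by auto
    next
      case 2
      then show ?thesis using mem[of 0 g 0] sub(2) zero by auto
    next
      case 3
      then show ?thesis using mem[of 0 0 g] sub(3) zero by auto
    qed
  qed
  show "Lambda d \<subseteq> I" if I: "ideal I ?W" "Lambda_gens d \<subseteq> I" for I
  proof -
    have "?G0 \<subseteq> I" "?G1 \<subseteq> I" "?G2 \<subseteq> I" using I(2) unfolding gens by simp_all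
    then show ?thesis unfolding L by (intro W.set_add_least W.genideal_least I(1))
  qed
qed

text \<open>The first relation is the minor with rows i, l and columns j, k. The second compares
  rows i, j and columns i, k with the complementary rows l, k and columns l, j; the products off the
  common index agree up to the factor w_jk. The third expands [ij] + [kl] - [ik] - [jl], whose
  diagonal products factor.\<close>

lemma Lambda_relations:
  fixes d :: nat
  assumes D: "{i, j, k, l} \<subseteq> {1..d}" and dist: "distinct [i, j, k, l]"
  shows "entry d i j * entry d k l - entry d i k * entry d j l \<in> (Lambda d :: 'k::field wpoly set)"
    and "entry d j k * (entry d i i - entry d l l) - (entry d i j * entry d i k - entry d l j * entry d l k)
      \<in> (Lambda d :: 'k::field wpoly set)"
    and "(entry d i i - entry d l l) * (entry d j j - entry d k k) -
        (entry d i j * entry d i j + entry d k l * entry d k l - entry d i k * entry d i k - entry d j l * entry d j l)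
      \<in> (Lambda d :: 'k::field wpoly set)"
proof -
  interpret W: subring_of_type "(W_set d :: 'k wpoly set)" by (rule subring_W)
  note uminus = W.ideal_on_uminus[OF Lambda_ideal]
  have sgn: "p \<in> Lambda d" if "(-1) ^ n * p \<in> Lambda d" for n and p :: "'k wpoly"
    using that uminus[of "- p"] by (cases "even n") auto
  have sgn_mult: "(-1) ^ (a + b) * ((-1) ^ b * p) = (-1) ^ a * p" for a b and p :: "'k wpoly"
    by (cases "even a"; cases "even b") simp_all
  have T: "principal_index d {i, j, k, l}" using D dist by (auto simp: principal_index_def)
  have sub: "({a, b}, {c, e}) \<in> submats d" if "a \<noteq> b" "c \<noteq> e" "{a, b, c, e} \<subseteq> {i, j, k, l}" for a b c e
    using that D by (auto simp: submats_def)
  have "({i, l}, {j, k}) \<in> A_submats d 0"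
    using sub[of i l j k] dist by (auto simp: A_submats_def)
  then have "minor d ({i, l}, {j, k}) \<in> (Lambda d :: 'k wpoly set)"
    using Lambda_gens_subset unfolding Lambda_gens_def by blast
  then have "det2 d i l j k \<in> (Lambda d :: 'k wpoly set)"
    using dist uminus[of "- det2 d i l j k"] by (auto simp: minor_eq_det2 split: if_splits)
  then show "entry d i j * entry d k l - entry d i k * entry d j l \<in> (Lambda d :: 'k wpoly set)"
    by (simp add: det2_def entry_sym[of d l])
  have dist': "distinct [i, j, k]" "distinct [l, k, j]" using dist by auto
  let ?m = "({i, j}, {i, k})" and ?n = "({l, k}, {l, j})"
  have "{i, j} \<inter> {i, k} = {i}" "{l, k} \<inter> {l, j} = {l}" using dist by auto
  then have "?m \<in> A_submats d 1" "?n \<in> A_submats d 1"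
    using sub[of i j i k] sub[of l k l j] dist by (auto simp: A_submats_def)
  moreover have "complementary d ?m ?n"
    unfolding complementary_def using T dist by (intro exI[where x = "{i, j, k, l}"]) (auto simp: inside_def)
  ultimately have "minor d ?m - (-1) ^ (delta ?m + delta ?n) * minor d ?n \<in> Lambda_gens d"
    unfolding Lambda_gens_def gens1_def by blast
  then have "minor d ?m - (-1) ^ (delta ?m + delta ?n) * minor d ?n \<in> (Lambda d :: 'k wpoly set)"
    using Lambda_gens_subset by blast
  moreover have "minor d ?m - (-1) ^ (delta ?m + delta ?n) * minor d ?n =
      (-1) ^ delta ?m * (det2 d i j i k - det2 d l k l j :: 'k wpoly)"
    unfolding minor_A1[OF dist'(1)] minor_A1[OF dist'(2)] sgn_mult by (simp add: right_diff_distrib)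
  ultimately have "det2 d i j i k - det2 d l k l j \<in> (Lambda d :: 'k wpoly set)"
    using sgn by metis
  moreover have "det2 d i j i k - det2 d l k l j = entry d j k * (entry d i i - entry d l l) -
      (entry d i j * entry d i k - entry d l j * entry d l k :: 'k wpoly)"
    by (simp add: det2_def algebra_simps entry_sym)
  ultimately show "entry d j k * (entry d i i - entry d l l) - (entry d i j * entry d i k - entry d l j * entry d l k)
      \<in> (Lambda d :: 'k wpoly set)" by simp
  let ?m1 = "({i, j}, {i, j})" and ?n1 = "({k, l}, {k, l})" and ?m2 = "({i, k}, {i, k})" and ?n2 = "({j, l}, {j, l})"
  have "{?m1, ?n1, ?m2, ?n2} \<subseteq> A_submats d 2"
    using sub[of i j i j] sub[of k l k l] sub[of i k i k] sub[of j l j l] dist by (auto simp: A_submats_def)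
  moreover have "complementary d ?m1 ?n1"
    unfolding complementary_def using T dist by (intro exI[where x = "{i, j, k, l}"]) (auto simp: inside_def)
  moreover have "complementary d ?m2 ?n2"
    unfolding complementary_def using T dist by (intro exI[where x = "{i, j, k, l}"]) (auto simp: inside_def)
  moreover have "inside {i, j, k, l} ?m1" "inside {i, j, k, l} ?n1" "inside {i, j, k, l} ?m2" "inside {i, j, k, l} ?n2"
    by (auto simp: inside_def)
  ultimately have "(minor d ?m1 + minor d ?n1) - (minor d ?m2 + minor d ?n2) \<in> Lambda_gens d"
    unfolding Lambda_gens_def gens2_def using T by blast
  then have "(minor d ?m1 + minor d ?n1) - (minor d ?m2 + minor d ?n2) \<in> (Lambda d :: 'k wpoly set)"
    using Lambda_gens_subset by blast
  from uminus[OF uminus[OF this]]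
  have 1: "(det2 d i j i j + det2 d k l k l) - (det2 d i k i k + det2 d j l j l) \<in> (Lambda d :: 'k wpoly set)"
    using dist by (simp add: minor_A2)
  have "(det2 d i j i j + det2 d k l k l) - (det2 d i k i k + det2 d j l j l) =
      (entry d i i - entry d l l) * (entry d j j - entry d k k) -
        (entry d i j * entry d i j + entry d k l * entry d k l - entry d i k * entry d i k - entry d j l * entry d j l :: 'k wpoly)"
    by (simp add: det2_def algebra_simps entry_sym)
  with 1 show "(entry d i i - entry d l l) * (entry d j j - entry d k k) -
        (entry d i j * entry d i j + entry d k l * entry d k l - entry d i k * entry d i k - entry d j l * entry d j l)
      \<in> (Lambda d :: 'k wpoly set)" by simp
qed

subsection \<open>The minors vanish on the fiber\<close>

text \<open>The generators extended to all index pairs, symmetric and zero at \<open>(d, d)\<close>.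
  This matches the convention for \<open>entry\<close>, so every matrix entry maps to its
  \<open>quad\<close> times t.\<close>

definition quad :: "nat \<Rightarrow> nat \<Rightarrow> nat \<Rightarrow> 'k::field rpoly" where
  "quad d i j = (if i = j then (Var i)\<^sup>2 - (Var d)\<^sup>2 else Var i * Var j)"

text \<open>The coefficientwise definition does not show that the inclusion is a ring homomorphism;
  the form as an evaluation does.\<close>

lemma W_to_S_eval: "W_to_S = eval_mpoly (\<lambda>c. Const (Const c)) Var"
proof
  fix p :: "'k::field wpoly"
  have "eval_mpoly (\<lambda>c. Const (Const c)) Var p =
      (\<Sum>m\<in>keys p. single m (Const (lookup p m) :: 'k rpoly))"
    unfolding eval_mpoly_lincomb lincomb_def monom_eval_Var
    by (rule sum.cong) (simp_all add: Const_def mult_single)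
  also have "\<dots> = W_to_S p"
  proof (rule poly_mapping_eqI)
    fix k
    have "lookup (\<Sum>m\<in>keys p. single m (Const (lookup p m) :: 'k rpoly)) k =
      (\<Sum>m\<in>keys p. if m = k then Const (lookup p k) else 0)"
      unfolding lookup_sum by (rule sum.cong) (auto simp: lookup_single when_def)
    also have "\<dots> = (if k \<in> keys p then Const (lookup p k) else 0)"
      by (simp only: sum.delta finite_keys)
    also have "\<dots> = lookup (W_to_S p) k"
      unfolding W_to_S_def Poly_Mapping.map.rep_eq by (auto simp: in_keys_iff when_def)
    finally show "lookup (\<Sum>m\<in>keys p. single m (Const (lookup p m) :: 'k rpoly)) k =
      lookup (W_to_S p) k" .
  qed
  finally show "W_to_S p = eval_mpoly (\<lambda>c. Const (Const c)) Var p" by simp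
qed

lemma type_hom_Const_Const: "type_hom (\<lambda>c::'k::field. Const (Const c :: 'k rpoly) :: 'k spoly)"
  by (rule type_hom_comp[OF type_hom_Const type_hom_Const])

lemma type_hom_W_to_S: "type_hom (W_to_S :: _ \<Rightarrow> 'k::field spoly)"
  unfolding W_to_S_eval by (rule type_hom.type_hom_eval[OF type_hom_Const_Const])

lemma W_to_S_simps [simp]:
  "W_to_S (Var v) = Var v" "W_to_S (Const c) = Const (Const c)"
  unfolding W_to_S_eval
  by (simp_all add: type_hom.eval_Var[OF type_hom_Const_Const] type_hom.eval_Const[OF type_hom_Const_Const])

lemma W_to_S_entry [simp]: "W_to_S (entry d i j) = entry d i j"
proof -
  interpret type_hom W_to_S by (rule type_hom_W_to_S)
  show ?thesis by (simp add: entry_def)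
qed

lemma rees_map_entry [simp]: "rees_map d (entry d i j) = [:0, quad d i j:]"
proof -
  interpret type_hom "rees_map d :: _ \<Rightarrow> (nat, 'a) mpoly poly" by (rule type_hom_rees)
  show ?thesis by (auto simp: entry_def quad_def gen_def min_def max_def mult.commute)
qed

definition fiber_eval :: "nat \<Rightarrow> 'k::field wpoly \<Rightarrow> 'k rpoly poly" where
  "fiber_eval d p = rees_map d (W_to_S p)"

lemma type_hom_fiber_eval: "type_hom (fiber_eval d)"
  unfolding fiber_eval_def[abs_def] by (rule type_hom_comp[OF type_hom_W_to_S type_hom_rees])

lemma fiber_eval_det2:
  "fiber_eval d (det2 d a b c e) = [:0, 0, quad d a c * quad d b e - quad d a e * quad d b c:]"
proof -
  interpret type_hom "fiber_eval d :: _ \<Rightarrow> (nat, 'a) mpoly poly" by (rule type_hom_fiber_eval)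
  have "fiber_eval d (entry d i j) = [:0, quad d i j :: (nat, 'a) mpoly:]" for i j by (simp add: fiber_eval_def)
  then show ?thesis by (simp add: det2_def)
qed

lemma complementary_cases:
  assumes "complementary d m n" "m \<in> submats d" "n \<in> submats d"
  obtains T where "card T = 4" "fst m \<subseteq> T" "snd m \<subseteq> T" "fst n = T - fst m" "snd n = T - snd m"
proof -
  obtain T where T: "principal_index d T" "inside T m" "inside T n" "fst m \<inter> fst n = {}" "snd m \<inter> snd n = {}"
    using assms(1) unfolding complementary_def by blast
  have fin: "finite T" "card T = 4" using T(1) by (auto simp: principal_index_def intro: card_ge_0_finite)
  have rest: "B = T - A" if "A \<subseteq> T" "B \<subseteq> T" "A \<inter> B = {}" "card A = 2" "card B = 2" for A B
  proof (rule card_subset_eq)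
    show "finite (T - A)" "B \<subseteq> T - A" using that fin by auto
    show "card B = card (T - A)" using that fin by (simp add: card_Diff_subset finite_subset)
  qed
  have "card (fst m) = 2" "card (snd m) = 2" "card (fst n) = 2" "card (snd n) = 2"
    using assms(2,3) by (auto simp: submats_def)
  note cards = this
  have "fst n = T - fst m" by (rule rest) (use T(2-5) cards in \<open>simp_all add: inside_def\<close>)
  moreover have "snd n = T - snd m" by (rule rest) (use T(2-5) cards in \<open>simp_all add: inside_def\<close>)
  ultimately show thesis using T(2) fin by (intro that[of T]) (auto simp: inside_def)
qed

text \<open>Off the diagonal the image matrix has the entries x_i x_j, so minors without diagonal
  entries vanish. With common index i, rows i, j and columns i, k (common index first) the
  determinant is -x_d^2 x_j x_k, which does not involve i and is the same for the complementary
  minor. A principal minor [ij] gives x_d^4 - x_d^2 (x_i^2 + x_j^2), and the sum over a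
  complementary pair depends only on the four indices together.\<close>

lemma fiber_eval_Lambda_gens:
  assumes "g \<in> Lambda_gens d"
  shows "fiber_eval d g = (0 :: 'k::field rpoly poly)"
proof -
  interpret h: type_hom "fiber_eval d :: _ \<Rightarrow> 'k rpoly poly" by (rule type_hom_fiber_eval)
  have A2: "fiber_eval d (minor d m) = [:0, 0, (Var d) ^ 4 - (Var d)\<^sup>2 * (\<Sum>i\<in>fst m. (Var i)\<^sup>2) :: 'k rpoly:] \<and> snd m = fst m"
    if m: "m \<in> A_submats d 2" for m
  proof -
    obtain P Q where PQ: "m = (P, Q)" "card P = 2" "card Q = 2" "card (P \<inter> Q) = 2"
      using m by (auto simp: A_submats_def submats_def)
    then have fin: "finite P" "finite Q" by (auto intro: card_ge_0_finite)
    have "P \<inter> Q = P" by (rule card_subset_eq) (use PQ fin in auto)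
    moreover have "P \<inter> Q = Q" by (rule card_subset_eq) (use PQ fin in auto)
    ultimately have Q: "Q = P" by simp
    obtain i j where P: "P = {i, j}" "i \<noteq> j" using PQ(2) by (auto simp: card_2_iff)
    have "quad d i i * quad d j j - quad d i j * quad d j i = (Var d) ^ 4 - (Var d)\<^sup>2 * ((Var i)\<^sup>2 + (Var j)\<^sup>2 :: 'k rpoly)"
      using P(2) by (simp add: quad_def algebra_simps power2_eq_square power4_eq_xxxx)
    then show ?thesis using P(2) by (simp add: PQ(1) Q P(1) minor_A2 fiber_eval_det2)
  qed
  have A2_pair: "fiber_eval d (minor d m + minor d n) =
      [:0, 0, 2 * (Var d) ^ 4 - (Var d)\<^sup>2 * (\<Sum>i\<in>T. (Var i)\<^sup>2) :: 'k rpoly:]"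
    if m: "m \<in> A_submats d 2" and n: "n \<in> A_submats d 2" and c: "complementary d m n"
      and T: "principal_index d T" "inside T m" "inside T n" for m n T
  proof -
    have sub: "m \<in> submats d" "n \<in> submats d" using m n by (auto simp: A_submats_def)
    \<comment> \<open>\<open>complementary\<close> brings its own set of four indices. Both it and
      \<open>T\<close> contain the disjoint row sets of \<open>m\<close> and \<open>n\<close>, so
      counting makes them equal.\<close>
    from complementary_cases[OF c sub] obtain T' where T': "fst m \<subseteq> T'" "fst n = T' - fst m" "card T' = 4" by metis
    have fin: "finite T" "card T = 4" using T(1) by (auto simp: principal_index_def intro: card_ge_0_finite)
    have "card (fst m) = 2" "card (fst n) = 2" using sub by (auto simp: submats_def)
    then have "finite (fst m)" "finite (fst n)" by (auto intro: card_ge_0_finite)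
    moreover have "fst m \<union> fst n = T'" using T' by auto
    ultimately have fin2: "finite (fst m)" "finite (fst n)" "card (fst m \<union> fst n) = 4" using T' by simp_all
    have "fst m \<union> fst n = T"
      using fin fin2 T(2,3) by (intro card_subset_eq) (auto simp: inside_def)
    then have "(\<Sum>i\<in>T. (Var i)\<^sup>2 :: 'k rpoly) = (\<Sum>i\<in>fst m. (Var i)\<^sup>2) + (\<Sum>i\<in>fst n. (Var i)\<^sup>2)"
      using fin2 T' by (subst sum.union_disjoint[symmetric]) auto
    then show ?thesis using A2[OF m] A2[OF n] by (simp add: algebra_simps)
  qed
  from assms show ?thesis unfolding Lambda_gens_def
  proof (elim UnE)
    assume "g \<in> minor d ` A_submats d 0"
    then obtain m where 1: "m \<in> A_submats d 0" "g = minor d m" by blast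
    then have "m \<in> submats d" by (auto simp: A_submats_def)
    then obtain a b c e where m: "m = ({a, b}, {c, e})" "a \<noteq> b" "c \<noteq> e" by (rule submats_cases)
    then have "card ({a, b} \<inter> {c, e}) = 0" using 1 by (auto simp: A_submats_def)
    then have "{a, b} \<inter> {c, e} = {}" by (subst (asm) card_0_eq) auto
    then show ?thesis using m by (simp add: 1(2) minor_eq_det2 fiber_eval_det2 quad_def mult_ac)
  next
    assume "g \<in> gens1 d"
    then obtain m n where 2: "m \<in> A_submats d 1" "n \<in> A_submats d 1" "complementary d m n"
      "g = minor d m - (-1) ^ (delta m + delta n) * minor d n" unfolding gens1_def by blast
    have sub: "m \<in> submats d" "n \<in> submats d" using 2 by (auto simp: A_submats_def)
    obtain P Q where PQ: "m = (P, Q)" "card P = 2" "card Q = 2" "card (P \<inter> Q) = 1"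
      using 2(1) by (auto simp: A_submats_def submats_def)
    then obtain i where i: "P \<inter> Q = {i}" by (auto simp: card_1_singleton_iff)
    have other: "\<exists>j. B = {i, j} \<and> j \<noteq> i" if "card B = 2" "i \<in> B" for B
    proof -
      have "card (B - {i}) = 1" using that by simp
      then obtain j where "B - {i} = {j}" by (auto simp: card_1_singleton_iff)
      then show ?thesis using that(2) by blast
    qed
    have "i \<in> P" "i \<in> Q" using i by auto
    then obtain j k where j: "P = {i, j}" "j \<noteq> i" and k: "Q = {i, k}" "k \<noteq> i"
      using other PQ(2,3) by metis
    have dist: "distinct [i, j, k]" using i j k by auto
    obtain T where T0: "card T = 4" "fst m \<subseteq> T" "snd m \<subseteq> T" "fst n = T - fst m" "snd n = T - snd m"
      by (rule complementary_cases[OF 2(3) sub])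
    then have T: "card T = 4" "{i, j, k} \<subseteq> T" "fst n = T - {i, j}" "snd n = T - {i, k}"
      by (simp_all add: PQ(1) j(1) k(1))
    have "finite T" using T(1) by (auto intro: card_ge_0_finite)
    then have "card (T - {i, j, k}) = 1" using T dist by (simp add: card_Diff_subset)
    then obtain l where l: "T - {i, j, k} = {l}" by (auto simp: card_1_singleton_iff)
    \<comment> \<open>In the set i, j, k, l the rows i, j leave k, l and the columns i, k leave j,
      l. So the complementary submatrix has common index \<open>l\<close>, with the roles of
      \<open>j\<close> and \<open>k\<close> exchanged.\<close>
    have n: "n = ({l, k}, {l, j})"
    proof (rule prod_eqI)
      show "fst n = fst ({l, k}, {l, j})" unfolding T(3) fst_conv using l T(2) dist by auto
      show "snd n = snd ({l, k}, {l, j})" unfolding T(4) snd_conv using l T(2) dist by auto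
    qed
    have dist': "distinct [l, k, j]" using l dist by auto
    have val: "quad d a a * quad d b c - quad d a c * quad d b a = - ((Var d)\<^sup>2 * Var b * Var c :: 'k rpoly)"
      if "distinct [a, b, c]" for a b c
      using that by (simp add: quad_def algebra_simps power2_eq_square)
    have m: "m = ({i, j}, {i, k})" using PQ j k by simp
    have sgn_mult: "(-1) ^ (a + b) * ((-1) ^ b * p) = (-1) ^ a * p" for a b and p :: "'k wpoly"
      by (cases "even a"; cases "even b") simp_all
    have "g = (-1) ^ delta m * (det2 d i j i k - det2 d l k l j)"
      unfolding 2(4) m n minor_A1[OF dist] minor_A1[OF dist'] sgn_mult by (simp add: right_diff_distrib)
    moreover have "fiber_eval d (det2 d i j i k) = (fiber_eval d (det2 d l k l j) :: 'k rpoly poly)"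
      unfolding fiber_eval_det2 val[OF dist] val[OF dist'] by (simp add: mult_ac)
    ultimately show ?thesis by simp
  next
    assume "g \<in> gens2 d"
    then obtain m1 n1 m2 n2 T where 3: "{m1, n1, m2, n2} \<subseteq> A_submats d 2" "complementary d m1 n1"
      "complementary d m2 n2" "principal_index d T" "inside T m1" "inside T n1" "inside T m2" "inside T n2"
      "g = (minor d m1 + minor d n1) - (minor d m2 + minor d n2)"
      unfolding gens2_def by (elim CollectE exE conjE)
    have "fiber_eval d (minor d m1 + minor d n1) = [:0, 0, 2 * (Var d) ^ 4 - (Var d)\<^sup>2 * (\<Sum>i\<in>T. (Var i)\<^sup>2) :: 'k rpoly:]"
      "fiber_eval d (minor d m2 + minor d n2) = [:0, 0, 2 * (Var d) ^ 4 - (Var d)\<^sup>2 * (\<Sum>i\<in>T. (Var i)\<^sup>2) :: 'k rpoly:]"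
      using 3 by (auto intro!: A2_pair simp del: h.hom_add)
    then show ?thesis unfolding 3(9) h.hom_diff by simp
  qed
qed

subsection \<open>The ideals in explicit form\<close>

lemma type_hom_eqI:
  fixes g h :: "('v, 'a::comm_ring_1) mpoly \<Rightarrow> 'b::comm_ring_1"
  assumes "type_hom g" "type_hom h" "\<And>c. g (Const c) = h (Const c)" "\<And>v. g (Var v) = h (Var v)"
  shows "g p = h p"
proof -
  interpret g: type_hom g by fact
  interpret h: type_hom h by fact
  have "g (var_prod vs) = h (var_prod vs)" for vs by (induction vs) (simp_all add: assms)
  note var_prod = this
  have "p \<in> polys UNIV UNIV" by (simp add: polys_def)
  then show ?thesis by (rule polys_induct) (simp_all add: assms var_prod)
qed

lemma ring_simps:
  "R_ring d = ring_on (R_set d)"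
  "W_ring d = ring_on (W_set d)"
  "S_ring d = ring_on (S_set d)"
  "SymP_ring d = ring_on (Sym_set d)"
  "carrier (ring_on C) = C" "\<zero>\<^bsub>ring_on C\<^esub> = 0"
  by (simp_all add: R_ring_def W_ring_def S_ring_def SymP_ring_def ring_of_type_algebra_def)

lemma zero_FactRing: "\<zero>\<^bsub>R Quot I\<^esub> = I"
  by (simp add: FactRing_def)

lemma J_ideal_eq: "J_ideal d = {p \<in> S_set d. rees_map d p \<in> {0}}"
  by (simp add: J_ideal_def a_kernel_def' ring_simps Rees_ring_def Rt_ring_def ring_of_type_algebra_def)

lemma ideal_J: "ideal (J_ideal d) (S_ring d)"
  unfolding J_ideal_eq ring_simps
  by (rule ideal_vimage[OF subring_S subring_of_type_UNIV subring_of_type.ideal_zero[OF subring_of_type_UNIV] type_hom_rees])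
     simp

lemma ideal_I: "ideal (I_ideal d) (ring_on (R_set d :: 'k::field rpoly set))"
  and quad_in_I: "{i, j} \<subseteq> {1..d} \<Longrightarrow> quad d i j \<in> (I_ideal d :: 'k::field rpoly set)"
  and I_least: "\<lbrakk>ideal K (ring_on (R_set d :: 'k::field rpoly set)); \<And>i j. {i, j} \<subseteq> {1..d} \<Longrightarrow> quad d i j \<in> K\<rbrakk>
    \<Longrightarrow> I_ideal d \<subseteq> K"
proof -
  interpret R: subring_of_type "(R_set d :: 'k rpoly set)" by (rule subring_R)
  let ?R = "ring_on (R_set d :: 'k rpoly set)"
  let ?G = "{Var i * Var j | i j. i \<in> {1..d} \<and> j \<in> {1..d} \<and> i \<noteq> j} \<union>
      {(Var k)\<^sup>2 - (Var d)\<^sup>2 | k. k \<in> {1..d} \<and> k \<noteq> d} :: 'k rpoly set"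
  have I: "I_ideal d = genideal ?R ?G" by (simp add: I_ideal_def R_ring_def)
  have var: "(Var i :: 'k rpoly) \<in> R_set d" if "i \<in> {1..d}" for i
    using that by (intro Var_in_polys) auto
  have G: "?G \<subseteq> R_set d"
  proof
    fix g assume "g \<in> ?G"
    then consider i j where "g = Var i * Var j" "i \<in> {1..d}" "j \<in> {1..d}"
      | k where "g = (Var k)\<^sup>2 - (Var d)\<^sup>2" "k \<in> {1..d}" "d \<in> {1..d}" by force
    then show "g \<in> R_set d"
      by cases (simp_all only: R.mult_closed R.diff_closed R.power_closed var)
  qed
  show ideal: "ideal (I_ideal d) ?R" unfolding I by (rule R.ideal_genideal[OF G])
  show "quad d i j \<in> (I_ideal d :: 'k rpoly set)" if ij: "{i, j} \<subseteq> {1..d}" for i j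
  proof (cases "i = d \<and> j = d")
    case True
    then show ?thesis using R.idealD(2)[OF ideal] by (simp add: quad_def)
  next
    case False
    then have "quad d i j \<in> ?G" using ij unfolding quad_def by auto
    then show ?thesis unfolding I using R.genideal_superset[OF G] by blast
  qed
  show "I_ideal d \<subseteq> K" if K: "ideal K ?R" "\<And>i j. {i, j} \<subseteq> {1..d} \<Longrightarrow> quad d i j \<in> K" for K
    unfolding I
  proof (rule R.genideal_least[OF K(1)])
    show "?G \<subseteq> K"
    proof
      fix g assume "g \<in> ?G"
      then consider i j where "g = Var i * Var j" "i \<in> {1..d}" "j \<in> {1..d}" "i \<noteq> j"
        | k where "g = (Var k)\<^sup>2 - (Var d)\<^sup>2" "k \<in> {1..d}" "k \<noteq> d" by blast
      then show "g \<in> K"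
      proof cases
        case (1 i j)
        then show ?thesis using K(2)[of i j] by (simp add: quad_def)
      next
        case (2 k)
        then show ?thesis using K(2)[of k k] by (simp add: quad_def)
      qed
    qed
  qed
qed

lemma gen_eq_quad: "gen d (i, j) = quad d i j"
  by (simp add: gen_def quad_def)

section \<open>The symmetric algebra and the ideal L\<close>

definition sym_eval :: "nat \<Rightarrow> 'k::field spoly \<Rightarrow> 'k sympoly" where
  "sym_eval d = eval_mpoly Const (\<lambda>ij. Var (gen d ij))"

lemma type_hom_sym_eval: "type_hom (sym_eval d)"
  unfolding sym_eval_def by (rule type_hom.type_hom_eval[OF type_hom_Const])

lemma sym_eval_simps [simp]: "sym_eval d (Var v) = Var (gen d v)" "sym_eval d (Const c) = Const c"
  unfolding sym_eval_def
  by (simp_all add: type_hom.eval_Var[OF type_hom_Const] type_hom.eval_Const[OF type_hom_Const])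

lemma subring_Sym: "subring_of_type (Sym_set d :: 'k::field sympoly set)"
  by (rule subring_polys[OF subring_R])

lemma I_subset_R: "I_ideal d \<subseteq> (R_set d :: 'k::field rpoly set)"
  by (rule subring_of_type.idealD(1)[OF subring_R ideal_I])

definition Sym_gens :: "nat \<Rightarrow> 'k::field sympoly set" where
  "Sym_gens d = {Var (a + b) - (Var a + Var b) | a b. a \<in> I_ideal d \<and> b \<in> I_ideal d} \<union>
      {Var (r * a) - Const r * Var a | r a. r \<in> R_set d \<and> a \<in> I_ideal d}"

lemma Sym_rels_eq: "Sym_rels d = genideal (ring_on (Sym_set d :: 'k::field sympoly set)) (Sym_gens d)"
  by (simp add: Sym_rels_def Sym_gens_def ring_simps)

lemma Sym_gens_subset: "Sym_gens d \<subseteq> (Sym_set d :: 'k::field sympoly set)"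
proof -
  interpret R: subring_of_type "(R_set d :: 'k rpoly set)" by (rule subring_R)
  interpret S: subring_of_type "(Sym_set d :: 'k sympoly set)" by (rule subring_Sym)
  note I = R.idealD[OF ideal_I]
  have var: "Var a \<in> (Sym_set d :: 'k sympoly set)" if "a \<in> I_ideal d" for a
    using that R.zero_closed R.one_closed by (intro Var_in_polys)
  have const: "Const r \<in> (Sym_set d :: 'k sympoly set)" if "r \<in> R_set d" for r
    using that R.zero_closed by (intro Const_in_polys)
  show ?thesis unfolding Sym_gens_def
    by (auto intro!: S.diff_closed S.add_closed S.mult_closed var const I(3,4) simp del: atLeastAtMost_iff One_nat_def)
qed

lemma ideal_Sym_rels: "ideal (Sym_rels d) (ring_on (Sym_set d :: 'k::field sympoly set))"
  unfolding Sym_rels_eq by (rule subring_of_type.ideal_genideal[OF subring_Sym Sym_gens_subset])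

lemma Sym_gens_in_rels: "Sym_gens d \<subseteq> Sym_rels d"
  unfolding Sym_rels_eq by (rule subring_of_type.genideal_superset[OF subring_Sym Sym_gens_subset])

lemma L_ideal_eq: "L_ideal d = {p \<in> S_set d. sym_eval d p \<in> Sym_rels d}"
  unfolding L_ideal_def a_kernel_def' Sym_ring_def zero_FactRing sym_map_def ring_simps sym_eval_def
    subring_of_type.coset_eq_ideal_iff[OF subring_Sym ideal_Sym_rels] ..

lemma gen_in_I: "v \<in> w_index d \<Longrightarrow> gen d v \<in> I_ideal d"
  using quad_in_I[of "fst v" "snd v" d] by (cases v) (auto simp: gen_eq_quad w_index_def)

lemma sym_eval_image:
  "sym_eval d ` (S_set d :: 'k::field spoly set) \<subseteq> Sym_set d"
proof
  fix q assume "q \<in> sym_eval d ` (S_set d :: 'k spoly set)"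
  then obtain p where p: "p \<in> (S_set d :: 'k spoly set)" "q = sym_eval d p" by blast
  interpret R: subring_of_type "(R_set d :: 'k rpoly set)" by (rule subring_R)
  interpret S: subring_of_type "(Sym_set d :: 'k sympoly set)" by (rule subring_Sym)
  show "q \<in> Sym_set d"
    unfolding p(2) sym_eval_def
  proof (rule S.eval_closed)
    fix m assume "m \<in> keys p"
    then show "Const (lookup p m) \<in> (Sym_set d :: 'k sympoly set)"
      using p(1) R.zero_closed by (intro Const_in_polys) (auto simp: polys_def)
    fix v assume "v \<in> keys m"
    then have "v \<in> w_index d" using p(1) \<open>m \<in> _\<close> by (auto simp: polys_def)
    then show "Var (gen d v) \<in> (Sym_set d :: 'k sympoly set)"
      using gen_in_I R.zero_closed R.one_closed by (intro Var_in_polys)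
  qed
qed

lemma ideal_L: "ideal (L_ideal d) (S_ring d)"
  unfolding L_ideal_eq ring_simps
  by (rule ideal_vimage[OF subring_S subring_Sym ideal_Sym_rels type_hom_sym_eval sym_eval_image])

text \<open>R[It] is a quotient of Sym(I): \<open>phi\<close> sends the variable attached to
  \<open>a\<close> to a t, kills the relations of Sym(I), and becomes the Rees map when composed
  with \<open>sym_eval\<close>.\<close>

lemma L_subset_J: "L_ideal d \<subseteq> (J_ideal d :: 'k::field spoly set)"
proof -
  define phi :: "'k sympoly \<Rightarrow> _" where "phi = eval_mpoly (\<lambda>a. [:a:]) (\<lambda>a. [:0, a:])"
  have phi: "type_hom phi" unfolding phi_def by (rule type_hom.type_hom_eval[OF type_hom_pCons])
  interpret phi: type_hom phi by (rule phi)
  have simps: "phi (Var a) = [:0, a:]" "phi (Const a) = [:a:]" for a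
    unfolding phi_def by (simp_all add: type_hom.eval_Var[OF type_hom_pCons] type_hom.eval_Const[OF type_hom_pCons])
  let ?K = "{p \<in> (Sym_set d :: 'k sympoly set). phi p \<in> {0}}"
  have "ideal ?K (ring_on (Sym_set d))"
    by (rule ideal_vimage[OF subring_Sym subring_of_type_UNIV subring_of_type.ideal_zero[OF subring_of_type_UNIV] phi]) simp
  moreover have "Sym_gens d \<subseteq> ?K"
  proof
    fix g :: "'k sympoly" assume g: "g \<in> Sym_gens d"
    then have "phi g = 0" by (auto simp: Sym_gens_def simps)
    then show "g \<in> ?K" using g Sym_gens_subset by blast
  qed
  ultimately have "Sym_rels d \<subseteq> ?K" unfolding Sym_rels_eq by (rule subring_of_type.genideal_least[OF subring_Sym])
  moreover have "phi (sym_eval d p) = rees_map d p" for p :: "'k spoly"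
    by (rule type_hom_eqI[OF type_hom_comp[OF type_hom_sym_eval phi] type_hom_rees]) (simp_all add: simps)
  ultimately show ?thesis unfolding L_ideal_eq J_ideal_eq by auto
qed

text \<open>Modulo the relations of Sym(I) a linear form collapses to the single variable attached
  to its value in I. For a syzygy this value is 0, and \<open>Var 0\<close> is itself a relation.
  The list of triples permits repeated entries and the position \<open>(d, d)\<close>.\<close>

lemma linear_syzygy_in_L:
  fixes ts :: "('k::field rpoly \<times> nat \<times> nat) list"
  assumes ts: "\<And>c i j. (c, i, j) \<in> set ts \<Longrightarrow> c \<in> R_set d \<and> {i, j} \<subseteq> {1..d}"
    and zero: "(\<Sum>(c, i, j)\<leftarrow>ts. c * quad d i j) = 0"
  shows "(\<Sum>(c, i, j)\<leftarrow>ts. Const c * entry d i j) \<in> L_ideal d"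
proof -
  interpret R: subring_of_type "(R_set d :: 'k rpoly set)" by (rule subring_R)
  interpret S: subring_of_type "(S_set d :: 'k spoly set)" by (rule subring_S)
  interpret T: subring_of_type "(Sym_set d :: 'k sympoly set)" by (rule subring_Sym)
  interpret h: type_hom "sym_eval d :: _ \<Rightarrow> 'k sympoly" by (rule type_hom_sym_eval)
  let ?N = "Sym_rels d :: 'k sympoly set"
  note I = R.idealD[OF ideal_I] and N = T.idealD[OF ideal_Sym_rels]
  have add: "Var (a + b) - (Var a + Var b) \<in> ?N" if "a \<in> I_ideal d" "b \<in> I_ideal d" for a b
    using that by (intro subsetD[OF Sym_gens_in_rels]) (auto simp: Sym_gens_def)
  have mult: "Var (r * a) - Const r * Var a \<in> ?N" if "r \<in> R_set d" "a \<in> I_ideal d" for r a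
    using that by (intro subsetD[OF Sym_gens_in_rels]) (auto simp: Sym_gens_def)
  interpret cst: type_hom "Const :: _ \<Rightarrow> 'k sympoly" by (rule type_hom_Const)
  \<comment> \<open>The scalar relation for r = 0 and a = 0.\<close>
  have var0: "Var 0 \<in> ?N" using mult[OF R.zero_closed I(2)] by simp
  have entry: "sym_eval d (entry d i j) - Var (quad d i j) \<in> ?N" if "{i, j} \<subseteq> {1..d}" for i j
  proof (cases "i = d \<and> j = d")
    case True
    then show ?thesis using T.ideal_on_uminus[OF ideal_Sym_rels var0] by (simp add: entry_def quad_def)
  next
    case False
    then have "sym_eval d (entry d i j) = (Var (quad d i j) :: 'k sympoly)"
      by (auto simp: entry_def quad_def gen_def min_def max_def mult.commute)
    then show ?thesis using N(2) by simp
  qed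
  have "(\<Sum>(c, i, j)\<leftarrow>us. c * quad d i j) \<in> I_ideal d \<and>
      sym_eval d (\<Sum>(c, i, j)\<leftarrow>us. Const c * entry d i j) - Var (\<Sum>(c, i, j)\<leftarrow>us. c * quad d i j) \<in> ?N \<and>
      (\<Sum>(c, i, j)\<leftarrow>us. Const c * entry d i j) \<in> (S_set d :: 'k spoly set)"
    if "set us \<subseteq> set ts" for us
    using that
  proof (induction us)
    case Nil
    then show ?case using I(2) T.ideal_on_uminus[OF ideal_Sym_rels var0] S.zero_closed by simp
  next
    case (Cons t us)
    obtain c i j where t: "t = (c, i, j)" by (metis prod_cases3)
    have c: "c \<in> R_set d" "{i, j} \<subseteq> {1..d}" using ts[of c i j] Cons.prems t by auto
    let ?s = "\<Sum>(c, i, j)\<leftarrow>us. c * quad d i j" and ?e = "\<Sum>(c, i, j)\<leftarrow>us. Const c * entry d i j"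
    have IH: "?s \<in> I_ideal d" "sym_eval d ?e - Var ?s \<in> ?N"
      "?e \<in> (S_set d :: 'k spoly set)" using Cons by auto
    have q: "quad d i j \<in> I_ideal d" using c(2) by (rule quad_in_I)
    have cq: "c * quad d i j \<in> I_ideal d" using c(1) q by (intro I(4))
    have C: "Const c \<in> (Sym_set d :: 'k sympoly set)"
      "Const c \<in> (S_set d :: 'k spoly set)"
      using c(1) R.zero_closed by (auto intro!: Const_in_polys)
    have "Const c * (sym_eval d (entry d i j) - Var (quad d i j)) \<in> ?N"
      using entry[OF c(2)] C(1) by (intro N(4))
    from N(3)[OF this IH(2)] T.ideal_on_uminus[OF ideal_Sym_rels N(3)[OF mult[OF c(1) q] add[OF cq IH(1)]]]
    have "(Const c * (sym_eval d (entry d i j) - Var (quad d i j)) + (sym_eval d ?e - Var ?s)) +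
        - ((Var (c * quad d i j) - Const c * Var (quad d i j)) + (Var (c * quad d i j + ?s) - (Var (c * quad d i j) + Var ?s))) \<in> ?N"
      by (rule N(3))
    also have "(Const c * (sym_eval d (entry d i j) - Var (quad d i j)) + (sym_eval d ?e - Var ?s)) +
        - ((Var (c * quad d i j) - Const c * Var (quad d i j)) + (Var (c * quad d i j + ?s) - (Var (c * quad d i j) + Var ?s))) =
      sym_eval d (Const c * entry d i j + ?e) - Var (c * quad d i j + ?s)"
      by (simp add: algebra_simps)
    finally have "sym_eval d (Const c * entry d i j + ?e) - Var (c * quad d i j + ?s) \<in> ?N" .
    moreover have "c * quad d i j + ?s \<in> I_ideal d" using cq IH(1) by (rule I(3))
    moreover have "Const c * entry d i j + ?e \<in> (S_set d :: 'k spoly set)"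
      using C(2) IH(3) c(2) by (intro S.add_closed S.mult_closed entry_in_polys subring_R) auto
    ultimately show ?case by (simp add: t)
  qed
  note result = this[of ts, OF order.refl, unfolded zero]
  have "sym_eval d (\<Sum>(c, i, j)\<leftarrow>ts. Const c * entry d i j) - Var 0 + Var 0 \<in> ?N"
    using result by (intro N(3) var0) blast
  then show ?thesis using result unfolding L_ideal_eq by simp
qed

subsection \<open>The special fiber ring\<close>

text \<open>Measures by how much the degree in the x_i exceeds twice the degree in t. The Rees
  algebra has excess at least 0, its extension of the maximal ideal at least 1, and the image of W
  exactly 0.\<close>

definition order_ge :: "nat \<Rightarrow> 'k::field rpoly poly set" where
  "order_ge k = {q. \<forall>n. \<forall>b\<in>keys (Polynomial.coeff q n). 2 * n + k \<le> size (mset_of b)}"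

lemma order_ge_zero [simp]: "0 \<in> order_ge k"
  by (simp add: order_ge_def)

lemma order_ge_add: "\<lbrakk>p \<in> order_ge k; q \<in> order_ge k\<rbrakk> \<Longrightarrow> p + q \<in> order_ge k"
  using keys_add unfolding order_ge_def by (fastforce simp: subset_iff)

lemma order_ge_mult:
  assumes "p \<in> order_ge 0" "q \<in> order_ge k"
  shows "p * q \<in> order_ge k"
  unfolding order_ge_def
proof (intro CollectI allI ballI)
  fix n b assume "b \<in> keys (Polynomial.coeff (p * q) n)"
  then obtain i where i: "i \<le> n" "b \<in> keys (Polynomial.coeff p i * Polynomial.coeff q (n - i))"
    using keys_sum[of "\<lambda>i. Polynomial.coeff p i * Polynomial.coeff q (n - i)" "{..n}"] unfolding coeff_mult by blast
  then obtain a c where "b = a + c" "a \<in> keys (Polynomial.coeff p i)" "c \<in> keys (Polynomial.coeff q (n - i))"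
    using keys_mult by blast
  moreover from this have "2 * i + 0 \<le> size (mset_of a)" "2 * (n - i) + k \<le> size (mset_of c)"
    using assms unfolding order_ge_def by blast+
  ultimately show "2 * n + k \<le> size (mset_of b)" using i(1) by simp
qed

lemma order_ge_const: "[:a:] \<in> order_ge k \<longleftrightarrow> (\<forall>b\<in>keys a. k \<le> size (mset_of b))"
  by (auto simp: order_ge_def coeff_pCons split: nat.splits)

lemma order_ge_t: "[:0, a:] \<in> order_ge 0 \<longleftrightarrow> (\<forall>b\<in>keys a. 2 \<le> size (mset_of b))"
  by (auto simp: order_ge_def coeff_pCons split: nat.splits)

lemma order_ge_0_const: "[:a:] \<in> order_ge 0"
  by (simp add: order_ge_const)

lemma ideal_order:
  "ideal {a \<in> R_set d. [:a:] \<in> order_ge k} (ring_on (R_set d :: 'k::field rpoly set))"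
proof -
  interpret R: subring_of_type "(R_set d :: 'k rpoly set)" by (rule subring_R)
  show ?thesis
  proof (rule R.ideal_onI)
    show "a + b \<in> {a \<in> R_set d. [:a:] \<in> order_ge k}"
      if "a \<in> {a \<in> R_set d. [:a:] \<in> order_ge k}" "b \<in> {a \<in> R_set d. [:a:] \<in> order_ge k}" for a b :: "'k rpoly"
      using that order_ge_add[of "[:a:]" k "[:b:]"] R.add_closed[of a b] by simp
    show "c * a \<in> {a \<in> R_set d. [:a:] \<in> order_ge k}"
      if "a \<in> {a \<in> R_set d. [:a:] \<in> order_ge k}" "c \<in> R_set d" for a c :: "'k rpoly"
      using that order_ge_mult[OF order_ge_0_const, of "[:a:]" k c] R.mult_closed[of c a] by (simp add: mult.commute)
  qed (auto simp: R.zero_closed R.zero_closed[simplified] order_ge_def)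
qed

section \<open>The Rees algebra as a generated subring\<close>

definition Rees_carrier :: "nat \<Rightarrow> 'k::field rpoly poly set" where
  "Rees_carrier d = carrier (Rees_ring d)"

lemma Rees_ring_eq: "Rees_ring d = ring_on (Rees_carrier d)"
  by (simp add: Rees_carrier_def Rees_ring_def Rt_ring_def)

lemma subring_Rt: "subring_of_type {p. \<forall>n. Polynomial.coeff p n \<in> (R_set d :: 'k::field rpoly set)}"
proof -
  interpret R: subring_of_type "(R_set d :: 'k rpoly set)" by (rule subring_R)
  show ?thesis
    by unfold_locales
      (auto simp: coeff_mult coeff_1 simp del: atLeastAtMost_iff One_nat_def
        intro: R.zero_closed R.one_closed R.add_closed R.uminus_closed R.mult_closed R.sum_closed)
qed

definition Rees_gens :: "nat \<Rightarrow> 'k::field rpoly poly set" where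
  "Rees_gens d = {[:a:] | a. a \<in> R_set d} \<union> {[:0, a:] | a. a \<in> I_ideal d}"

lemma Rt_ring_eq: "Rt_ring d = ring_on {p. \<forall>n. Polynomial.coeff p n \<in> (R_set d :: 'k::field rpoly set)}"
  by (simp add: Rt_ring_def ring_simps)

lemma Rees_carrier_eq: "Rees_carrier d = generate_ring (Rt_ring d) (Rees_gens d)"
  by (simp add: Rees_carrier_def Rees_ring_def Rees_gens_def ring_simps)

text \<open>\<open>generate_ring\<close> closes under the additive inverse of the ambient ring
  structure, which is tied to the minus of the type only on the carrier. Hence the elements are
  first located in that carrier.\<close>

lemma Rt_uminus:
  assumes "h \<in> (Rees_carrier d :: 'k::field rpoly poly set)"
  shows "\<ominus>\<^bsub>Rt_ring d\<^esub> h = - h"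
proof -
  interpret R: subring_of_type "(R_set d :: 'k rpoly set)" by (rule subring_R)
  interpret Rt: subring_of_type "{p. \<forall>n. Polynomial.coeff p n \<in> (R_set d :: 'k rpoly set)}" by (rule subring_Rt)
  interpret ring: cring "Rt_ring d :: 'k rpoly poly ring" unfolding Rt_ring_eq by (rule Rt.cring_on)
  have "Rees_gens d \<subseteq> carrier (Rt_ring d :: 'k rpoly poly ring)"
  proof
    fix q :: "'k rpoly poly" assume "q \<in> Rees_gens d"
    then obtain a where "a \<in> R_set d" "q = [:a:] \<or> q = [:0, a:]"
      unfolding Rees_gens_def using I_subset_R by blast
    then show "q \<in> carrier (Rt_ring d)"
      unfolding Rt_ring_eq ring_simps using R.zero_closed
      by (auto simp: coeff_pCons simp del: atLeastAtMost_iff One_nat_def split: nat.splits)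
  qed
  then have "h \<in> carrier (Rt_ring d)"
    using ring.generate_ring_in_carrier assms unfolding Rees_carrier_eq by blast
  then show ?thesis unfolding Rt_ring_eq by (intro Rt.a_inv_on) (simp add: ring_simps)
qed

lemma Rees_induct [consumes 1, case_names one const shift uminus add mult]:
  assumes q: "q \<in> (Rees_carrier d :: 'k::field rpoly poly set)"
    and one: "Q 1"
    and const: "\<And>a. a \<in> R_set d \<Longrightarrow> Q [:a:]"
    and shift: "\<And>a. a \<in> I_ideal d \<Longrightarrow> Q [:0, a:]"
    and uminus: "\<And>a. Q a \<Longrightarrow> Q (- a)"
    and add: "\<And>a b. \<lbrakk>Q a; Q b\<rbrakk> \<Longrightarrow> Q (a + b)"
    and mult: "\<And>a b. \<lbrakk>Q a; Q b\<rbrakk> \<Longrightarrow> Q (a * b)"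
  shows "Q q"
  using q unfolding Rees_carrier_eq
proof (induction rule: generate_ring.induct)
  case one
  then show ?case using assms(2) by (simp add: Rt_ring_eq ring_of_type_algebra_def)
next
  case (incl h)
  then show ?case using const shift by (auto simp: Rees_gens_def)
next
  case (a_inv h)
  then show ?case using Rt_uminus[of h d] uminus by (simp add: Rees_carrier_eq)
next
  case (eng_add h1 h2)
  then show ?case using add by (simp add: Rt_ring_eq ring_of_type_algebra_def)
next
  case (eng_mult h1 h2)
  then show ?case using mult by (simp add: Rt_ring_eq ring_of_type_algebra_def)
qed

lemma subring_Rees: "subring_of_type (Rees_carrier d :: 'k::field rpoly poly set)"
proof -
  let ?G = "Rees_carrier d :: 'k rpoly poly set"
  have one: "1 \<in> ?G"
    using generate_ring.one[of "Rt_ring d"] by (simp add: Rees_carrier_eq Rt_ring_eq ring_of_type_algebra_def)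
  have uminus: "- a \<in> ?G" if "a \<in> ?G" for a
    using generate_ring.a_inv[of a "Rt_ring d"] that Rt_uminus[OF that] by (simp add: Rees_carrier_eq)
  have add: "a + b \<in> ?G" if "a \<in> ?G" "b \<in> ?G" for a b
    using generate_ring.eng_add[of a "Rt_ring d" _ b] that by (simp add: Rees_carrier_eq Rt_ring_eq ring_of_type_algebra_def)
  have mult: "a * b \<in> ?G" if "a \<in> ?G" "b \<in> ?G" for a b
    using generate_ring.eng_mult[of a "Rt_ring d" _ b] that by (simp add: Rees_carrier_eq Rt_ring_eq ring_of_type_algebra_def)
  have "0 \<in> ?G" using add[OF one uminus[OF one]] by simp
  then show ?thesis using one uminus add mult by unfold_locales
qed

lemma Rees_order_ge: "(Rees_carrier d :: 'k::field rpoly poly set) \<subseteq> order_ge 0"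
proof
  fix q :: "'k rpoly poly" assume "q \<in> Rees_carrier d"
  then show "q \<in> order_ge 0"
  proof (induction rule: Rees_induct)
    case (shift a)
    have "I_ideal d \<subseteq> {a \<in> R_set d. [:a :: 'k rpoly:] \<in> order_ge 2}"
    proof (rule I_least[OF ideal_order])
      fix i j assume ij: "{i, j} \<subseteq> {1..d}"
      then have "quad d i j \<in> (R_set d :: 'k rpoly set)" using quad_in_I I_subset_R by blast
      moreover have "2 \<le> size (mset_of b)" if "b \<in> keys (quad d i j :: 'k rpoly)" for b
      proof -
        have "(i, j) \<in> w_index d \<or> (j, i) \<in> w_index d \<or> i = d \<and> j = d" using ij by (auto simp: w_index_def)
        moreover have eq: "quad d i j = (gen d (j, i) :: 'k rpoly)" by (auto simp: quad_def gen_def mult.commute)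
        ultimately show ?thesis
        proof (elim disjE conjE)
          assume "(i, j) \<in> w_index d"
          then show ?thesis using keys_gen(2)[of "(i, j)" d b, where 'k = 'k] that by (simp add: gen_eq_quad)
        next
          assume "(j, i) \<in> w_index d"
          then show ?thesis using keys_gen(2)[of "(j, i)" d b, where 'k = 'k] that unfolding eq by simp
        next
          assume "i = d" "j = d"
          then show ?thesis using that by (simp add: quad_def)
        qed
      qed
      ultimately show "quad d i j \<in> {a \<in> R_set d. [:a :: 'k rpoly:] \<in> order_ge 2}"
        by (simp add: order_ge_const)
    qed
    then show ?case using shift by (auto simp: order_ge_const order_ge_t)
  next
    case (uminus a)
    then show ?case by (simp add: order_ge_def keys_def)
  qed (use order_ge_0_const[of 1] in \<open>simp_all add: order_ge_0_const order_ge_add order_ge_mult one_pCons\<close>)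
qed

lemma ideal_mRees: "ideal (mRees d) (ring_on (Rees_carrier d :: 'k::field rpoly poly set))"
  and mRees_order_ge: "mRees d \<subseteq> (order_ge 1 :: 'k rpoly poly set)"
proof -
  interpret R: subring_of_type "(R_set d :: 'k rpoly set)" by (rule subring_R)
  interpret Re: subring_of_type "Rees_carrier d :: 'k rpoly poly set" by (rule subring_Rees)
  let ?m = "genideal (R_ring d) (Var ` {1..d}) :: 'k rpoly set"
  have vars: "Var ` {1..d} \<subseteq> (R_set d :: 'k rpoly set)" by (auto intro!: Var_in_polys)
  have m: "mRees d = genideal (ring_on (Rees_carrier d)) {[:a:] | a. a \<in> ?m}"
    by (simp add: mRees_def Rees_ring_eq)
  have m_R: "?m \<subseteq> R_set d"
    unfolding ring_simps by (rule R.idealD(1)[OF R.ideal_genideal[OF vars]])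
  have const: "[:a:] \<in> Rees_carrier d" if "a \<in> (R_set d :: 'k rpoly set)" for a
    unfolding Rees_carrier_eq using that by (intro generate_ring.incl) (auto simp: Rees_gens_def)
  then have gens: "{[:a:] | a. a \<in> ?m} \<subseteq> Rees_carrier d" using m_R by auto
  show "ideal (mRees d) (ring_on (Rees_carrier d :: 'k rpoly poly set))"
    unfolding m by (rule Re.ideal_genideal[OF gens])
  have "?m \<subseteq> {a \<in> R_set d. [:a :: 'k rpoly:] \<in> order_ge 1}"
    unfolding ring_simps
  proof (rule R.genideal_least[OF ideal_order])
    show "Var ` {1..d} \<subseteq> {a \<in> R_set d. [:a :: 'k rpoly:] \<in> order_ge 1}"
      using vars by (auto simp: order_ge_const Var_def)
  qed
  then have "{[:a:] | a. a \<in> ?m} \<subseteq> {q \<in> Rees_carrier d. q \<in> order_ge 1}" using gens by blast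
  moreover have "ideal {q \<in> Rees_carrier d. q \<in> order_ge 1} (ring_on (Rees_carrier d :: 'k rpoly poly set))"
    using Rees_order_ge[of d, where 'k = 'k]
    by (intro Re.ideal_onI) (auto intro: Re.add_closed Re.mult_closed Re.zero_closed order_ge_add order_ge_mult)
  ultimately show "mRees d \<subseteq> (order_ge 1 :: 'k rpoly poly set)"
    unfolding m using Re.genideal_least by blast
qed

text \<open>Coefficients of W are scalars, so the degree in the x_i comes from the generators alone:
  two for each factor t.\<close>

lemma keys_fiber_eval:
  assumes p: "p \<in> (W_set d :: 'k::field wpoly set)"
    and b: "b \<in> keys (Polynomial.coeff (fiber_eval d p) n)"
  shows "size (mset_of b) = 2 * n"
proof -
  interpret h: type_hom "fiber_eval d :: _ \<Rightarrow> 'k rpoly poly" by (rule type_hom_fiber_eval)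
  have mono: "size (mset_of b) = 2 * length vs" if "set vs \<subseteq> w_index d"
    "b \<in> keys (Const c * gen_prod d vs :: 'k rpoly)" for b c vs
    using that
  proof (induction vs arbitrary: b)
    case Nil
    then show ?case by (simp add: Const_def split: if_splits)
  next
    case (Cons v vs)
    have "Const c * gen_prod d (v # vs) = gen d v * (Const c * gen_prod d vs :: 'k rpoly)" by (simp add: mult_ac)
    then have "b \<in> keys (gen d v * (Const c * gen_prod d vs :: 'k rpoly))"
      using Cons.prems(2) by metis
    then obtain a e where "b = a + e" "a \<in> keys (gen d v :: 'k rpoly)"
      "e \<in> keys (Const c * gen_prod d vs :: 'k rpoly)"
      using keys_mult by blast
    then show ?case using Cons.IH[of e] Cons.prems(1) keys_gen(2)[of v d a] by simp
  qed
  have "\<forall>n. \<forall>b\<in>keys (Polynomial.coeff (fiber_eval d p) n). size (mset_of b) = 2 * n"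
    using p
  proof (rule polys_induct)
    fix a b :: "'k wpoly"
    assume "\<forall>n. \<forall>c\<in>keys (Polynomial.coeff (fiber_eval d a) n). size (mset_of c) = 2 * n"
      "\<forall>n. \<forall>c\<in>keys (Polynomial.coeff (fiber_eval d b) n). size (mset_of c) = 2 * n"
    then show "\<forall>n. \<forall>c\<in>keys (Polynomial.coeff (fiber_eval d (a + b)) n). size (mset_of c) = 2 * n"
      using keys_add by (fastforce simp: subset_iff)
  next
    fix c and vs :: "(nat \<times> nat) list" assume vs: "set vs \<subseteq> w_index d"
    interpret w: type_hom "W_to_S :: _ \<Rightarrow> 'k spoly" by (rule type_hom_W_to_S)
    have "W_to_S (var_prod vs) = (var_prod vs :: 'k spoly)"
      by (induction vs) simp_all
    then have "W_to_S (Const c * var_prod vs) = (Const (Const c) * var_prod vs :: 'k spoly)"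
      by simp
    then have "fiber_eval d (Const c * var_prod vs) = Polynomial.monom (Const c * gen_prod d vs) (length vs)"
      unfolding fiber_eval_def by (simp only: rees_map_monomial)
    then show "\<forall>n. \<forall>b\<in>keys (Polynomial.coeff (fiber_eval d (Const c * var_prod vs)) n). size (mset_of b) = 2 * n"
      using mono[OF vs] by simp
  qed simp
  then show ?thesis using b by blast
qed

text \<open>The image of W has excess 0 and \<open>mRees\<close> has excess at least 1, so they meet
  only in 0. The kernel into the fiber ring is therefore the kernel of the map from W to R[It]; here
  the generation of I in one degree is used.\<close>

lemma IX_ideal_eq: "IX_ideal d = {p \<in> (W_set d :: 'k::field wpoly set). fiber_eval d p \<in> {0}}"
proof -
  have "fiber_eval d p \<in> mRees d \<longleftrightarrow> fiber_eval d p = 0" if p: "p \<in> (W_set d :: 'k wpoly set)" for p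
  proof
    assume m: "fiber_eval d p \<in> mRees d"
    show "fiber_eval d p = 0"
    proof (rule poly_eqI)
      fix n
      have "keys (Polynomial.coeff (fiber_eval d p) n) = {}"
        using keys_fiber_eval[OF p] m mRees_order_ge[of d, where 'k = 'k] by (fastforce simp: order_ge_def)
      then show "Polynomial.coeff (fiber_eval d p) n = Polynomial.coeff 0 n" by simp
    qed
  next
    assume "fiber_eval d p = 0"
    then show "fiber_eval d p \<in> mRees d" using subring_of_type.idealD(2)[OF subring_Rees ideal_mRees] by simp
  qed
  then show ?thesis
    unfolding IX_ideal_def a_kernel_def' Fiber_ring_def zero_FactRing fiber_map_def Rees_ring_eq ring_simps
      subring_of_type.coset_eq_ideal_iff[OF subring_Rees ideal_mRees] fiber_eval_def[symmetric] by auto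
qed

subsection \<open>The defining ideals\<close>

lemma W_to_S_in_S:
  assumes "p \<in> (W_set d :: 'k::field wpoly set)"
  shows "W_to_S p \<in> S_set d"
proof -
  interpret R: subring_of_type "(R_set d :: 'k rpoly set)" by (rule subring_R)
  interpret S: subring_of_type "(S_set d :: 'k spoly set)" by (rule subring_S)
  show ?thesis unfolding W_to_S_eval
    using assms R.zero_closed R.one_closed
    by (intro S.eval_closed Const_in_polys Var_in_polys) (auto simp: polys_def)
qed

lemma ideal_LambdaS: "ideal (LambdaS d) (ring_on (S_set d :: 'k::field spoly set))"
  and W_to_S_Lambda: "p \<in> (Lambda d :: 'k::field wpoly set) \<Longrightarrow> W_to_S p \<in> LambdaS d"
  and LambdaS_least: "\<lbrakk>ideal K (ring_on (S_set d :: 'k::field spoly set));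
    \<And>p. p \<in> Lambda d \<Longrightarrow> W_to_S p \<in> K\<rbrakk> \<Longrightarrow> LambdaS d \<subseteq> K"
proof -
  interpret S: subring_of_type "(S_set d :: 'k spoly set)" by (rule subring_S)
  have sub: "W_to_S ` Lambda d \<subseteq> (S_set d :: 'k spoly set)"
    using subring_of_type.idealD(1)[OF subring_W Lambda_ideal] W_to_S_in_S by blast
  show "ideal (LambdaS d) (ring_on (S_set d :: 'k spoly set))"
    unfolding LambdaS_def ring_simps by (rule S.ideal_genideal[OF sub])
  show "p \<in> (Lambda d :: 'k wpoly set) \<Longrightarrow> W_to_S p \<in> LambdaS d" for p
    unfolding LambdaS_def ring_simps using S.genideal_superset[OF sub] by blast
  show "\<lbrakk>ideal K (ring_on (S_set d :: 'k spoly set));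
    \<And>p. p \<in> Lambda d \<Longrightarrow> W_to_S p \<in> K\<rbrakk> \<Longrightarrow> LambdaS d \<subseteq> K" for K
    unfolding LambdaS_def ring_simps by (rule S.genideal_least) auto
qed

lemma Lambda_subset_IX: "Lambda d \<subseteq> (IX_ideal d :: 'k::field wpoly set)"
  unfolding IX_ideal_eq
proof (rule Lambda_least)
  show "ideal {p \<in> (W_set d :: 'k wpoly set). fiber_eval d p \<in> {0}} (ring_on (W_set d))"
    by (rule ideal_vimage[OF subring_W subring_of_type_UNIV subring_of_type.ideal_zero[OF subring_of_type_UNIV] type_hom_fiber_eval])
       simp
  show "Lambda_gens d \<subseteq> {p \<in> (W_set d :: 'k wpoly set). fiber_eval d p \<in> {0}}"
    using Lambda_gens_in_W fiber_eval_Lambda_gens by blast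
qed

lemma LambdaS_subset_J: "LambdaS d \<subseteq> (J_ideal d :: 'k::field spoly set)"
proof (rule LambdaS_least)
  show "ideal (J_ideal d) (ring_on (S_set d :: 'k spoly set))"
    using ideal_J by (simp add: ring_simps)
  fix p :: "'k wpoly" assume "p \<in> Lambda d"
  then show "W_to_S p \<in> J_ideal d"
    using Lambda_subset_IX W_to_S_in_S unfolding IX_ideal_eq J_ideal_eq fiber_eval_def by blast
qed

text \<open>The hypotheses on \<open>rho\<close> are tailored to its two uses: as a retraction onto \<open>S\<close>, and as the
  reduction of \<open>S\<close> modulo the variables of \<open>R\<close>.\<close>

lemma fiber_relations_vimage:
  fixes rho :: "'k::field spoly \<Rightarrow> 'b::comm_ring_1"
  assumes d: "4 \<le> d" and C: "subring_of_type C" and I: "ideal I (ring_on C)"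
    and rho: "type_hom rho" and image: "\<And>p. rho p \<in> C"
    and syzygy: "\<And>ts. \<lbrakk>\<And>c i j. (c, i, j) \<in> set ts \<Longrightarrow> (\<exists>k\<in>{1..d}. c = Var k \<or> c = - Var k) \<and> {i, j} \<subseteq> {1..d};
      (\<Sum>(c, i, j)\<leftarrow>ts. c * quad d i j) = 0\<rbrakk> \<Longrightarrow> rho (\<Sum>(c, i, j)\<leftarrow>ts. Const c * entry d i j) \<in> I"
    and Lambda: "\<And>p. p \<in> Lambda d \<Longrightarrow> rho (W_to_S p) \<in> I"
  shows "fiber_relations d {p. rho p \<in> I}"
proof -
  interpret C: subring_of_type C by fact
  interpret rho: type_hom rho by fact
  interpret w: type_hom "W_to_S :: _ \<Rightarrow> 'k spoly" by (rule type_hom_W_to_S)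
  interpret c: type_hom "Const :: _ \<Rightarrow> 'k spoly" by (rule type_hom_Const)
  interpret R: subring_of_type "(R_set d :: 'k rpoly set)" by (rule subring_R)
  note I' = C.idealD[OF I]
  show ?thesis
  proof (intro fiber_relations.intro quadric_relations.intro type_ideal.intro quadric_relations_axioms.intro)
    show "finite {1..d}" "4 \<le> card {1..d}" using d by auto
    show "entry d i j = (entry d j i :: 'k spoly)" for i j by (rule entry_sym)
    show "0 \<in> {p. rho p \<in> I}" using I'(2) by simp
    show "a + b \<in> {p. rho p \<in> I}" if "a \<in> {p. rho p \<in> I}" "b \<in> {p. rho p \<in> I}" for a b
      using that I'(3) by simp
    show "c * a \<in> {p. rho p \<in> I}" if "a \<in> {p. rho p \<in> I}" for a c
      using that I'(4) image by simp
  next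
    fix i j k assume D: "{i, j, k} \<subseteq> {1..d}" and dist: "distinct [i, j, k]"
    have "rho (\<Sum>(c, i, j)\<leftarrow>[(Var i, j, k), (- Var j, i, k)]. Const c * entry d i j) \<in> I"
    proof (rule syzygy)
      show "(\<Sum>(c, i, j)\<leftarrow>[(Var i, j, k), (- Var j, i, k)]. c * quad d i j) = 0"
        using dist by (simp add: quad_def algebra_simps)
    qed (use D in auto)
    then show "Const (Var i) * entry d j k - Const (Var j) * entry d i k \<in> {p. rho p \<in> I}" by simp
    \<comment> \<open>The difference of the squares of x_i and x_j takes two triples, because each
      diagonal \<open>quad\<close> subtracts the square of x_d.\<close>
    have "rho (\<Sum>(c, i, j)\<leftarrow>[(Var k, i, i), (- Var k, j, j), (- Var i, i, k), (Var j, j, k)]. Const c * entry d i j) \<in> I"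
    proof (rule syzygy)
      show "(\<Sum>(c, i, j)\<leftarrow>[(Var k, i, i), (- Var k, j, j), (- Var i, i, k), (Var j, j, k)]. c * quad d i j) = 0"
        using dist by (simp add: quad_def algebra_simps power2_eq_square)
    qed (use D in auto)
    then show "Const (Var k) * (entry d i i - entry d j j) - (Const (Var i) * entry d i k - Const (Var j) * entry d j k)
        \<in> {p. rho p \<in> I}" by (simp add: algebra_simps)
  next
    fix i j k l assume "{i, j, k, l} \<subseteq> {1..d}" "distinct [i, j, k, l]"
    note rel = Lambda_relations[OF this, where 'k = 'k, THEN Lambda]
    show "entry d i j * entry d k l - entry d i k * entry d j l \<in> {p. rho p \<in> I}"
      "entry d j k * (entry d i i - entry d l l) - (entry d i j * entry d i k - entry d l j * entry d l k) \<in> {p. rho p \<in> I}"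
      "(entry d i i - entry d l l) * (entry d j j - entry d k k) -
        (entry d i j * entry d i j + entry d k l * entry d k l - entry d i k * entry d i k - entry d j l * entry d j l)
        \<in> {p. rho p \<in> I}"
      using rel by simp_all
  qed
qed

text \<open>The reduction asks for an ideal of the whole type. The homomorphism \<open>rho\<close>
  drops all variables foreign to S and is the identity on S, so the preimage of the sum of the two
  ideals is such an ideal and meets S in that sum.\<close>

lemma reduce_J:
  assumes d: "4 \<le> d" and p: "p \<in> (J_ideal d :: 'k::field spoly set)"
  shows "p \<in> L_ideal d <+>\<^bsub>S_ring d\<^esub> LambdaS d"
proof -
  let ?C = "(S_set d :: 'k spoly set)"
  interpret R: subring_of_type "(R_set d :: 'k rpoly set)" by (rule subring_R)
  interpret S: subring_of_type ?C by (rule subring_S)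
  define r :: "'k rpoly \<Rightarrow> 'k rpoly" where
    "r = eval_mpoly Const (\<lambda>i. if i \<in> {1..d} then Var i else 0)"
  define rho :: "'k spoly \<Rightarrow> 'k spoly" where
    "rho = eval_mpoly (\<lambda>c. Const (r c)) (\<lambda>v. if v \<in> w_index d then Var v else 0)"
  have r: "type_hom r" unfolding r_def by (rule type_hom.type_hom_eval[OF type_hom_Const])
  have rho: "type_hom rho" unfolding rho_def
    by (rule type_hom.type_hom_eval[OF type_hom_comp[OF r type_hom_Const]])
  have r_image: "r c \<in> R_set d" for c
    unfolding r_def
    by (rule R.eval_closed) (use R.zero_closed in \<open>auto intro!: Const_in_polys Var_in_polys simp del: atLeastAtMost_iff One_nat_def\<close>)
  have r_id: "r c = c" if "c \<in> R_set d" for c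
  proof -
    have "r c = eval_mpoly Const Var c"
      unfolding r_def
    proof (rule eval_cong)
      fix m v assume "m \<in> keys c" "v \<in> keys m"
      then have "v \<in> {1..d}" using that unfolding polys_def by blast
      then show "(if v \<in> {1..d} then Var v else 0) = Var v" by simp
    qed simp
    then show ?thesis by simp
  qed
  have image: "rho p \<in> ?C" for p
    unfolding rho_def
    by (rule S.eval_closed)
       (use S.zero_closed R.zero_closed R.one_closed r_image in \<open>auto intro!: Const_in_polys Var_in_polys simp del: atLeastAtMost_iff One_nat_def\<close>)
  have rho_id: "rho p = p" if "p \<in> ?C" for p
  proof -
    have "rho p = eval_mpoly Const Var p"
      unfolding rho_def by (rule eval_cong) (use that r_id in \<open>auto simp: polys_def simp del: atLeastAtMost_iff One_nat_def\<close>)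
    then show ?thesis by simp
  qed
  have L: "ideal (L_ideal d) (ring_on ?C)" using ideal_L by (simp add: ring_simps)
  let ?I = "L_ideal d <+>\<^bsub>ring_on ?C\<^esub> LambdaS d"
  have I: "ideal ?I (ring_on ?C)" by (rule S.ideal_set_add[OF L ideal_LambdaS])
  have L_I: "a \<in> ?I" if "a \<in> L_ideal d" for a
    using S.set_add_mem[OF that S.idealD(2)[OF ideal_LambdaS]] by simp
  have La_I: "a \<in> ?I" if "a \<in> LambdaS d" for a
    using S.set_add_mem[OF S.idealD(2)[OF L] that] by simp
  have L_C: "L_ideal d \<subseteq> ?C" by (rule S.idealD(1)[OF L])
  have La_C: "LambdaS d \<subseteq> ?C" by (rule S.idealD(1)[OF ideal_LambdaS])
  interpret fiber_relations d "{p. rho p \<in> ?I}"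
  proof (rule fiber_relations_vimage[OF d subring_S I rho image])
    fix ts :: "('k rpoly \<times> nat \<times> nat) list"
    assume ts: "\<And>c i j. (c, i, j) \<in> set ts \<Longrightarrow> (\<exists>k\<in>{1..d}. c = Var k \<or> c = - Var k) \<and> {i, j} \<subseteq> {1..d}"
      and zero: "(\<Sum>(c, i, j)\<leftarrow>ts. c * quad d i j) = 0"
    have var: "(Var k :: 'k rpoly) \<in> R_set d" if "k \<in> {1..d}" for k
      using that by (intro Var_in_polys) auto
    have "(\<Sum>(c, i, j)\<leftarrow>ts. Const c * entry d i j) \<in> L_ideal d"
    proof (rule linear_syzygy_in_L[OF _ zero])
      fix c i j assume "(c, i, j) \<in> set ts"
      then obtain k where "k \<in> {1..d}" "c = Var k \<or> c = - Var k" "{i, j} \<subseteq> {1..d}" using ts by blast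
      then show "c \<in> R_set d \<and> {i, j} \<subseteq> {1..d}" using var[of k] R.uminus_closed[OF var[of k]] by blast
    qed
    from rho_id[OF subsetD[OF L_C this]] L_I[OF this]
    show "rho (\<Sum>(c, i, j)\<leftarrow>ts. Const c * entry d i j) \<in> ?I" by (simp only:)
  next
    fix q :: "'k wpoly" assume "q \<in> Lambda d"
    then have "W_to_S q \<in> LambdaS d" by (rule W_to_S_Lambda)
    from rho_id[OF subsetD[OF La_C this]] La_I[OF this] show "rho (W_to_S q) \<in> ?I" by (simp only:)
  qed
  have pC: "p \<in> ?C" and rees: "rees_map d p = 0" using p by (auto simp: J_ideal_eq simp del: atLeastAtMost_iff One_nat_def)
  obtain c where c: "\<And>v. c v \<in> (R_set d :: 'k rpoly set)" "(\<Sum>v\<in>w_index d. c v * gen d v) = 0"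
    "p - (\<Sum>v\<in>w_index d. Const (c v) * Var v) \<in> {p. rho p \<in> ?I}"
    by (rule reduce_to_linear[OF pC rees]) blast
  let ?l = "\<Sum>v\<in>w_index d. Const (c v) * Var v :: 'k spoly"
  obtain vs where vs: "set vs = w_index d" "distinct vs" using finite_distinct_list[OF finite_w_index] by blast
  define ts where "ts = map (\<lambda>v. (c v, fst v, snd v)) vs"
  have entry: "entry d (fst v) (snd v) = Var v" if "v \<in> w_index d" for v
    using that by (cases v) (auto simp: entry_def w_index_def)
  have "?l = (\<Sum>v\<leftarrow>vs. Const (c v) * entry d (fst v) (snd v))"
    unfolding vs(1)[symmetric] sum_list_distinct_conv_sum_set[OF vs(2)]
    by (rule sum.cong) (simp_all add: entry vs(1))
  also have "\<dots> = (\<Sum>(c, i, j)\<leftarrow>ts. Const c * entry d i j)" by (simp add: ts_def comp_def case_prod_unfold)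
  also have "\<dots> \<in> L_ideal d"
  proof (rule linear_syzygy_in_L)
    have "(\<Sum>(c, i, j)\<leftarrow>ts. c * quad d i j) = (\<Sum>v\<leftarrow>vs. c v * gen d v)"
      by (simp add: ts_def comp_def case_prod_unfold gen_eq_quad[symmetric])
    also have "\<dots> = 0" unfolding sum_list_distinct_conv_sum_set[OF vs(2)] vs(1) by (rule c(2))
    finally show "(\<Sum>(c, i, j)\<leftarrow>ts. c * quad d i j) = 0" .
    fix e i j assume "(e, i, j) \<in> set ts"
    then have "e = c (i, j)" "(i, j) \<in> w_index d" using vs(1) by (auto simp: ts_def)
    then show "e \<in> R_set d \<and> {i, j} \<subseteq> {1..d}" using c(1) by (auto simp: w_index_def simp del: One_nat_def)
  qed
  finally have l: "?l \<in> L_ideal d" .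
  then have "p - ?l \<in> ?C" using pC L_C S.diff_closed by blast
  then have "p - ?l \<in> ?I" using c(3) rho_id by auto
  from S.idealD(3)[OF I this L_I[OF l]] show ?thesis by (simp add: ring_simps)
qed

section \<open>Syzygies have no constant terms\<close>

lemma lookup_mult_homogeneous:
  fixes c g :: "('v, 'a::comm_ring_1) mpoly"
  assumes g: "\<And>m. m \<in> keys g \<Longrightarrow> size (mset_of m) = n" and b: "size (mset_of b) = n"
  shows "lookup (c * g) b = lookup c 0 * lookup g b"
proof (rule poly_mapping_single_induct[where p = c])
  fix m
  let ?s = "single m (lookup c m)"
  show "lookup (?s * g) b = lookup ?s 0 * lookup g b"
  proof (rule poly_mapping_single_induct[where p = g])
    fix k assume "k \<in> keys g"
    then have k: "size (mset_of k) = n" by (rule g)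
    have "m = 0" if "m + k = b"
    proof -
      have "size (mset_of m) = 0" using that k b by auto
      then have "keys m = {}" by (metis set_mset_of set_mset_empty size_eq_0_iff_empty)
      then show ?thesis by simp
    qed
    then show "lookup (?s * single k (lookup g k)) b =
        lookup ?s 0 * lookup (single k (lookup g k)) b"
      by (auto simp: mult_single lookup_single when_def)
  qed (simp_all add: distrib_left lookup_add)
qed (simp_all add: distrib_right lookup_add)

text \<open>The only monomial that several generators can share is the square of x_d, and the index
  \<open>(d, d)\<close> is excluded. Every other quadratic monomial identifies its
  generator.\<close>

lemma lookup_gen:
  assumes u: "(i, j) \<in> w_index d" and v: "v \<in> w_index d"
  shows "lookup (gen d v :: 'k::field rpoly) (single i 1 + single j 1) =
    (if v = (i, j) then 1 else 0)"
proof -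
  obtain k l where kl: "v = (k, l)" by fastforce
  have mult: "Var p * Var q = (single (single p 1 + single q 1) 1 :: 'k rpoly)" for p q
    by (simp add: Var_def mult_single)
  have eq: "single p 1 + single q 1 = single i 1 + single j (1::nat) \<longleftrightarrow>
      p = i \<and> q = j" if "p \<le> q" for p q
  proof
    assume "single p 1 + single q 1 = single i 1 + single j (1::nat)"
    then have "mset_of (single p 1 + single q 1) = mset_of (single i 1 + single j (1::nat))"
      by simp
    then have "{#p, q#} = {#i, j#}" by (simp add: add_mset_commute)
    then show "p = i \<and> q = j" using that u by (auto simp: add_eq_conv_ex w_index_def)
  qed simp
  have "k \<le> l" "(k, l) \<noteq> (d, d)" "(i, j) \<noteq> (d, d)" using u v by (auto simp: kl w_index_def)
  then show ?thesis
    using eq[of k l] eq[of k k] eq[of d d]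
    by (auto simp: kl gen_def power2_eq_square mult lookup_minus lookup_single when_def)
qed

text \<open>In degree 2 only the constant terms of the coefficients contribute, and the quadrics are
  linearly independent over the field. This is the minimality of the generating set.\<close>

lemma gen_independent_mod_vars:
  assumes zero: "(\<Sum>v\<in>w_index d. c v * gen d v) = (0 :: 'k::field rpoly)" and u: "u \<in> w_index d"
  shows "lookup (c u) 0 = 0"
proof -
  obtain i j where ij: "u = (i, j)" by fastforce
  let ?b = "single i 1 + single j (1::nat)"
  have "lookup (c v * gen d v) ?b = (if v = u then lookup (c v) 0 else 0)" if "v \<in> w_index d" for v
  proof -
    have "lookup (c v * gen d v) ?b = lookup (c v) 0 * lookup (gen d v) ?b"
      by (rule lookup_mult_homogeneous[where n = 2]) (use keys_gen(2)[OF that] in simp_all)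
    then show ?thesis using lookup_gen[of i j d v, where 'k = 'k] u that by (simp add: ij)
  qed
  then have "(\<Sum>v\<in>w_index d. lookup (c v * gen d v) ?b) = lookup (c u) 0"
    using u by (simp add: sum.delta)
  then show ?thesis using zero by (simp flip: lookup_sum)
qed

text \<open>Read in S, an element of I(X) is killed by the Rees map, hence congruent to a linear
  syzygy. Setting the x_i to 0 annihilates the syzygy, whose coefficients have no constant term, and
  returns the element itself, now seen to lie in \<open>Lambda d\<close>.\<close>

lemma reduce_IX:
  assumes d: "4 \<le> d" and p: "p \<in> (IX_ideal d :: 'k::field wpoly set)"
  shows "p \<in> Lambda d"
proof -
  let ?C = "(W_set d :: 'k wpoly set)"
  interpret W: subring_of_type ?C by (rule subring_W)
  define z :: "'k rpoly \<Rightarrow> 'k" where "z = eval_mpoly (\<lambda>a. a) (\<lambda>_. 0)"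
  interpret z: type_hom z unfolding z_def by (rule type_hom.type_hom_eval[OF type_hom_id])
  have z_simps: "z (Const a) = a" "z (Var i) = 0" for a i
    unfolding z_def by (simp_all add: type_hom.eval_Var[OF type_hom_id] type_hom.eval_Const[OF type_hom_id])
  have z_lookup: "z c = lookup c 0" for c
  proof -
    have "monom_eval (\<lambda>_. 0 :: 'k) m = (if m = 0 then 1 else 0)" for m :: "nat \<Rightarrow>\<^sub>0 nat"
    proof (cases "m = 0")
      case False
      then obtain v where "v \<in> keys m" using keys_eq_empty[of m] by blast
      then show ?thesis using False by (auto simp: monom_eval_def in_keys_iff intro!: prod_zero)
    qed simp
    then have "z c = (\<Sum>m\<in>keys c. if m = 0 then lookup c 0 else 0)"
      unfolding z_def eval_mpoly_lincomb lincomb_def by (intro sum.cong) auto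
    then show ?thesis by (simp add: sum.delta in_keys_iff)
  qed
  define rho :: "'k spoly \<Rightarrow> 'k wpoly" where
    "rho = eval_mpoly (\<lambda>c. Const (z c)) (\<lambda>v. if v \<in> w_index d then Var v else 0)"
  have zc: "type_hom (\<lambda>c. Const (z c) :: 'k wpoly)"
    by (rule type_hom_comp[OF z.type_hom_axioms type_hom_Const])
  interpret rho: type_hom rho unfolding rho_def by (rule type_hom.type_hom_eval[OF zc])
  have rho_simps: "rho (Const c) = Const (z c)" "rho (Var v) = (if v \<in> w_index d then Var v else 0)" for c v
    unfolding rho_def by (simp_all add: type_hom.eval_Var[OF zc] type_hom.eval_Const[OF zc])
  have Const_0: "Const 0 = (0 :: 'k wpoly)" by (simp add: Const_def)
  have image: "rho p \<in> ?C" for p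
    unfolding rho_def by (rule W.eval_closed) (use W.zero_closed in \<open>auto intro!: Const_in_polys Var_in_polys\<close>)
  have rho_W: "rho (W_to_S p) = p" if "p \<in> ?C" for p
  proof -
    have "rho (W_to_S p) = eval_mpoly Const (\<lambda>v. if v \<in> w_index d then Var v else 0) p"
      by (rule type_hom_eqI[OF type_hom_comp[OF type_hom_W_to_S rho.type_hom_axioms] type_hom.type_hom_eval[OF type_hom_Const]])
         (simp_all add: rho_simps z_simps type_hom.eval_Var[OF type_hom_Const] type_hom.eval_Const[OF type_hom_Const])
    also have "\<dots> = eval_mpoly Const Var p"
      by (rule eval_cong) (use that in \<open>auto simp: polys_def\<close>)
    finally show ?thesis by simp
  qed
  have Lambda_C: "Lambda d \<subseteq> ?C" by (rule W.idealD(1)[OF Lambda_ideal])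
  interpret fiber_relations d "{p. rho p \<in> Lambda d}"
  proof (rule fiber_relations_vimage[OF d subring_W Lambda_ideal rho.type_hom_axioms image])
    fix ts :: "('k rpoly \<times> nat \<times> nat) list"
    assume ts: "\<And>c i j. (c, i, j) \<in> set ts \<Longrightarrow> (\<exists>k\<in>{1..d}. c = Var k \<or> c = - Var k) \<and> {i, j} \<subseteq> {1..d}"
    have "rho (\<Sum>(c, i, j)\<leftarrow>us. Const c * entry d i j) = 0" if "set us \<subseteq> set ts" for us
      using that
    proof (induction us)
      case (Cons t us)
      obtain c i j where t: "t = (c, i, j)" by (metis prod_cases3)
      then have "z c = 0" using ts[of c i j] Cons.prems by (auto simp: z_simps)
      then show ?case using Cons t by (simp add: rho_simps Const_0)
    qed simp
    then show "rho (\<Sum>(c, i, j)\<leftarrow>ts. Const c * entry d i j) \<in> Lambda d"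
      using W.idealD(2)[OF Lambda_ideal] by simp
  next
    fix q :: "'k wpoly" assume "q \<in> Lambda d"
    from rho_W[OF subsetD[OF Lambda_C this]] this show "rho (W_to_S q) \<in> Lambda d" by (simp only:)
  qed
  have pC: "p \<in> ?C" and rees: "rees_map d (W_to_S p) = 0" using p by (auto simp: IX_ideal_eq fiber_eval_def)
  obtain c where "\<And>v. c v \<in> (R_set d :: 'k rpoly set)" and c: "(\<Sum>v\<in>w_index d. c v * gen d v) = (0 :: 'k rpoly)"
    "W_to_S p - (\<Sum>v\<in>w_index d. Const (c v) * Var v) \<in> {p. rho p \<in> Lambda d}"
    by (rule reduce_to_linear[OF W_to_S_in_S[OF pC] rees]) blast
  have "rho (\<Sum>v\<in>w_index d. Const (c v) * Var v) = 0"
    unfolding rho.hom_sum using gen_independent_mod_vars[OF c(1)]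
    by (intro sum.neutral) (simp add: rho_simps z_lookup Const_0)
  then show ?thesis using c(2) rho_W[OF pC] by simp
qed

theorem theorem4p3:
  fixes d :: nat
  assumes "4 \<le> d"
  shows "Lambda d = (IX_ideal d :: (nat \<times> nat, 'k::field_char_0) mpoly set) \<and>
         (J_ideal d :: (nat \<times> nat, (nat, 'k) mpoly) mpoly set) = L_ideal d <+>\<^bsub>S_ring d\<^esub> LambdaS d"
proof (rule conjI)
  show "Lambda d = (IX_ideal d :: (nat \<times> nat, 'k) mpoly set)"
  proof (rule equalityI)
    show "Lambda d \<subseteq> (IX_ideal d :: (nat \<times> nat, 'k) mpoly set)" by (rule Lambda_subset_IX)
    show "(IX_ideal d :: (nat \<times> nat, 'k) mpoly set) \<subseteq> Lambda d" by (rule subsetI, rule reduce_IX[OF assms])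
  qed
  show "(J_ideal d :: 'k spoly set) = L_ideal d <+>\<^bsub>S_ring d\<^esub> LambdaS d"
  proof (rule equalityI)
    show "(J_ideal d :: 'k spoly set) \<subseteq> L_ideal d <+>\<^bsub>S_ring d\<^esub> LambdaS d"
      by (rule subsetI, rule reduce_J[OF assms])
    show "L_ideal d <+>\<^bsub>S_ring d\<^esub> LambdaS d \<subseteq> (J_ideal d :: 'k spoly set)"
      unfolding ring_simps(3)
      by (rule subring_of_type.set_add_least[OF subring_S ideal_J[unfolded ring_simps(3)] L_subset_J LambdaS_subset_J])
  qed
qed

end
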